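(* Let $\mathbb{P}$ be a simplicial complement, $K_{\mathbb{P}}$ the simplicial complex corresponding to $\mathbb{P}$, and $\omega\subset[m]$ a subset. Then: (1) $\mathrm{star}_{K_{\mathbb{P}}}\omega=K_{E_\omega\mathbb{P}}$, the simplicial complex corresponding to the simplicial complement $E_\omega\mathbb{P}$. Thus, for all $q$ and all $\sigma\subset[m]$, $$H_{q,\sigma}(\Lambda^{*,\sigma}[E_\omega\mathbb{P}],d)=\mathrm{Tor}^{\mathbf{k}[\mathbf{x}]}_{q,\sigma}(\mathbf{k}(\mathrm{star}_{K_{\mathbb{P}}}\omega),\mathbf{k}).$$ (2) $\mathrm{link}_{K_{\mathbb{P}}}\omega=K_{E_\omega\mathbb{P}}\cap([m]\setminus\omega)$, and for all $q$ $$H_{q,[m]\setminus\omega}(\Lambda^{*,[m]\setminus\omega}[E_\omega\mathbb{P}],d)=\widetilde{H}^{m-|\omega|-q-1}(\mathrm{link}_{K_{\mathbb{P}}}\omega,\mathbf{k}).$$ (Equalities of homology modules mean isomorphisms of $\mathbf{k}$-modules.)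
   Context: $\mathbf{k}$ is a principal ideal domain, $[m]=\{1,\dots,m\}$, $\mathbf{k}[\mathbf{x}]=\mathbf{k}[x_1,\dots,x_m]$ with its $\mathbb{N}^m$-grading, and $\mathbf{k}$ is a $\mathbf{k}[\mathbf{x}]$-module with all $x_i$ acting as $0$. For $\sigma\subset[m]$, $\mathbf{x}_\sigma=\prod_{i\in\sigma}x_i$. A simplicial complement is a finite sequence $\mathbb{P}=\{\sigma_1,\dots,\sigma_s\}$ of subsets of $[m]$. $K_{\mathbb{P}}$ is the abstract simplicial complex on $[m]$ whose non-faces are exactly the subsets of $[m]$ containing some $\sigma_i$ (void if some $\sigma_i=\emptyset$). The $\omega$-compression is $E_\omega\mathbb{P}=\{\sigma_1\setminus\omega,\dots,\sigma_s\setminus\omega\}$ (again a sequence of length $s$). Define $\mathrm{star}_{K}\omega=\{\tau\in K\mid\tau\cup\omega\in K\}$ and $\mathrm{link}_{K}\omega=\{\tau\in K\mid\tau\cup\omega\in K,\ \tau\cap\omega=\emptyset\}$. For $\sigma\subset[m]$, $K\cap\sigma=\{\tau\cap\sigma\mid\tau\in K\}$ is the full subcomplex on $\sigma$. $\mathbf{k}(K)=\mathbf{k}[\mathbf{x}]/\langle\mathbf{x}_\sigma:\sigma\notin K\rangle$ is the Stanley–Reisner face ring. Reduced cohomology is that of the augmented cochain complex, so $\widetilde H^{-1}(\{\emptyset\},\mathbf{k})=\mathbf{k}$ and the void complex has zero reduced cohomology. For a simplicial complement $\mathbb{Q}=\{\rho_1,\dots,\rho_s\}$, $\Lambda[\mathbb{Q}]$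 is the exterior algebra over $\mathbf{k}$ on formal generators $\rho_1,\dots,\rho_s$ (distinct even if some subsets coincide), with $\mathbf{k}$-module generators $\mathbf{u}=\rho_{k_1}\cdots\rho_{k_q}$, $k_1<\dots<k_q$ (including $1$), total subset $S_{\mathbf{u}}=\rho_{k_1}\cup\dots\cup\rho_{k_q}$ ($S_1=\emptyset$), and bidegree $(q,S_{\mathbf{u}})$. The differential is $d(\mathbf{u})=\sum_i(-1)^i\partial_i(\mathbf{u})\,\delta_{\partial_i(\mathbf{u})}$, where $\partial_i(\mathbf{u})$ omits $\rho_{k_i}$ and $\delta_{\partial_i(\mathbf{u})}=1$ if $S_{\partial_i(\mathbf{u})}=S_{\mathbf{u}}$, $0$ otherwise. $\Lambda^{*,\sigma}[\mathbb{Q}]$ is the subcomplex spanned by generators with total subset $\sigma$; $H_{q,\sigma}$ is its homology in degree $q$. $\mathrm{Tor}_{q,\sigma}$ is the component of $\mathrm{Tor}_q$ of $\mathbb{N}^m$-degree equal to the exponent vector of $\mathbf{x}_\sigma$. *)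

theory Defs
  imports "HOL-Library.Poly_Mapping" "HOL-Algebra.QuotRing" "HOL-Algebra.Ring_Divisibility" "HOL-Algebra.Generated_Groups"
begin

section \<open>Modules over a commutative ring\<close>

text \<open>
  HOL-Algebra modules are records extending rings, so every module built below carries irrelevant
  \<open>mult\<close> and \<open>one\<close> fields; these are left \<open>undefined\<close>.
\<close>

definition linear_map ::
  "('r, 's) ring_scheme \<Rightarrow> ('r, 'a, 'u) module_scheme \<Rightarrow> ('r, 'b, 'v) module_scheme \<Rightarrow> ('a \<Rightarrow> 'b) \<Rightarrow> bool"
  where "linear_map R M N f \<longleftrightarrow>
    f \<in> carrier M \<rightarrow> carrier N \<and>
    (\<forall>x\<in>carrier M. \<forall>y\<in>carrier M. f (x \<oplus>\<^bsub>M\<^esub> y) = f x \<oplus>\<^bsub>N\<^esub> f y) \<and>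
    (\<forall>r\<in>carrier R. \<forall>x\<in>carrier M. f (r \<odot>\<^bsub>M\<^esub> x) = r \<odot>\<^bsub>N\<^esub> f x)"

definition module_isomorphic ::
  "('r, 's) ring_scheme \<Rightarrow> ('r, 'a, 'u) module_scheme \<Rightarrow> ('r, 'b, 'v) module_scheme \<Rightarrow> bool"
  where "module_isomorphic R M N \<longleftrightarrow>
    (\<exists>f. linear_map R M N f \<and> bij_betw f (carrier M) (carrier N))"

definition quotient_module :: "('r, 'a, 'u) module_scheme \<Rightarrow> 'a set \<Rightarrow> ('r, 'a set) module"
  where "quotient_module M H =
    \<lparr>carrier = a_rcosets\<^bsub>M\<^esub> H, mult = undefined, one = undefined, zero = H, add = set_add M,
     smult = (\<lambda>r S. \<Union>x\<in>S. H +>\<^bsub>M\<^esub> (r \<odot>\<^bsub>M\<^esub> x))\<rparr>"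

definition generated_submodule ::
  "('r, 's) ring_scheme \<Rightarrow> ('r, 'a) module \<Rightarrow> 'a set \<Rightarrow> 'a set"
  where "generated_submodule R M S = \<Inter>{H. submodule H R M \<and> S \<subseteq> H}"

definition free_module :: "('r, 's) ring_scheme \<Rightarrow> 'x set \<Rightarrow> ('r, 'x \<Rightarrow> 'r) module"
  where "free_module R S =
    \<lparr>carrier = {f. (\<forall>x\<in>S. f x \<in> carrier R) \<and> (\<forall>x. x \<notin> S \<longrightarrow> f x = \<zero>\<^bsub>R\<^esub>) \<and> finite {x. f x \<noteq> \<zero>\<^bsub>R\<^esub>}},
     mult = undefined, one = undefined, zero = (\<lambda>x. \<zero>\<^bsub>R\<^esub>),
     add = (\<lambda>f g x. f x \<oplus>\<^bsub>R\<^esub> g x), smult = (\<lambda>r f x. r \<otimes>\<^bsub>R\<^esub> f x)\<rparr>"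

definition free_gen :: "('r, 's) ring_scheme \<Rightarrow> 'x \<Rightarrow> 'x \<Rightarrow> 'r"
  where "free_gen R x = (\<lambda>y. if y = x then \<one>\<^bsub>R\<^esub> else \<zero>\<^bsub>R\<^esub>)"

text \<open>
  A sequence \<open>C 0 \<leftarrow> C 1 \<leftarrow> \<dots>\<close> with \<open>d n\<close> going from \<open>C (Suc n)\<close> to \<open>C n\<close>.
\<close>

definition cycles :: "(nat \<Rightarrow> ('r, 'a, 'u) module_scheme) \<Rightarrow> (nat \<Rightarrow> 'a \<Rightarrow> 'a) \<Rightarrow> nat \<Rightarrow> 'a set"
  where "cycles C d q =
    (case q of 0 \<Rightarrow> carrier (C 0) | Suc n \<Rightarrow> {x \<in> carrier (C (Suc n)). d n x = \<zero>\<^bsub>C n\<^esub>})"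

definition homology ::
  "(nat \<Rightarrow> ('r, 'a, 'u) module_scheme) \<Rightarrow> (nat \<Rightarrow> 'a \<Rightarrow> 'a) \<Rightarrow> nat \<Rightarrow> ('r, 'a set) module"
  where "homology C d q =
    quotient_module ((C q)\<lparr>carrier := cycles C d q\<rparr>) (d q ` carrier (C (Suc q)))"


subsection \<open>Tensor products\<close>

definition tensor_free ::
  "('r, 's) ring_scheme \<Rightarrow> ('r, 'a, 'u) module_scheme \<Rightarrow> ('r, 'b, 'v) module_scheme \<Rightarrow> ('r, 'a \<times> 'b \<Rightarrow> 'r) module"
  where "tensor_free R M N = free_module R (carrier M \<times> carrier N)"

definition tensor_relators ::
  "('r, 's) ring_scheme \<Rightarrow> ('r, 'a, 'u) module_scheme \<Rightarrow> ('r, 'b, 'v) module_scheme \<Rightarrow> ('a \<times> 'b \<Rightarrow> 'r) set"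
  where "tensor_relators R M N = (let T = tensor_free R M N; e = (\<lambda>x y. free_gen R (x, y)) in
    {e (x \<oplus>\<^bsub>M\<^esub> x') y \<ominus>\<^bsub>T\<^esub> (e x y \<oplus>\<^bsub>T\<^esub> e x' y) | x x' y.
       x \<in> carrier M \<and> x' \<in> carrier M \<and> y \<in> carrier N} \<union>
    {e x (y \<oplus>\<^bsub>N\<^esub> y') \<ominus>\<^bsub>T\<^esub> (e x y \<oplus>\<^bsub>T\<^esub> e x y') | x y y'.
       x \<in> carrier M \<and> y \<in> carrier N \<and> y' \<in> carrier N} \<union>
    {e (r \<odot>\<^bsub>M\<^esub> x) y \<ominus>\<^bsub>T\<^esub> r \<odot>\<^bsub>T\<^esub> e x y | r x y.
       r \<in> carrier R \<and> x \<in> carrier M \<and> y \<in> carrier N} \<union>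
    {e x (r \<odot>\<^bsub>N\<^esub> y) \<ominus>\<^bsub>T\<^esub> r \<odot>\<^bsub>T\<^esub> e x y | r x y.
       r \<in> carrier R \<and> x \<in> carrier M \<and> y \<in> carrier N})"

definition tensor_kernel ::
  "('r, 's) ring_scheme \<Rightarrow> ('r, 'a, 'u) module_scheme \<Rightarrow> ('r, 'b, 'v) module_scheme \<Rightarrow> ('a \<times> 'b \<Rightarrow> 'r) set"
  where "tensor_kernel R M N = generated_submodule R (tensor_free R M N) (tensor_relators R M N)"

definition tensor_product ::
  "('r, 's) ring_scheme \<Rightarrow> ('r, 'a, 'u) module_scheme \<Rightarrow> ('r, 'b, 'v) module_scheme \<Rightarrow> ('r, ('a \<times> 'b \<Rightarrow> 'r) set) module"
  where "tensor_product R M N = quotient_module (tensor_free R M N) (tensor_kernel R M N)"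

definition pure_tensor ::
  "('r, 's) ring_scheme \<Rightarrow> ('r, 'a, 'u) module_scheme \<Rightarrow> ('r, 'b, 'v) module_scheme \<Rightarrow> 'a \<Rightarrow> 'b \<Rightarrow> ('a \<times> 'b \<Rightarrow> 'r) set"
  where "pure_tensor R M N x y = tensor_kernel R M N +>\<^bsub>tensor_free R M N\<^esub> free_gen R (x, y)"

text \<open>
  For a linear map \<open>f\<close> from \<open>M\<close> to \<open>M'\<close>, the induced map \<open>f \<otimes> id\<close> from \<open>M \<otimes> N\<close> to \<open>M' \<otimes> N\<close>:
  a coset is sent to the (common) class of the images \<open>\<Sum> z(x, y) (f x, y)\<close> of its elements
  \<open>z = \<Sum> z(x, y) (x, y)\<close>.
\<close>

definition tensor_map ::
  "('r, 's) ring_scheme \<Rightarrow> ('r, 'a, 'u) module_scheme \<Rightarrow> ('r, 'c, 'w) module_scheme \<Rightarrow> ('r, 'b, 'v) module_scheme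
    \<Rightarrow> ('a \<Rightarrow> 'c) \<Rightarrow> ('a \<times> 'b \<Rightarrow> 'r) set \<Rightarrow> ('c \<times> 'b \<Rightarrow> 'r) set"
  where "tensor_map R M M' N f S = (let T' = tensor_free R M' N in
    \<Union>z\<in>S. tensor_kernel R M' N +>\<^bsub>T'\<^esub>
      (\<Oplus>\<^bsub>T'\<^esub>p\<in>{p. z p \<noteq> \<zero>\<^bsub>R\<^esub>}. z p \<odot>\<^bsub>T'\<^esub> free_gen R (f (fst p), snd p)))"


section \<open>The polynomial ring and its graded modules\<close>

type_synonym expo = "nat \<Rightarrow>\<^sub>0 nat"
type_synonym 'k mpoly = "(nat \<Rightarrow>\<^sub>0 nat) \<Rightarrow>\<^sub>0 'k"

definition coeff_ring :: "'k::comm_ring_1 ring"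
  where "coeff_ring = \<lparr>carrier = UNIV, mult = (*), one = 1, zero = 0, add = (+)\<rparr>"

text \<open>The grading monoid \<open>\<nat>\<^sup>m\<close>, as exponent vectors supported on \<open>{1..m}\<close>.\<close>

definition degrees :: "nat \<Rightarrow> expo set"
  where "degrees m = {a. Poly_Mapping.keys a \<subseteq> {1..m}}"

definition mpoly_ring :: "nat \<Rightarrow> 'k::comm_ring_1 mpoly ring"
  where "mpoly_ring m =
    \<lparr>carrier = {p. Poly_Mapping.keys p \<subseteq> degrees m}, mult = (*), one = 1, zero = 0, add = (+)\<rparr>"

definition term_poly :: "expo \<Rightarrow> 'k \<Rightarrow> 'k::comm_ring_1 mpoly"
  where "term_poly a c = Poly_Mapping.single a c"

definition squarefree_expo :: "nat set \<Rightarrow> expo"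
  where "squarefree_expo \<sigma> = (\<Sum>i\<in>\<sigma>. Poly_Mapping.single i 1)"

definition squarefree_monomial :: "nat set \<Rightarrow> 'k::comm_ring_1 mpoly"
  where "squarefree_monomial \<sigma> = term_poly (squarefree_expo \<sigma>) 1"

record ('r, 'a) graded_module = "('r, 'a) module" +
  homog :: "expo \<Rightarrow> 'a set"

text \<open>
  An \<open>\<nat>\<^sup>m\<close>-graded module over the polynomial ring; the values of \<open>homog\<close> outside
  \<open>degrees m\<close> play no role.
\<close>

definition graded_module :: "nat \<Rightarrow> ('k::comm_ring_1 mpoly, 'a) graded_module \<Rightarrow> bool"
  where "graded_module m M \<longleftrightarrow>
    Module.module (mpoly_ring m) M \<and>
    (\<forall>a\<in>degrees m. additive_subgroup (homog M a) M) \<and>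
    (\<forall>a\<in>degrees m. \<forall>b\<in>degrees m. \<forall>c. \<forall>x\<in>homog M b. term_poly a c \<odot>\<^bsub>M\<^esub> x \<in> homog M (a + b)) \<and>
    (\<forall>x\<in>carrier M. \<exists>!u. (\<forall>a\<in>degrees m. u a \<in> homog M a) \<and> (\<forall>a. a \<notin> degrees m \<longrightarrow> u a = \<zero>\<^bsub>M\<^esub>) \<and>
       finite {a. u a \<noteq> \<zero>\<^bsub>M\<^esub>} \<and> x = (\<Oplus>\<^bsub>M\<^esub>a\<in>{a. u a \<noteq> \<zero>\<^bsub>M\<^esub>}. u a))"

definition graded_map ::
  "nat \<Rightarrow> ('k::comm_ring_1 mpoly, 'a) graded_module \<Rightarrow> ('k mpoly, 'b) graded_module \<Rightarrow> ('a \<Rightarrow> 'b) \<Rightarrow> bool"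
  where "graded_map m M N f \<longleftrightarrow>
    linear_map (mpoly_ring m) M N f \<and> (\<forall>a\<in>degrees m. f ` homog M a \<subseteq> homog N a)"

definition graded_free :: "nat \<Rightarrow> ('k::comm_ring_1 mpoly, 'a) graded_module \<Rightarrow> bool"
  where "graded_free m M \<longleftrightarrow> graded_module m M \<and>
    (\<exists>B. B \<subseteq> (\<Union>a\<in>degrees m. homog M a) \<and>
      (\<forall>x\<in>carrier M. \<exists>!c. c \<in> carrier (free_module (mpoly_ring m) B) \<and>
         x = (\<Oplus>\<^bsub>M\<^esub>b\<in>{b. c b \<noteq> 0}. c b \<odot>\<^bsub>M\<^esub> b)))"

text \<open>
  \<open>\<dots> \<rightarrow> F 2 \<rightarrow> F 1 \<rightarrow> F 0 \<rightarrow> M \<rightarrow> 0\<close> exact, with \<open>d n\<close> going from \<open>F (Suc n)\<close> to \<open>F n\<close> and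
  \<open>\<epsilon>\<close> from \<open>F 0\<close> to \<open>M\<close>.
\<close>

definition graded_free_resolution ::
  "nat \<Rightarrow> ('k::comm_ring_1 mpoly, 'a) graded_module \<Rightarrow> (nat \<Rightarrow> ('k mpoly, 'f) graded_module)
    \<Rightarrow> (nat \<Rightarrow> 'f \<Rightarrow> 'f) \<Rightarrow> ('f \<Rightarrow> 'a) \<Rightarrow> bool"
  where "graded_free_resolution m M F d \<epsilon> \<longleftrightarrow>
    (\<forall>n. graded_free m (F n)) \<and>
    (\<forall>n. graded_map m (F (Suc n)) (F n) (d n)) \<and>
    graded_map m (F 0) M \<epsilon> \<and>
    \<epsilon> ` carrier (F 0) = carrier M \<and>
    d 0 ` carrier (F 1) = {x \<in> carrier (F 0). \<epsilon> x = \<zero>\<^bsub>M\<^esub>} \<and>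
    (\<forall>n. d (Suc n) ` carrier (F (Suc (Suc n))) = {x \<in> carrier (F (Suc n)). d n x = \<zero>\<^bsub>F n\<^esub>})"

text \<open>
  The component of degree \<open>a\<close> of \<open>M \<otimes> N\<close> is spanned by the \<open>x \<otimes> y\<close> with \<open>deg x + deg y = a\<close>.
  It is regarded as a module over the ring of coefficients, whose elements act as constant
  polynomials.
\<close>

definition tensor_component ::
  "nat \<Rightarrow> ('k::comm_ring_1 mpoly, 'a) graded_module \<Rightarrow> ('k mpoly, 'b) graded_module \<Rightarrow> expo
    \<Rightarrow> ('k, ('a \<times> 'b \<Rightarrow> 'k mpoly) set) module"
  where "tensor_component m M N a = (let T = tensor_product (mpoly_ring m) M N in
    \<lparr>carrier = generate (add_monoid T)
       {pure_tensor (mpoly_ring m) M N x y | x y b c.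
          b \<in> degrees m \<and> c \<in> degrees m \<and> b + c = a \<and> x \<in> homog M b \<and> y \<in> homog N c},
     mult = undefined, one = undefined, zero = \<zero>\<^bsub>T\<^esub>, add = add T,
     smult = (\<lambda>c z. term_poly 0 c \<odot>\<^bsub>T\<^esub> z)\<rparr>)"

text \<open>
  The component of degree \<open>a\<close> of \<open>Tor\<^sub>q(M, N)\<close>, computed as the homology of \<open>F \<otimes> N\<close> for a graded
  free resolution \<open>(F, d)\<close> of \<open>M\<close>. Up to isomorphism it does not depend on the resolution, so a statement
  about Tor is made for an arbitrary \<open>F\<close>, over an arbitrary type.
\<close>

definition Tor_component ::
  "nat \<Rightarrow> (nat \<Rightarrow> ('k::comm_ring_1 mpoly, 'f) graded_module) \<Rightarrow> (nat \<Rightarrow> 'f \<Rightarrow> 'f)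
    \<Rightarrow> ('k mpoly, 'b) graded_module \<Rightarrow> nat \<Rightarrow> expo \<Rightarrow> ('k, ('f \<times> 'b \<Rightarrow> 'k mpoly) set set) module"
  where "Tor_component m F d N q a =
    homology (\<lambda>n. tensor_component m (F n) N a)
      (\<lambda>n. tensor_map (mpoly_ring m) (F (Suc n)) (F n) N (d n)) q"

text \<open>The ring of coefficients as a graded module on which all variables act as \<open>0\<close>.\<close>

definition trivial_module :: "('k::comm_ring_1 mpoly, 'k) graded_module"
  where "trivial_module =
    \<lparr>carrier = UNIV, mult = undefined, one = undefined, zero = 0, add = (+),
     smult = (\<lambda>p c. Poly_Mapping.lookup p 0 * c), homog = (\<lambda>a. if a = 0 then UNIV else {0})\<rparr>"


section \<open>Simplicial complexes\<close>

definition simplicial_complement :: "nat \<Rightarrow> nat set list \<Rightarrow> bool"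
  where "simplicial_complement m P \<longleftrightarrow> (\<forall>\<rho>\<in>set P. \<rho> \<subseteq> {1..m})"

definition complex_of :: "nat \<Rightarrow> nat set list \<Rightarrow> nat set set"
  where "complex_of m P = {\<tau>. \<tau> \<subseteq> {1..m} \<and> \<not> (\<exists>\<rho>\<in>set P. \<rho> \<subseteq> \<tau>)}"

definition compression :: "nat set \<Rightarrow> nat set list \<Rightarrow> nat set list"
  where "compression \<omega> P = map (\<lambda>\<rho>. \<rho> - \<omega>) P"

definition star :: "nat set set \<Rightarrow> nat set \<Rightarrow> nat set set"
  where "star K \<omega> = {\<tau> \<in> K. \<tau> \<union> \<omega> \<in> K}"

definition link :: "nat set set \<Rightarrow> nat set \<Rightarrow> nat set set"
  where "link K \<omega> = {\<tau> \<in> K. \<tau> \<union> \<omega> \<in> K \<and> \<tau> \<inter> \<omega> = {}}"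

definition full_subcomplex :: "nat set set \<Rightarrow> nat set \<Rightarrow> nat set set"
  where "full_subcomplex K \<sigma> = {\<tau> \<inter> \<sigma> | \<tau>. \<tau> \<in> K}"

definition Stanley_Reisner_ideal :: "nat \<Rightarrow> nat set set \<Rightarrow> 'k::comm_ring_1 mpoly set"
  where "Stanley_Reisner_ideal m K =
    genideal (mpoly_ring m) {squarefree_monomial \<sigma> | \<sigma>. \<sigma> \<subseteq> {1..m} \<and> \<sigma> \<notin> K}"

text \<open>The face ring, as a graded module over the polynomial ring.\<close>

definition face_ring :: "nat \<Rightarrow> nat set set \<Rightarrow> ('k::comm_ring_1 mpoly, 'k mpoly set) graded_module"
  where "face_ring m K =
    (let R = mpoly_ring m; I = Stanley_Reisner_ideal m K; Q = R Quot I in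
    \<lparr>carrier = carrier Q, mult = mult Q, one = one Q, zero = zero Q, add = add Q,
     smult = (\<lambda>p S. (I +>\<^bsub>R\<^esub> p) \<otimes>\<^bsub>Q\<^esub> S), homog = (\<lambda>a. range (\<lambda>c. I +>\<^bsub>R\<^esub> term_poly a c))\<rparr>)"

text \<open>
  The augmented cochain complex with faces oriented by the order of the vertices, in all integer
  degrees: the empty face has degree \<open>-1\<close>, and there are no cochains in degrees below \<open>-1\<close>.
\<close>

definition cochains :: "nat set set \<Rightarrow> int \<Rightarrow> ('k::comm_ring_1, nat set \<Rightarrow> 'k) module"
  where "cochains K p = free_module coeff_ring {\<tau> \<in> K. int (card \<tau>) = p + 1}"

definition coboundary :: "nat set set \<Rightarrow> int \<Rightarrow> (nat set \<Rightarrow> 'k::comm_ring_1) \<Rightarrow> nat set \<Rightarrow> 'k"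
  where "coboundary K p f \<tau> =
    (if \<tau> \<in> K \<and> int (card \<tau>) = p + 2
     then \<Sum>i<card \<tau>. (-1) ^ i * f (\<tau> - {sorted_list_of_set \<tau> ! i}) else 0)"

definition reduced_cohomology :: "nat set set \<Rightarrow> int \<Rightarrow> ('k::comm_ring_1, (nat set \<Rightarrow> 'k) set) module"
  where "reduced_cohomology K p =
    quotient_module
      ((cochains K p)\<lparr>carrier := {f \<in> carrier (cochains K p). coboundary K p f = \<zero>\<^bsub>cochains K (p + 1)\<^esub>}\<rparr>)
      (coboundary K (p - 1) ` carrier (cochains K (p - 1)))"


section \<open>The complex of a simplicial complement\<close>

text \<open>
  A generator \<open>\<rho>\<^bsub>k\<^sub>1\<^esub> \<cdots> \<rho>\<^bsub>k\<^sub>q\<^esub>\<close> of the exterior algebra on the members of a sequence \<open>Q\<close> is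
  represented by the strictly increasing list of its indices. List positions are counted from
  \<open>0\<close>, whence the sign \<open>(-1) ^ Suc i\<close> of the differential.
\<close>

definition total_subset :: "nat set list \<Rightarrow> nat list \<Rightarrow> nat set"
  where "total_subset Q u = (\<Union>k\<in>set u. Q ! k)"

definition \<Lambda>_gens :: "nat set list \<Rightarrow> nat \<Rightarrow> nat set \<Rightarrow> nat list set"
  where "\<Lambda>_gens Q q \<sigma> =
    {u. sorted_wrt (<) u \<and> set u \<subseteq> {..<length Q} \<and> length u = q \<and> total_subset Q u = \<sigma>}"

definition omit :: "nat \<Rightarrow> nat list \<Rightarrow> nat list"
  where "omit i u = take i u @ drop (Suc i) u"

definition \<Lambda>_diff_gen :: "nat set list \<Rightarrow> nat list \<Rightarrow> nat list \<Rightarrow> 'k::comm_ring_1"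
  where "\<Lambda>_diff_gen Q u = (\<lambda>v. \<Sum>i<length u.
    (-1) ^ Suc i * (if total_subset Q (omit i u) = total_subset Q u then 1 else 0)
      * free_gen coeff_ring (omit i u) v)"

definition \<Lambda>_diff :: "nat set list \<Rightarrow> (nat list \<Rightarrow> 'k::comm_ring_1) \<Rightarrow> nat list \<Rightarrow> 'k"
  where "\<Lambda>_diff Q f = (\<lambda>v. \<Sum>u\<in>{u. f u \<noteq> 0}. f u * \<Lambda>_diff_gen Q u v)"

definition \<Lambda>_component :: "nat set list \<Rightarrow> nat set \<Rightarrow> nat \<Rightarrow> ('k::comm_ring_1, nat list \<Rightarrow> 'k) module"
  where "\<Lambda>_component Q \<sigma> q = free_module coeff_ring (\<Lambda>_gens Q q \<sigma>)"

definition \<Lambda>_homology :: "nat set list \<Rightarrow> nat \<Rightarrow> nat set \<Rightarrow> ('k::comm_ring_1, (nat list \<Rightarrow> 'k) set) module"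
  where "\<Lambda>_homology Q q \<sigma> = homology (\<Lambda>_component Q \<sigma>) (\<lambda>_. \<Lambda>_diff Q) q"

end

theory Submission
  imports Defs "HOL-Library.Function_Algebras"
begin

text \<open>
  Setting all variables to \<open>1\<close> turns a graded free resolution of a face ring \<open>k(K)\<close>, restricted to
  squarefree degrees, into a complex of free \<open>k\<close>-modules filtered by the subsets of \<open>{1..m}\<close>, exact in
  each filtration degree; its component of \<open>F \<otimes> k\<close> of degree \<open>\<sigma>\<close> is the associated graded complex
  at \<open>\<sigma>\<close>. Lifting along exactness gives filtered chain maps between any two such complexes, inverse to
  each other up to filtered homotopy, so that the homology of the associated graded complex depends
  only on \<open>K\<close>. The complex \<open>\<Lambda>[Q]\<close> arises in this way from the full simplex on the members of \<open>Q\<close>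
  (Taylor's resolution), the cochains of the full subcomplexes of \<open>K\<close> from the cellular complexes of
  cubes, and Tor from the given resolution. Comparing Taylor's resolution with the other two for
  \<open>Q = E\<^sub>\<omega> P\<close> yields both isomorphisms.
\<close>

section \<open>Finitely supported chains\<close>

text \<open>Tor is stated for an arbitrary resolution over an arbitrary type, so nothing about
  \<open>F\<close> can be chosen, and isomorphisms have to come from comparing resolutions. Only
  squarefree degrees matter: a basis element of degree \<open>e\<close> reaches degree \<sigma> of
  \<open>F\<close> through a monomial of degree \<sigma> - \<open>e\<close>, and the summands of a
  0/1 exponent are again 0/1 exponents. Tensoring with \<open>k\<close> kills these monomials unless
  they are 1, that is, unless \<open>e\<close> equals \<sigma>; this is why the associated graded
  piece appears. In the cube complex the piece at \<open>V\<close> is spanned by the pairs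
  \<open>(V - c, c)\<close> with \<open>c\<close> a face inside \<open>V\<close>. The homological
  degree is the number \<open>card V - card c\<close> of directions, whereas \<open>c\<close> has
  dimension \<open>card c - 1\<close>; hence the cohomological degree \<open>card V - q - 1\<close>.
  The differential moves a direction into \<open>c\<close> and so becomes a coboundary. The
  compression enters through its complex only: this complex is the star, and its faces in the
  complement of \<omega> form the link.\<close>

abbreviation (input) "coef \<equiv> Poly_Mapping.lookup"
abbreviation (input) "supp \<equiv> Poly_Mapping.keys"
abbreviation (input) "gen b \<equiv> Poly_Mapping.single b 1"

definition scale :: "'k::comm_ring_1 \<Rightarrow> ('b \<Rightarrow>\<^sub>0 'k) \<Rightarrow> ('b \<Rightarrow>\<^sub>0 'k)"
  where "scale c x = Poly_Mapping.map ((*) c) x"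

lemma coef_scale [simp]: "coef (scale c x) b = c * coef x b"
  by (simp add: scale_def Poly_Mapping.map.rep_eq "when_def")

lemma scale_simps [simp]:
  "scale 1 x = x" "scale 0 x = 0" "scale c 0 = 0" "scale (- 1) x = - x"
  by (simp_all add: poly_mapping_eq_iff fun_eq_iff)

lemma scale_add_right: "scale c (x + y) = scale c x + scale c y"
  by (simp add: poly_mapping_eq_iff fun_eq_iff lookup_add algebra_simps)

lemma scale_add_left: "scale (c + e) x = scale c x + scale e x"
  by (simp add: poly_mapping_eq_iff fun_eq_iff lookup_add algebra_simps)

lemma scale_scale [simp]: "scale c (scale e x) = scale (c * e) x"
  by (simp add: poly_mapping_eq_iff fun_eq_iff algebra_simps)

lemma scale_single [simp]: "scale c (Poly_Mapping.single b e) = Poly_Mapping.single b (c * e)"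
  by (simp add: poly_mapping_eq_iff fun_eq_iff lookup_single "when_def")

lemma scale_sum: "scale c (\<Sum>i\<in>I. f i) = (\<Sum>i\<in>I. scale c (f i))"
  by (induction I rule: infinite_finite_induct) (simp_all add: scale_add_right)

lemma chain_expand: "finite S \<Longrightarrow> supp x \<subseteq> S \<Longrightarrow> x = (\<Sum>b\<in>S. scale (coef x b) (gen b))"
  by (rule poly_mapping_eqI) (auto simp: lookup_sum lookup_single when_def in_keys_iff subset_iff)

definition klinear :: "(('b \<Rightarrow>\<^sub>0 'k::comm_ring_1) \<Rightarrow> ('c \<Rightarrow>\<^sub>0 'k)) \<Rightarrow> bool"
  where "klinear f \<longleftrightarrow> (\<forall>x y. f (x + y) = f x + f y) \<and> (\<forall>c x. f (scale c x) = scale c (f x))"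

lemma klinearD:
  fixes f :: "('b \<Rightarrow>\<^sub>0 'k::comm_ring_1) \<Rightarrow> ('c \<Rightarrow>\<^sub>0 'k)"
  assumes "klinear f"
  shows "f (x + y) = f x + f y" "f (scale c x) = scale c (f x)" "f 0 = 0" "f (- x) = - f x"
    "f (x - y) = f x - f y" "f (sum g I) = (\<Sum>i\<in>I. f (g i))"
proof -
  show add: "f (x + y) = f x + f y" and scl: "f (scale c x) = scale c (f x)" for x y :: "'b \<Rightarrow>\<^sub>0 'k" and c
    using assms by (auto simp: klinear_def)
  show "f 0 = 0" using scl[of 0 0] by simp
  then show "f (sum g I) = (\<Sum>i\<in>I. f (g i))"
    by (induction I rule: infinite_finite_induct) (auto simp: add)
  show neg: "f (- x) = - f x" for x :: "'b \<Rightarrow>\<^sub>0 'k" using scl[of "-1" x] by simp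
  show "f (x - y) = f x - f y" using add[of x "- y"] neg by simp
qed

lemma klinear_comp: "klinear f \<Longrightarrow> klinear g \<Longrightarrow> klinear (\<lambda>x. f (g x))"
  by (simp add: klinear_def)

lemma klinear_add: "klinear f \<Longrightarrow> klinear g \<Longrightarrow> klinear (\<lambda>x. f x + g x)"
  by (simp add: klinear_def scale_add_right)

lemma klinear_diff: "klinear f \<Longrightarrow> klinear g \<Longrightarrow> klinear (\<lambda>x. f x - g x)"
  by (auto simp: klinear_def poly_mapping_eq_iff fun_eq_iff lookup_add lookup_minus algebra_simps)

lemma klinear_id: "klinear (\<lambda>x. x)"
  by (simp add: klinear_def)

definition extend :: "('b \<Rightarrow> 'c \<Rightarrow>\<^sub>0 'k) \<Rightarrow> ('b \<Rightarrow>\<^sub>0 'k) \<Rightarrow> ('c \<Rightarrow>\<^sub>0 'k::comm_ring_1)"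
  where "extend \<phi> x = (\<Sum>b\<in>supp x. scale (coef x b) (\<phi> b))"

lemma extend_superset:
  "finite S \<Longrightarrow> supp x \<subseteq> S \<Longrightarrow> extend \<phi> x = (\<Sum>b\<in>S. scale (coef x b) (\<phi> b))"
  unfolding extend_def by (rule sum.mono_neutral_left) (auto simp: in_keys_iff)

lemma supp_add: "supp (x + y) \<subseteq> supp x \<union> supp y"
  by (rule keys_add)

lemma supp_scale: "supp (scale c x) \<subseteq> supp x"
  by (auto simp: in_keys_iff)

lemma klinear_extend:
  fixes \<phi> :: "'b \<Rightarrow> 'c \<Rightarrow>\<^sub>0 'k::comm_ring_1"
  shows "klinear (extend \<phi>)"
  unfolding klinear_def
proof safe
  fix x y :: "'b \<Rightarrow>\<^sub>0 'k"
  let ?S = "supp x \<union> supp y"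
  show "extend \<phi> (x + y) = extend \<phi> x + extend \<phi> y"
    using supp_add[of x y]
    by (simp add: extend_superset[of ?S] lookup_add scale_add_left sum.distrib)
next
  fix c and x :: "'b \<Rightarrow>\<^sub>0 'k"
  show "extend \<phi> (scale c x) = scale c (extend \<phi> x)"
    using supp_scale[of c x] by (simp add: extend_superset[of "supp x"] scale_sum)
qed

lemma extend_gen [simp]: "extend \<phi> (gen b) = \<phi> b"
  by (simp add: extend_superset[of "{b}"])

lemma klinear_eq_extend: "klinear f \<Longrightarrow> f x = extend (\<lambda>b. f (gen b)) x"
  by (subst chain_expand[of "supp x" x]) (simp_all add: extend_def klinearD del: scale_single)

definition chains :: "'b set \<Rightarrow> ('b \<Rightarrow>\<^sub>0 'k::comm_ring_1) set"
  where "chains S = {x. supp x \<subseteq> S}"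

lemma chains_closed:
  fixes x y :: "'b \<Rightarrow>\<^sub>0 'k::comm_ring_1" and f :: "'i \<Rightarrow> 'b \<Rightarrow>\<^sub>0 'k"
  shows
  "0 \<in> chains S"
  "x \<in> chains S \<Longrightarrow> y \<in> chains S \<Longrightarrow> x + y \<in> chains S"
  "x \<in> chains S \<Longrightarrow> - x \<in> chains S"
  "x \<in> chains S \<Longrightarrow> y \<in> chains S \<Longrightarrow> x - y \<in> chains S"
  "x \<in> chains S \<Longrightarrow> scale c x \<in> chains S"
  "(\<And>i. i \<in> I \<Longrightarrow> f i \<in> chains S) \<Longrightarrow> sum f I \<in> chains S"
  "b \<in> S \<Longrightarrow> Poly_Mapping.single b c \<in> chains S"
proof -
  show zero: "0 \<in> chains S" by (simp add: chains_def)
  show add: "x + y \<in> chains S" if "x \<in> chains S" "y \<in> chains S" for x y :: "'b \<Rightarrow>\<^sub>0 'k"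
    using that supp_add[of x y] by (auto simp: chains_def)
  show scl: "scale c x \<in> chains S" if "x \<in> chains S" for x :: "'b \<Rightarrow>\<^sub>0 'k" and c
    using that supp_scale[of c x] by (auto simp: chains_def)
  show neg: "- x \<in> chains S" if "x \<in> chains S" for x :: "'b \<Rightarrow>\<^sub>0 'k"
    using scl[OF that, of "-1"] by simp
  show "x - y \<in> chains S" if "x \<in> chains S" "y \<in> chains S" for x y :: "'b \<Rightarrow>\<^sub>0 'k"
    using add[OF that(1) neg[OF that(2)]] by simp
  show "sum f I \<in> chains S" if "\<And>i. i \<in> I \<Longrightarrow> f i \<in> chains S"
    using that by (induction I rule: infinite_finite_induct) (simp_all add: zero add)
  show "b \<in> S \<Longrightarrow> Poly_Mapping.single b c \<in> chains S"
    by (simp add: chains_def)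
qed

lemma chains_mono: "S \<subseteq> T \<Longrightarrow> x \<in> chains S \<Longrightarrow> x \<in> chains T"
  by (auto simp: chains_def)

lemma klinear_chains:
  assumes "klinear f" "\<And>b. b \<in> S \<Longrightarrow> f (gen b) \<in> chains T" "x \<in> chains S"
  shows "f x \<in> chains T"
  using assms(2,3) by (auto simp: klinear_eq_extend[OF assms(1), of x] extend_def chains_def[of S]
      intro!: chains_closed)

text \<open>Separates the bound \<open>T b\<close> on the image of one basis element from the common
  bound \<open>T'\<close>, the shape in which degree conditions on basis elements pass to
  chains.\<close>

lemma klinear_chains_subset:
  assumes "klinear f" "x \<in> chains S" "\<And>b. b \<in> S \<Longrightarrow> f (gen b) \<in> chains (T b)" "\<And>b. b \<in> S \<Longrightarrow> T b \<subseteq> T'"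
  shows "f x \<in> chains T'"
  by (rule klinear_chains[OF assms(1) _ assms(2)]) (rule chains_mono[OF assms(4) assms(3)])

lemma klinear_eq_on_chains:
  assumes "klinear f" "klinear g" "\<And>b. b \<in> S \<Longrightarrow> f (gen b) = g (gen b)" "x \<in> chains S"
  shows "f x = g x"
  using assms(3,4) by (auto simp: klinear_eq_extend[OF assms(1), of x] klinear_eq_extend[OF assms(2), of x]
      extend_def chains_def subset_iff intro!: sum.cong)

definition restr :: "'b set \<Rightarrow> ('b \<Rightarrow>\<^sub>0 'k::comm_ring_1) \<Rightarrow> ('b \<Rightarrow>\<^sub>0 'k)"
  where "restr S x = Poly_Mapping.mapp (\<lambda>b c. if b \<in> S then c else 0) x"

lemma coef_restr [simp]: "coef (restr S x) b = (if b \<in> S then coef x b else 0)"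
  by (auto simp: restr_def lookup_mapp in_keys_iff when_def)

lemma klinear_restr: "klinear (restr S)"
  by (auto simp: klinear_def poly_mapping_eq_iff fun_eq_iff lookup_add)

lemma restr_chains: "x \<in> chains T \<Longrightarrow> restr S x \<in> chains (S \<inter> T)"
  by (auto simp: chains_def in_keys_iff subset_iff split: if_splits)

lemma restr_id: "x \<in> chains S \<Longrightarrow> restr S x = x"
  by (rule poly_mapping_eqI) (auto simp: chains_def in_keys_iff subset_iff)

lemma restr_zero: "x \<in> chains T \<Longrightarrow> S \<inter> T = {} \<Longrightarrow> restr S x = 0"
  by (rule poly_mapping_eqI) (force simp: chains_def in_keys_iff subset_iff)


section \<open>Filtered free resolutions\<close>

text \<open>
  The component of degree \<open>a\<close> is encoded as the span of the basis elements of degree \<open>\<subseteq> a\<close>, and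
  multiplication by a monomial as an inclusion.
\<close>

definition filtered ::
  "'b set \<Rightarrow> ('b \<Rightarrow> nat set) \<Rightarrow> 'c set \<Rightarrow> ('c \<Rightarrow> nat set) \<Rightarrow> (('b \<Rightarrow>\<^sub>0 'k::comm_ring_1) \<Rightarrow> ('c \<Rightarrow>\<^sub>0 'k)) \<Rightarrow> bool"
  where "filtered B mdeg B' mdeg' f \<longleftrightarrow>
    klinear f \<and> (\<forall>b\<in>B. f (gen b) \<in> chains {b' \<in> B'. mdeg' b' \<subseteq> mdeg b})"

text \<open>Represents the graded piece at \<open>a\<close> by the basis elements of degree exactly
  \<open>a\<close>, a complement of the lower part of the filtration step, so that the associated
  graded complex lives on chains and needs no quotient.\<close>

definition gr :: "('b \<Rightarrow> nat set) \<Rightarrow> nat set \<Rightarrow> ('b \<Rightarrow>\<^sub>0 'k::comm_ring_1) \<Rightarrow> ('b \<Rightarrow>\<^sub>0 'k)"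
  where "gr mdeg a = restr {b. mdeg b = a}"

lemma klinear_gr: "klinear (gr mdeg a)"
  by (simp add: gr_def klinear_restr)

lemmas gr_simps = klinearD[OF klinear_gr]

lemma coef_gr [simp]: "coef (gr mdeg a x) b = (if mdeg b = a then coef x b else 0)"
  by (simp add: gr_def)

text \<open>The discarded part \<open>x - gr mdeg a x\<close> is supported strictly below
  \<open>a\<close>, where a filtered map keeps it; hence the leading part of \<open>f x\<close>
  depends on the leading part of \<open>x\<close> only.\<close>

lemma gr_filtered:
  assumes f: "filtered B mdeg B' mdeg' f" and x: "x \<in> chains {b \<in> B. mdeg b \<subseteq> a}"
  shows "gr mdeg' a (f (gr mdeg a x)) = gr mdeg' a (f x)"
proof -
  have lin: "klinear f" using f by (simp add: filtered_def)
  have "x - gr mdeg a x \<in> chains {b \<in> B. mdeg b \<subset> a}"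
    using x by (auto simp: chains_def in_keys_iff lookup_minus subset_iff split: if_splits)
  then have "f (x - gr mdeg a x) \<in> chains {b \<in> B'. mdeg' b \<subset> a}"
    using f by (elim klinear_chains_subset[OF lin, where T = "\<lambda>b. {b' \<in> B'. mdeg' b' \<subseteq> mdeg b}"])
      (auto simp: filtered_def)
  then have "gr mdeg' a (f (x - gr mdeg a x)) = 0"
    unfolding gr_def by (rule restr_zero) auto
  then show ?thesis by (simp add: klinearD[OF lin] gr_simps)
qed

text \<open>Models the component of degree \<open>a\<close> of a resolution of the face ring, for
  every \<open>a\<close> inside \<open>U\<close>. The face ring has component \<open>k\<close> if
  \<open>a\<close> is in \<open>K\<close> and 0 otherwise, and multiplication by a monomial between
  two face degrees is the identity of \<open>k\<close>; so a single functional \<open>aug\<close>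
  serves all faces at once. It has to vanish on boundaries in face degrees only: over a non-face,
  \<open>exact_0\<close> makes every chain of homological degree 0 a boundary. The basis may be
  infinite.\<close>

locale filtered_resolution =
  fixes K :: "nat set set" and B :: "'b set" and hdeg :: "'b \<Rightarrow> nat" and mdeg :: "'b \<Rightarrow> nat set"
    and D :: "('b \<Rightarrow>\<^sub>0 'k::comm_ring_1) \<Rightarrow> ('b \<Rightarrow>\<^sub>0 'k)" and aug :: "('b \<Rightarrow>\<^sub>0 'k) \<Rightarrow> 'k"
    and U :: "nat set"
  assumes K_subset: "\<sigma> \<in> K \<Longrightarrow> \<tau> \<subseteq> \<sigma> \<Longrightarrow> \<tau> \<in> K"
    and deg_U: "b \<in> B \<Longrightarrow> mdeg b \<subseteq> U"
    and D_linear: "klinear D"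
    and D_0: "b \<in> B \<Longrightarrow> hdeg b = 0 \<Longrightarrow> D (gen b) = 0"
    and D_gen: "b \<in> B \<Longrightarrow> hdeg b = Suc n \<Longrightarrow> D (gen b) \<in> chains {c \<in> B. hdeg c = n \<and> mdeg c \<subseteq> mdeg b}"
    and DD_gen: "b \<in> B \<Longrightarrow> D (D (gen b)) = 0"
    and exact: "a \<subseteq> U \<Longrightarrow> x \<in> chains {b \<in> B. hdeg b = Suc n \<and> mdeg b \<subseteq> a} \<Longrightarrow> D x = 0 \<Longrightarrow>
      \<exists>y \<in> chains {b \<in> B. hdeg b = Suc (Suc n) \<and> mdeg b \<subseteq> a}. D y = x"
    and aug_add: "aug (x + y) = aug x + aug y"
    and aug_scale: "aug (scale c x) = c * aug x"
    and aug_D: "b \<in> B \<Longrightarrow> hdeg b = 1 \<Longrightarrow> mdeg b \<in> K \<Longrightarrow> aug (D (gen b)) = 0"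
    and exact_0: "a \<subseteq> U \<Longrightarrow> x \<in> chains {b \<in> B. hdeg b = 0 \<and> mdeg b \<subseteq> a} \<Longrightarrow> (a \<in> K \<Longrightarrow> aug x = 0) \<Longrightarrow>
      \<exists>y \<in> chains {b \<in> B. hdeg b = 1 \<and> mdeg b \<subseteq> a}. D y = x"
    and aug_onto: "a \<in> K \<Longrightarrow> \<exists>x \<in> chains {b \<in> B. hdeg b = 0 \<and> mdeg b \<subseteq> a}. aug x = 1"
begin

definition ch :: "nat \<Rightarrow> nat set \<Rightarrow> ('b \<Rightarrow>\<^sub>0 'k) set"
  where "ch n a = chains {b \<in> B. hdeg b = n \<and> mdeg b \<subseteq> a}"

text \<open>The stratum at \<open>a\<close>. In contrast to \<open>ch n a\<close>, which stands for
  the whole component of degree \<open>a\<close>, it stands for what remains of this component when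
  all variables act as 0.\<close>

definition str :: "nat \<Rightarrow> nat set \<Rightarrow> ('b \<Rightarrow>\<^sub>0 'k) set"
  where "str n a = chains {b \<in> B. hdeg b = n \<and> mdeg b = a}"

definition grD :: "nat set \<Rightarrow> ('b \<Rightarrow>\<^sub>0 'k) \<Rightarrow> ('b \<Rightarrow>\<^sub>0 'k)"
  where "grD a x = gr mdeg a (D x)"

definition grZ :: "nat \<Rightarrow> nat set \<Rightarrow> ('b \<Rightarrow>\<^sub>0 'k) set"
  where "grZ n a = {x \<in> str n a. grD a x = 0}"

definition grB :: "nat \<Rightarrow> nat set \<Rightarrow> ('b \<Rightarrow>\<^sub>0 'k) set"
  where "grB n a = grD a ` str (Suc n) a"

lemmas D_simps = klinearD[OF D_linear]

lemma klinear_grD: "klinear (grD a)"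
  unfolding grD_def by (rule klinear_comp[OF klinear_gr D_linear])

lemma str_ch: "x \<in> str n a \<Longrightarrow> x \<in> ch n a"
  unfolding str_def ch_def by (erule chains_mono[rotated]) auto

lemma ch_filt: "x \<in> ch n a \<Longrightarrow> x \<in> chains {b \<in> B. mdeg b \<subseteq> a}"
  unfolding ch_def by (erule chains_mono[rotated]) auto

lemma ch_B: "x \<in> ch n a \<Longrightarrow> x \<in> chains B"
  unfolding ch_def by (erule chains_mono[rotated]) auto

lemma gr_str: "x \<in> ch n a \<Longrightarrow> gr mdeg a x \<in> str n a"
  unfolding ch_def str_def gr_def by (drule restr_chains) (erule chains_mono[rotated], auto)

lemma gr_id: "x \<in> str n a \<Longrightarrow> gr mdeg a x = x"
  unfolding str_def gr_def by (rule restr_id) (erule chains_mono[rotated], auto)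

lemma D_ch: "x \<in> ch (Suc n) a \<Longrightarrow> D x \<in> ch n a"
  unfolding ch_def
  by (erule klinear_chains_subset[OF D_linear, where T = "\<lambda>b. {c \<in> B. hdeg c = n \<and> mdeg c \<subseteq> mdeg b}"])
    (auto intro: D_gen)

lemma D_ch_0: "x \<in> ch 0 a \<Longrightarrow> D x = 0"
  unfolding ch_def
  by (rule klinear_eq_on_chains[OF D_linear, of "\<lambda>_. 0"]) (auto simp: D_0 klinear_def)

lemma D_filtered: "filtered B mdeg B mdeg D"
  unfolding filtered_def
proof (intro conjI D_linear ballI)
  fix b assume b: "b \<in> B"
  show "D (gen b) \<in> chains {b' \<in> B. mdeg b' \<subseteq> mdeg b}"
  proof (cases "hdeg b")
    case (Suc n)
    show ?thesis by (rule chains_mono[OF _ D_gen[OF b Suc]]) auto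
  qed (simp add: D_0 b chains_closed)
qed

lemma DD: "x \<in> chains B \<Longrightarrow> D (D x) = 0"
  by (rule klinear_eq_on_chains[OF klinear_comp[OF D_linear D_linear], of "\<lambda>_. 0"])
    (auto simp: DD_gen klinear_def)

lemma aug_simps: "aug 0 = 0" "aug (- x) = - aug x" "aug (x - y) = aug x - aug y"
  "aug (sum f I) = (\<Sum>i\<in>I. aug (f i))"
proof -
  show 0: "aug 0 = 0" using aug_scale[of 0 0] by simp
  show neg: "aug (- x) = - aug x" for x using aug_scale[of "-1" x] by simp
  show "aug (x - y) = aug x - aug y" using aug_add[of x "- y"] neg by simp
  show "aug (sum f I) = (\<Sum>i\<in>I. aug (f i))"
    by (induction I rule: infinite_finite_induct) (auto simp: aug_add 0)
qed

lemma aug_expand: "aug x = (\<Sum>b\<in>supp x. coef x b * aug (gen b))"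
  by (subst chain_expand[of "supp x" x]) (simp_all add: aug_simps aug_scale del: scale_single)

lemma grD_gr: "x \<in> ch n a \<Longrightarrow> grD a (gr mdeg a x) = grD a x"
  unfolding grD_def by (rule gr_filtered[OF D_filtered ch_filt])

lemma grD_str: "x \<in> str (Suc n) a \<Longrightarrow> grD a x \<in> str n a"
  unfolding grD_def by (intro gr_str D_ch str_ch)

lemma grD_str_0: "x \<in> str 0 a \<Longrightarrow> grD a x = 0"
  by (simp add: grD_def D_ch_0[OF str_ch] gr_simps)

text \<open>The terms of \<open>D x\<close> dropped after the first step lie strictly below
  \<open>a\<close> and cannot return, so that \<open>D (D x) = 0\<close> passes to the graded
  piece.\<close>

lemma grD_grD: "x \<in> str (Suc n) a \<Longrightarrow> grD a (grD a x) = 0"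
  using grD_gr[OF D_ch[OF str_ch]] DD[OF ch_B[OF str_ch]] by (simp add: grD_def gr_simps)

lemma grB_grZ: "x \<in> grB n a \<Longrightarrow> x \<in> grZ n a"
  by (auto simp: grB_def grZ_def grD_str grD_grD)

end

section \<open>Comparison of two filtered resolutions of the same complex\<close>

locale two_filtered_resolutions =
  L: filtered_resolution K B hdeg mdeg D aug U + M: filtered_resolution K B' hdeg' mdeg' D' aug' U
  for K :: "nat set set" and B :: "'b set" and hdeg :: "'b \<Rightarrow> nat" and mdeg :: "'b \<Rightarrow> nat set"
    and D :: "('b \<Rightarrow>\<^sub>0 'k::comm_ring_1) \<Rightarrow> ('b \<Rightarrow>\<^sub>0 'k)" and aug :: "('b \<Rightarrow>\<^sub>0 'k) \<Rightarrow> 'k"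
    and U :: "nat set"
    and B' :: "'c set" and hdeg' :: "'c \<Rightarrow> nat" and mdeg' :: "'c \<Rightarrow> nat set"
    and D' :: "('c \<Rightarrow>\<^sub>0 'k) \<Rightarrow> ('c \<Rightarrow>\<^sub>0 'k)" and aug' :: "('c \<Rightarrow>\<^sub>0 'k) \<Rightarrow> 'k"
begin

text \<open>Shift 0 is that of chain maps, shift 1 that of homotopies. In both cases the filtration
  degree must not grow, for the map to act on graded pieces.\<close>

definition graded_of_shift :: "nat \<Rightarrow> (('b \<Rightarrow>\<^sub>0 'k) \<Rightarrow> ('c \<Rightarrow>\<^sub>0 'k)) \<Rightarrow> bool"
  where "graded_of_shift p f \<longleftrightarrow> klinear f \<and> (\<forall>b\<in>B. f (gen b) \<in> M.ch (p + hdeg b) (mdeg b))"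

lemma shift_ch: "graded_of_shift p f \<Longrightarrow> x \<in> L.ch n a \<Longrightarrow> f x \<in> M.ch (p + n) a"
  unfolding L.ch_def M.ch_def
  by (erule klinear_chains_subset[where T = "\<lambda>b. {c \<in> B'. hdeg' c = p + hdeg b \<and> mdeg' c \<subseteq> mdeg b}", rotated])
    (auto simp: graded_of_shift_def M.ch_def)

lemma shift_filtered: "graded_of_shift p f \<Longrightarrow> filtered B mdeg B' mdeg' f"
  by (auto simp: graded_of_shift_def filtered_def intro: M.ch_filt)

lemma shift_linear: "graded_of_shift p f \<Longrightarrow> klinear f"
  by (simp add: graded_of_shift_def)

text \<open>The maps below are built by recursion on the homological degree, with one family
  \<open>\<psi> n\<close> per degree; on chains of degree \<open>n\<close> their common extension is
  that of \<open>\<psi> n\<close>.\<close>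

lemma extend_dim:
  assumes "x \<in> L.ch n a"
  shows "extend (\<lambda>b. \<psi> (hdeg b) b) x = extend (\<psi> n) x"
  by (rule klinear_eq_on_chains[OF klinear_extend klinear_extend _ assms[unfolded L.ch_def]]) auto

definition chain_map :: "(('b \<Rightarrow>\<^sub>0 'k) \<Rightarrow> ('c \<Rightarrow>\<^sub>0 'k)) \<Rightarrow> bool"
  where "chain_map f \<longleftrightarrow> graded_of_shift 0 f \<and> (\<forall>x\<in>chains B. D' (f x) = f (D x))"

text \<open>The usual lifting from a complex of free modules to an exact one. The image of each
  basis element \<open>b\<close> is chosen inside degree \<open>mdeg b\<close>, where the target is
  exact as well, and this makes the chain map filtered.\<close>

lemma exists_lift:
  obtains \<phi> where "chain_map \<phi>" "\<And>a x. a \<in> K \<Longrightarrow> x \<in> L.ch 0 a \<Longrightarrow> aug' (\<phi> x) = aug x"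
proof -
  define \<psi> where "\<psi> = rec_nat (\<lambda>b. SOME y. y \<in> M.ch 0 (mdeg b) \<and> (mdeg b \<in> K \<longrightarrow> aug' y = aug (gen b)))
    (\<lambda>n \<psi>n b. SOME y. y \<in> M.ch (Suc n) (mdeg b) \<and> D' y = extend \<psi>n (D (gen b)))"
  have psi_0: "\<psi> 0 b \<in> M.ch 0 (mdeg b) \<and> (mdeg b \<in> K \<longrightarrow> aug' (\<psi> 0 b) = aug (gen b))" if b: "b \<in> B" for b
  proof -
    have "\<exists>y. y \<in> M.ch 0 (mdeg b) \<and> (mdeg b \<in> K \<longrightarrow> aug' y = aug (gen b))"
    proof (cases "mdeg b \<in> K")
      case True
      \<comment> \<open>An element of augmentation 1 is rescaled to the prescribed value.\<close>
      then obtain y where "y \<in> M.ch 0 (mdeg b)" "aug' y = 1" using M.aug_onto[OF True] unfolding M.ch_def by blast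
      then show ?thesis
        by (intro exI[of _ "scale (aug (gen b)) y"]) (auto simp: M.aug_scale M.ch_def chains_closed)
    next
      case False
      then show ?thesis by (intro exI[of _ 0]) (simp add: M.ch_def chains_closed)
    qed
    from someI_ex[OF this] show ?thesis by (simp add: \<psi>_def)
  qed
  have aug: "aug' (extend (\<psi> 0) x) = aug x" if "a \<in> K" "x \<in> L.ch 0 a" for a x
  proof -
    \<comment> \<open>Degrees below a face are faces, so the prescribed augmentations hold on the
      whole support of \<open>x\<close>.\<close>
    have "mdeg b \<in> K \<and> b \<in> B" if "b \<in> supp x" for b
      using \<open>x \<in> L.ch 0 a\<close> \<open>a \<in> K\<close> that L.K_subset by (auto simp: L.ch_def chains_def)
    then show ?thesis
      using psi_0 by (auto simp: extend_def M.aug_simps M.aug_scale L.aug_expand[of x] intro!: sum.cong)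
  qed
  have ch: "extend (\<psi> n) x \<in> M.ch n a"
    if "\<And>b. b \<in> B \<Longrightarrow> hdeg b = n \<Longrightarrow> \<psi> n b \<in> M.ch n (mdeg b)" "x \<in> L.ch n a" for n x a
    using that(2) unfolding L.ch_def M.ch_def
    by (elim klinear_chains_subset[OF klinear_extend, where T = "\<lambda>b. {c \<in> B'. hdeg' c = n \<and> mdeg' c \<subseteq> mdeg b}"])
      (use that(1) in \<open>auto simp: M.ch_def\<close>)
  have step: "\<psi> (Suc n) b \<in> M.ch (Suc n) (mdeg b) \<and> D' (\<psi> (Suc n) b) = extend (\<psi> n) (D (gen b))"
    if b: "b \<in> B" "hdeg b = Suc n" for n b
    using b
  proof (induction n arbitrary: b)
    case 0
    have D: "D (gen b) \<in> L.ch 0 (mdeg b)"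
      using 0 L.D_gen by (auto simp: L.ch_def)
    have "extend (\<psi> 0) (D (gen b)) \<in> M.ch 0 (mdeg b)"
      by (rule ch[OF _ D]) (auto simp: psi_0)
    \<comment> \<open>Over a non-face nothing has to be checked, since \<open>exact_0\<close>
      imposes no condition there.\<close>
    moreover have "aug' (extend (\<psi> 0) (D (gen b))) = 0" if "mdeg b \<in> K"
      using aug[OF that D] L.aug_D[OF 0(1) _ that] 0 by simp
    ultimately have "\<exists>y. y \<in> M.ch (Suc 0) (mdeg b) \<and> D' y = extend (\<psi> 0) (D (gen b))"
      using M.exact_0[OF L.deg_U[OF 0(1)]] by (auto simp: M.ch_def)
    from someI_ex[OF this] show ?case by (simp add: \<psi>_def)
  next
    case (Suc n)
    have D: "D (gen b) \<in> L.ch (Suc n) (mdeg b)"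
      using Suc L.D_gen by (auto simp: L.ch_def)
    have 1: "extend (\<psi> (Suc n)) (D (gen b)) \<in> M.ch (Suc n) (mdeg b)"
      by (rule ch[OF _ D]) (auto simp: Suc.IH)
    have "D' (extend (\<psi> (Suc n)) (D (gen b))) = extend (\<psi> n) (D (D (gen b)))"
      using D unfolding L.ch_def
      by (rule klinear_eq_on_chains[OF klinear_comp[OF M.D_linear klinear_extend]
            klinear_comp[OF klinear_extend L.D_linear], rotated]) (auto simp: Suc.IH)
    also have "\<dots> = 0" using Suc by (simp add: L.DD_gen klinearD[OF klinear_extend])
    finally have "\<exists>y. y \<in> M.ch (Suc (Suc n)) (mdeg b) \<and> D' y = extend (\<psi> (Suc n)) (D (gen b))"
      using 1 M.exact[OF L.deg_U[OF Suc(2)]] by (auto simp: M.ch_def)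
    from someI_ex[OF this] show ?case by (simp add: \<psi>_def)
  qed
  define \<phi> where "\<phi> = extend (\<lambda>b. \<psi> (hdeg b) b)"
  have lin: "klinear \<phi>" by (simp add: \<phi>_def klinear_extend)
  have shift: "graded_of_shift 0 \<phi>"
    unfolding graded_of_shift_def
  proof (intro conjI lin ballI)
    fix b assume "b \<in> B"
    then show "\<phi> (gen b) \<in> M.ch (0 + hdeg b) (mdeg b)"
      using step psi_0 by (cases "hdeg b") (auto simp: \<phi>_def)
  qed
  have "D' (\<phi> (gen b)) = \<phi> (D (gen b))" if b: "b \<in> B" for b
  proof (cases "hdeg b")
    case 0
    then show ?thesis
      using M.D_ch_0[OF conjunct1[OF psi_0[OF b]]] by (simp add: \<phi>_def L.D_0 b klinearD[OF klinear_extend])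
  next
    case (Suc n)
    have D: "D (gen b) \<in> L.ch n (mdeg b)"
      using Suc L.D_gen[OF b] by (auto simp: L.ch_def)
    show ?thesis using step[OF b Suc] by (simp add: \<phi>_def Suc extend_dim[OF D])
  qed
  then have "D' (\<phi> x) = \<phi> (D x)" if "x \<in> chains B" for x
    using klinear_eq_on_chains[OF klinear_comp[OF M.D_linear lin] klinear_comp[OF lin L.D_linear] _ that]
    by simp
  then have "chain_map \<phi>" using shift by (simp add: chain_map_def)
  moreover have "aug' (\<phi> x) = aug x" if "a \<in> K" "x \<in> L.ch 0 a" for a x
    using aug[OF that] by (simp add: \<phi>_def extend_dim[OF that(2)])
  ultimately show ?thesis using that by blast
qed

text \<open>Meant for the difference of a round trip and the identity, which has augmentation 0. On
  a basis element, \<open>f b - h (D b)\<close> is a cycle inside degree \<open>mdeg b\<close>, and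
  any chain there that bounds it serves as \<open>h b\<close>; so the homotopy is filtered
  too.\<close>

lemma exists_homotopy:
  assumes f: "chain_map f" and aug_f: "\<And>a x. a \<in> K \<Longrightarrow> x \<in> L.ch 0 a \<Longrightarrow> aug' (f x) = 0"
  obtains h where "graded_of_shift 1 h" "\<And>x. x \<in> chains B \<Longrightarrow> f x = D' (h x) + h (D x)"
proof -
  have f0: "graded_of_shift 0 f" and fD: "\<And>x. x \<in> chains B \<Longrightarrow> D' (f x) = f (D x)"
    using f by (auto simp: chain_map_def)
  have f_lin: "klinear f" using f0 by (rule shift_linear)
  define \<eta> where "\<eta> = rec_nat (\<lambda>b. SOME y. y \<in> M.ch 1 (mdeg b) \<and> D' y = f (gen b))
    (\<lambda>n \<eta>n b. SOME y. y \<in> M.ch (Suc (Suc n)) (mdeg b) \<and> D' y = f (gen b) - extend \<eta>n (D (gen b)))"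
  have gen_B: "b \<in> B \<Longrightarrow> gen b \<in> chains B" for b by (auto intro: chains_closed)
  have eta_0: "\<eta> 0 b \<in> M.ch 1 (mdeg b) \<and> D' (\<eta> 0 b) = f (gen b)" if b: "b \<in> B" "hdeg b = 0" for b
  proof -
    have g: "gen b \<in> L.ch 0 (mdeg b)" using b by (auto simp: L.ch_def intro: chains_closed)
    have "\<exists>y. y \<in> M.ch 1 (mdeg b) \<and> D' y = f (gen b)"
      using M.exact_0[OF L.deg_U[OF b(1)], of "f (gen b)"] shift_ch[OF f0 g] aug_f[OF _ g] by (auto simp: M.ch_def)
    from someI_ex[OF this] show ?thesis by (simp add: \<eta>_def)
  qed
  have ch: "extend (\<eta> n) x \<in> M.ch (Suc n) a"
    if "\<And>b. b \<in> B \<Longrightarrow> hdeg b = n \<Longrightarrow> \<eta> n b \<in> M.ch (Suc n) (mdeg b)" "x \<in> L.ch n a" for n x a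
    using that(2) unfolding L.ch_def M.ch_def
    by (elim klinear_chains_subset[OF klinear_extend, where T = "\<lambda>b. {c \<in> B'. hdeg' c = Suc n \<and> mdeg' c \<subseteq> mdeg b}"])
      (use that(1) in \<open>auto simp: M.ch_def\<close>)
  have step: "\<eta> (Suc n) b \<in> M.ch (Suc (Suc n)) (mdeg b) \<and>
      D' (\<eta> (Suc n) b) = f (gen b) - extend (\<eta> n) (D (gen b))"
    if b: "b \<in> B" "hdeg b = Suc n" for n b
    using b
  proof (induction n arbitrary: b)
    case 0
    have D: "D (gen b) \<in> L.ch 0 (mdeg b)"
      using 0 L.D_gen by (auto simp: L.ch_def)
    have g: "gen b \<in> L.ch (Suc 0) (mdeg b)" using 0 by (auto simp: L.ch_def intro: chains_closed)
    have 1: "f (gen b) - extend (\<eta> 0) (D (gen b)) \<in> M.ch (Suc 0) (mdeg b)"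
      using shift_ch[OF f0 g] ch[OF _ D] eta_0 by (auto simp: M.ch_def intro!: chains_closed)
    have "D' (extend (\<eta> 0) (D (gen b))) = f (D (gen b))"
      using D unfolding L.ch_def
      by (rule klinear_eq_on_chains[OF klinear_comp[OF M.D_linear klinear_extend] f_lin, rotated])
        (use eta_0 in auto)
    then have "D' (f (gen b) - extend (\<eta> 0) (D (gen b))) = 0"
      using fD[OF gen_B[OF 0(1)]] by (simp add: M.D_simps)
    then have "\<exists>y. y \<in> M.ch (Suc (Suc 0)) (mdeg b) \<and> D' y = f (gen b) - extend (\<eta> 0) (D (gen b))"
      using 1 M.exact[OF L.deg_U[OF 0(1)]] by (auto simp: M.ch_def)
    from someI_ex[OF this] show ?case by (simp add: \<eta>_def)
  next
    case (Suc n)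
    have D: "D (gen b) \<in> L.ch (Suc n) (mdeg b)"
      using Suc L.D_gen by (auto simp: L.ch_def)
    have g: "gen b \<in> L.ch (Suc (Suc n)) (mdeg b)" using Suc by (auto simp: L.ch_def intro: chains_closed)
    have 1: "f (gen b) - extend (\<eta> (Suc n)) (D (gen b)) \<in> M.ch (Suc (Suc n)) (mdeg b)"
      using shift_ch[OF f0 g] ch[OF _ D] Suc.IH by (auto simp: M.ch_def intro!: chains_closed)
    \<comment> \<open>One degree lower the homotopy equation reads \<open>D' h = f - h D\<close>;
      the term with \<open>D D\<close> then disappears.\<close>
    have "D' (extend (\<eta> (Suc n)) (D (gen b))) = f (D (gen b)) - extend (\<eta> n) (D (D (gen b)))"
      using D unfolding L.ch_def
      by (rule klinear_eq_on_chains[OF klinear_comp[OF M.D_linear klinear_extend]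
            klinear_diff[OF f_lin klinear_comp[OF klinear_extend L.D_linear]], rotated])
        (use Suc.IH in auto)
    then have "D' (f (gen b) - extend (\<eta> (Suc n)) (D (gen b))) = 0"
      using fD[OF gen_B[OF Suc(2)]] by (simp add: M.D_simps L.DD_gen Suc(2) klinearD[OF klinear_extend])
    then have "\<exists>y. y \<in> M.ch (Suc (Suc (Suc n))) (mdeg b) \<and> D' y = f (gen b) - extend (\<eta> (Suc n)) (D (gen b))"
      using 1 M.exact[OF L.deg_U[OF Suc(2)]] by (auto simp: M.ch_def)
    from someI_ex[OF this] show ?case by (simp add: \<eta>_def)
  qed
  define h where "h = extend (\<lambda>b. \<eta> (hdeg b) b)"
  have lin: "klinear h" by (simp add: h_def klinear_extend)
  have shift: "graded_of_shift 1 h"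
    unfolding graded_of_shift_def
  proof (intro conjI lin ballI)
    fix b assume "b \<in> B"
    then show "h (gen b) \<in> M.ch (1 + hdeg b) (mdeg b)"
      using step eta_0 by (cases "hdeg b") (auto simp: h_def)
  qed
  have "f (gen b) = D' (h (gen b)) + h (D (gen b))" if b: "b \<in> B" for b
  proof (cases "hdeg b")
    case 0
    then show ?thesis
      using eta_0[OF b] by (simp add: h_def L.D_0 b klinearD[OF klinear_extend])
  next
    case (Suc n)
    have D: "D (gen b) \<in> L.ch n (mdeg b)"
      using Suc L.D_gen[OF b] by (auto simp: L.ch_def)
    show ?thesis using step[OF b Suc] by (simp add: h_def Suc extend_dim[OF D])
  qed
  then have "f x = D' (h x) + h (D x)" if "x \<in> chains B" for x
    using klinear_eq_on_chains[OF f_lin klinear_add[OF klinear_comp[OF M.D_linear lin] klinear_comp[OF lin L.D_linear]] _ that]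
    by simp
  with shift show ?thesis using that by blast
qed

text \<open>By \<open>gr_filtered\<close>, leading parts may be taken before or after each map, so a
  filtered chain map commutes with the differentials of the graded pieces.\<close>

lemma gr_chain_map:
  assumes f: "chain_map f" and x: "x \<in> L.str n a"
  shows "M.grD a (gr mdeg' a (f x)) = gr mdeg' a (f (L.grD a x))"
proof -
  have 0: "graded_of_shift 0 f" and fD: "D' (f x) = f (D x)"
    using f L.ch_B[OF L.str_ch[OF x]] by (auto simp: chain_map_def)
  have "M.grD a (gr mdeg' a (f x)) = M.grD a (f x)"
    using shift_ch[OF 0 L.str_ch[OF x]] by (rule M.grD_gr)
  also have "\<dots> = gr mdeg' a (f (D x))" by (simp add: M.grD_def fD)
  also have "\<dots> = gr mdeg' a (f (L.grD a x))"
  proof (cases n)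
    case 0
    then show ?thesis using L.D_ch_0[OF L.str_ch] x by (simp add: L.grD_def gr_simps)
  next
    case (Suc k)
    then have "D x \<in> L.ch k a" using L.D_ch[OF L.str_ch] x by blast
    from gr_filtered[OF shift_filtered[OF 0] L.ch_filt[OF this]]
    show ?thesis by (simp add: L.grD_def)
  qed
  finally show ?thesis .
qed

end

text \<open>An isomorphism of homology, phrased on cycles: the equivalence for boundaries contains
  well-definedness and injectivity, the last clause is surjectivity. It comes from filtered liftings
  in both directions and the homotopies from the two round trips to the identity, all restricted to
  the stratum at \<open>a\<close>.\<close>

theorem gr_homology_iso:
  fixes B :: "'b set" and B' :: "'c set" and aug :: "('b \<Rightarrow>\<^sub>0 'k::comm_ring_1) \<Rightarrow> 'k"
  assumes "two_filtered_resolutions K B hdeg mdeg D aug U B' hdeg' mdeg' D' aug'"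
  defines "Z \<equiv> \<lambda>n a. filtered_resolution.grZ B hdeg mdeg D n a"
    and "Bd \<equiv> \<lambda>n a. filtered_resolution.grB B hdeg mdeg D n a"
    and "Z' \<equiv> \<lambda>n a. filtered_resolution.grZ B' hdeg' mdeg' D' n a"
    and "Bd' \<equiv> \<lambda>n a. filtered_resolution.grB B' hdeg' mdeg' D' n a"
  obtains f where "klinear f" "\<And>x. x \<in> Z n a \<Longrightarrow> f x \<in> Z' n a"
    "\<And>x. x \<in> Z n a \<Longrightarrow> f x \<in> Bd' n a \<longleftrightarrow> x \<in> Bd n a"
    "\<And>y. y \<in> Z' n a \<Longrightarrow> \<exists>x\<in>Z n a. y - f x \<in> Bd' n a"
proof -
  interpret L: filtered_resolution K B hdeg mdeg D aug U
    using assms(1) by (rule two_filtered_resolutions.axioms(1))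
  interpret M: filtered_resolution K B' hdeg' mdeg' D' aug' U
    using assms(1) by (rule two_filtered_resolutions.axioms(2))
  interpret AB: two_filtered_resolutions K B hdeg mdeg D aug U B' hdeg' mdeg' D' aug' by unfold_locales
  interpret BA: two_filtered_resolutions K B' hdeg' mdeg' D' aug' U B hdeg mdeg D aug by unfold_locales
  interpret LL: two_filtered_resolutions K B hdeg mdeg D aug U B hdeg mdeg D aug by unfold_locales
  interpret MM: two_filtered_resolutions K B' hdeg' mdeg' D' aug' U B' hdeg' mdeg' D' aug' by unfold_locales
  obtain \<phi> where phi: "AB.chain_map \<phi>" and aug_phi: "\<And>a x. a \<in> K \<Longrightarrow> x \<in> L.ch 0 a \<Longrightarrow> aug' (\<phi> x) = aug x"
    using AB.exists_lift by blast
  obtain \<psi> where psi: "BA.chain_map \<psi>" and aug_psi: "\<And>a x. a \<in> K \<Longrightarrow> x \<in> M.ch 0 a \<Longrightarrow> aug (\<psi> x) = aug' x"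
    using BA.exists_lift by blast
  have phi0: "AB.graded_of_shift 0 \<phi>" and psi0: "BA.graded_of_shift 0 \<psi>"
    using phi psi by (auto simp: AB.chain_map_def BA.chain_map_def)
  note lphi = AB.shift_linear[OF phi0] and lpsi = BA.shift_linear[OF psi0]
  have phi_D: "D' (\<phi> x) = \<phi> (D x)" if "x \<in> L.ch n a" for x n a
    using phi L.ch_B[OF that] by (auto simp: AB.chain_map_def)
  have psi_D: "D (\<psi> x) = \<psi> (D' x)" if "x \<in> M.ch n a" for x n a
    using psi M.ch_B[OF that] by (auto simp: BA.chain_map_def)
  have phi_ch: "\<phi> x \<in> M.ch n a" if "x \<in> L.ch n a" for x n a
    using AB.shift_ch[OF phi0 that] by simp
  have psi_ch: "\<psi> x \<in> L.ch n a" if "x \<in> M.ch n a" for x n a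
    using BA.shift_ch[OF psi0 that] by simp
  have gen_L: "gen b \<in> L.ch (hdeg b) (mdeg b)" if "b \<in> B" for b
    using that by (auto simp: L.ch_def intro: chains_closed)
  have gen_M: "gen b \<in> M.ch (hdeg' b) (mdeg' b)" if "b \<in> B'" for b
    using that by (auto simp: M.ch_def intro: chains_closed)
  have L_cm: "LL.chain_map (\<lambda>x. \<psi> (\<phi> x) - x)"
    unfolding LL.chain_map_def LL.graded_of_shift_def
  proof (intro conjI ballI klinear_diff klinear_comp[OF lpsi lphi] klinear_id)
    fix b assume "b \<in> B"
    show "\<psi> (\<phi> (gen b)) - gen b \<in> L.ch (0 + hdeg b) (mdeg b)"
      using psi_ch[OF phi_ch[OF gen_L[OF \<open>b \<in> B\<close>]]] gen_L[OF \<open>b \<in> B\<close>]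
      by (auto simp: L.ch_def intro: chains_closed)
  next
    fix x :: "'b \<Rightarrow>\<^sub>0 'k" assume x: "x \<in> chains B"
    have "D (\<psi> (\<phi> x)) = \<psi> (\<phi> (D x))"
      using klinear_eq_on_chains[OF klinear_comp[OF L.D_linear klinear_comp[OF lpsi lphi]]
        klinear_comp[OF klinear_comp[OF lpsi lphi] L.D_linear] _ x]
      using psi_D[OF phi_ch[OF gen_L]] phi_D[OF gen_L] by auto
    then show "D (\<psi> (\<phi> x) - x) = \<psi> (\<phi> (D x)) - D x" by (simp add: L.D_simps)
  qed
  have M_cm: "MM.chain_map (\<lambda>x. \<phi> (\<psi> x) - x)"
    unfolding MM.chain_map_def MM.graded_of_shift_def
  proof (intro conjI ballI klinear_diff klinear_comp[OF lphi lpsi] klinear_id)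
    fix b assume "b \<in> B'"
    show "\<phi> (\<psi> (gen b)) - gen b \<in> M.ch (0 + hdeg' b) (mdeg' b)"
      using phi_ch[OF psi_ch[OF gen_M[OF \<open>b \<in> B'\<close>]]] gen_M[OF \<open>b \<in> B'\<close>]
      by (auto simp: M.ch_def intro: chains_closed)
  next
    fix x :: "'c \<Rightarrow>\<^sub>0 'k" assume x: "x \<in> chains B'"
    have "D' (\<phi> (\<psi> x)) = \<phi> (\<psi> (D' x))"
      using klinear_eq_on_chains[OF klinear_comp[OF M.D_linear klinear_comp[OF lphi lpsi]]
        klinear_comp[OF klinear_comp[OF lphi lpsi] M.D_linear] _ x]
      using phi_D[OF psi_ch[OF gen_M]] psi_D[OF gen_M] by auto
    then show "D' (\<phi> (\<psi> x) - x) = \<phi> (\<psi> (D' x)) - D' x" by (simp add: M.D_simps)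
  qed
  obtain h where h: "LL.graded_of_shift 1 h" and hx: "\<And>x. x \<in> chains B \<Longrightarrow> \<psi> (\<phi> x) - x = D (h x) + h (D x)"
    by (rule LL.exists_homotopy[OF L_cm]) (auto simp: L.aug_simps aug_phi aug_psi phi_ch)
  obtain h' where h': "MM.graded_of_shift 1 h'" and hx': "\<And>x. x \<in> chains B' \<Longrightarrow> \<phi> (\<psi> x) - x = D' (h' x) + h' (D' x)"
    by (rule MM.exists_homotopy[OF M_cm]) (auto simp: M.aug_simps aug_phi aug_psi psi_ch)
  define f where "f x = gr mdeg' a (\<phi> x)" for x
  have f_lin: "klinear f" unfolding f_def by (rule klinear_comp[OF klinear_gr lphi])
  note f_simps = klinearD[OF f_lin]
  have f_str: "f x \<in> M.str k a" if "x \<in> L.str k a" for x k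
    unfolding f_def by (intro M.gr_str phi_ch L.str_ch that)
  have f_grD: "M.grD a (f x) = f (L.grD a x)" if "x \<in> L.str k a" for x k
    unfolding f_def by (rule AB.gr_chain_map[OF phi that])
  \<comment> \<open>Here \<open>D x\<close> itself need not vanish; being 0 in the graded piece, it
    lies strictly below \<open>a\<close>, and \<open>h\<close> does not raise it.\<close>
  have grD_zero: "gr mdeg a (h (D x)) = 0" if x: "x \<in> L.str n a" "L.grD a x = 0" for x
  proof (cases n)
    case 0
    then show ?thesis using x L.D_ch_0[OF L.str_ch] by (simp add: klinearD[OF LL.shift_linear[OF h]] gr_simps)
  next
    case (Suc k)
    then have "D x \<in> L.ch k a" using L.D_ch[OF L.str_ch] x by blast
    from gr_filtered[OF LL.shift_filtered[OF h] L.ch_filt[OF this]]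
    show ?thesis using x by (simp add: L.grD_def klinearD[OF LL.shift_linear[OF h]] gr_simps)
  qed
  have grD_zero': "gr mdeg' a (h' (D' x)) = 0" if x: "x \<in> M.str n a" "M.grD a x = 0" for x
  proof (cases n)
    case 0
    then show ?thesis using x M.D_ch_0[OF M.str_ch] by (simp add: klinearD[OF MM.shift_linear[OF h']] gr_simps)
  next
    case (Suc k)
    then have "D' x \<in> M.ch k a" using M.D_ch[OF M.str_ch] x by blast
    from gr_filtered[OF MM.shift_filtered[OF h'] M.ch_filt[OF this]]
    show ?thesis using x by (simp add: M.grD_def klinearD[OF MM.shift_linear[OF h']] gr_simps)
  qed
  have Z: "f x \<in> Z' n a" if "x \<in> Z n a" for x
    using that f_str f_grD[of x n] by (auto simp: Z_def Z'_def L.grZ_def M.grZ_def f_simps)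
  moreover have "f x \<in> Bd' n a \<longleftrightarrow> x \<in> Bd n a" if xZ: "x \<in> Z n a" for x
  proof
    assume "x \<in> Bd n a"
    then obtain y where y: "y \<in> L.str (Suc n) a" "x = L.grD a y" by (auto simp: Bd_def L.grB_def)
    then show "f x \<in> Bd' n a"
      unfolding Bd'_def M.grB_def y(2) f_grD[OF y(1), symmetric] by (intro imageI f_str)
  next
    assume "f x \<in> Bd' n a"
    then obtain y where y: "y \<in> M.str (Suc n) a" "f x = M.grD a y" by (auto simp: Bd'_def M.grB_def)
    have x: "x \<in> L.str n a" "L.grD a x = 0" using xZ by (auto simp: Z_def L.grZ_def)
    have xc: "x \<in> L.ch n a" and yc: "y \<in> M.ch (Suc n) a" using x y by (auto intro: L.str_ch M.str_ch)
    have hxc: "h x \<in> L.ch (Suc n) a" using LL.shift_ch[OF h xc] by simp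
    \<comment> \<open>Applying \<psi> to the equation that bounds \<open>f x\<close>, and replacing
      \<psi>\<phi> by the identity plus a homotopy, exhibits \<open>x\<close> as the graded boundary
      of \<open>\<psi> y - h x\<close>.\<close>
    have "gr mdeg a (\<psi> (gr mdeg' a (\<phi> x))) = gr mdeg a (\<psi> (gr mdeg' a (D' y)))"
      using y by (simp add: f_def M.grD_def)
    then have "gr mdeg a (\<psi> (\<phi> x)) = gr mdeg a (\<psi> (D' y))"
      using gr_filtered[OF BA.shift_filtered[OF psi0] M.ch_filt[OF phi_ch[OF xc]]]
        gr_filtered[OF BA.shift_filtered[OF psi0] M.ch_filt[OF M.D_ch[OF yc]]] by simp
    also have "\<psi> (\<phi> x) = x + (D (h x) + h (D x))" using hx[OF L.ch_B[OF xc]] by (simp add: algebra_simps)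
    also have "gr mdeg a \<dots> = x + gr mdeg a (D (h x))" using grD_zero[OF x] by (simp add: gr_simps L.gr_id[OF x(1)])
    also have "\<psi> (D' y) = D (\<psi> y)" using psi_D[OF yc] by simp
    finally have "x = L.grD a (\<psi> y - h x)" by (simp add: L.grD_def L.D_simps gr_simps algebra_simps)
    also have "\<dots> = L.grD a (gr mdeg a (\<psi> y - h x))"
      using psi_ch[OF yc] hxc by (intro L.grD_gr[symmetric, where n="Suc n"]) (auto simp: L.ch_def intro: chains_closed)
    finally show "x \<in> Bd n a"
      using psi_ch[OF yc] hxc by (auto simp: Bd_def L.grB_def L.ch_def intro!: L.gr_str chains_closed)
  qed
  moreover have "\<exists>x\<in>Z n a. y - f x \<in> Bd' n a" if yZ: "y \<in> Z' n a" for y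
  proof -
    have y: "y \<in> M.str n a" "M.grD a y = 0" using yZ by (auto simp: Z'_def M.grZ_def)
    have yc: "y \<in> M.ch n a" using y by (auto intro: M.str_ch)
    have hyc: "h' y \<in> M.ch (Suc n) a" using MM.shift_ch[OF h' yc] by simp
    let ?x = "gr mdeg a (\<psi> y)"
    have "?x \<in> Z n a"
      using BA.gr_chain_map[OF psi y(1)] y L.gr_str[OF psi_ch[OF yc]]
      by (auto simp: Z_def L.grZ_def klinearD[OF lpsi] gr_simps)
    moreover have "f ?x = gr mdeg' a (\<phi> (\<psi> y))"
      unfolding f_def using gr_filtered[OF AB.shift_filtered[OF phi0] L.ch_filt[OF psi_ch[OF yc]]] .
    moreover have "\<phi> (\<psi> y) = y + (D' (h' y) + h' (D' y))" using hx'[OF M.ch_B[OF yc]] by (simp add: algebra_simps)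
    ultimately have "y - f ?x = - M.grD a (h' y)"
      using grD_zero'[OF y] by (simp add: gr_simps M.gr_id[OF y(1)] M.grD_def)
    also have "\<dots> = M.grD a (gr mdeg' a (- h' y))"
      using M.grD_gr[of "- h' y" "Suc n" a] hyc by (simp add: klinearD[OF M.klinear_grD] M.ch_def chains_closed)
    finally have "y - f ?x \<in> Bd' n a"
      using hyc by (auto simp: Bd'_def M.grB_def M.ch_def intro!: M.gr_str chains_closed)
    with \<open>?x \<in> Z n a\<close> show ?thesis by blast
  qed
  ultimately show ?thesis using that f_lin by blast
qed

section \<open>Koszul type complexes\<close>

text \<open>The exterior sign of \<open>i\<close>, given by its position if \<open>i\<close> is in
  \<tau>. It makes sense for every \<open>i\<close>, which coning with a new element relies
  on.\<close>

definition vsign :: "nat \<Rightarrow> nat set \<Rightarrow> 'k::comm_ring_1"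
  where "vsign i \<tau> = (- 1) ^ card {y \<in> \<tau>. y < i}"

lemma vsign_square [simp]: "vsign i \<tau> * vsign i \<tau> = 1" "vsign i \<tau> * (vsign i \<tau> * c) = c"
proof -
  show 1: "vsign i \<tau> * vsign i \<tau> = (1 :: 'k::comm_ring_1)" for \<tau>
    by (simp add: vsign_def flip: power_mult_distrib)
  show "vsign i \<tau> * (vsign i \<tau> * c) = c" by (simp add: 1 flip: mult.assoc)
qed

lemma vsign_eq_0 [simp]: "vsign i \<tau> * c = 0 \<longleftrightarrow> c = 0"
  by (metis mult_zero_right vsign_square(2))

lemma vsign_insert:
  "finite \<tau> \<Longrightarrow> j \<notin> \<tau> \<Longrightarrow> vsign i (insert j \<tau>) = (if j < i then - vsign i \<tau> else vsign i \<tau>)"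
proof -
  assume "finite \<tau>" "j \<notin> \<tau>"
  moreover have "{y \<in> insert j \<tau>. y < i} = (if j < i then insert j {y \<in> \<tau>. y < i} else {y \<in> \<tau>. y < i})"
    by auto
  ultimately show ?thesis by (auto simp: vsign_def)
qed

lemma vsign_remove:
  assumes "finite \<tau>" "j \<in> \<tau>"
  shows "vsign i (\<tau> - {j}) = (if j < i then - vsign i \<tau> else vsign i \<tau> :: 'k::comm_ring_1)"
proof -
  have "(vsign i \<tau> :: 'k) = (if j < i then - vsign i (\<tau> - {j}) else vsign i (\<tau> - {j}))"
    using assms vsign_insert[of "\<tau> - {j}" j i] by (simp add: insert_absorb)
  then show ?thesis by (cases "j < i") auto
qed

text \<open>The pairs with \<open>i < j\<close> cancel against those with \<open>j < i\<close>. As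
  the diagonal is absent, no division by 2 is involved.\<close>

lemma antisymmetric_sum_zero:
  fixes F :: "nat \<Rightarrow> nat \<Rightarrow> 'a::ab_group_add"
  assumes "finite \<tau>" and F: "\<And>i j. i \<in> \<tau> \<Longrightarrow> j \<in> \<tau> \<Longrightarrow> i < j \<Longrightarrow> F j i = - F i j"
  shows "(\<Sum>i\<in>\<tau>. \<Sum>j\<in>\<tau> - {i}. F i j) = 0"
proof -
  have "(\<Sum>i\<in>\<tau>. \<Sum>j\<in>\<tau> - {i}. F i j) = (\<Sum>i\<in>\<tau>. (\<Sum>j\<in>{j\<in>\<tau>. i < j}. F i j) + (\<Sum>j\<in>{j\<in>\<tau>. j < i}. F i j))"
    using assms(1) by (intro sum.cong refl, subst sum.union_disjoint[symmetric]) (auto intro!: sum.cong)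
  also have "\<dots> = (\<Sum>i\<in>\<tau>. \<Sum>j\<in>{j\<in>\<tau>. i < j}. F i j) + (\<Sum>i\<in>\<tau>. \<Sum>j\<in>{j\<in>\<tau>. j < i}. F i j)"
    by (rule sum.distrib)
  also have "(\<Sum>i\<in>\<tau>. \<Sum>j\<in>{j\<in>\<tau>. j < i}. F i j) = (\<Sum>j\<in>\<tau>. \<Sum>i\<in>{i\<in>\<tau>. j < i}. F i j)"
    using assms(1) by (rule sum.swap_restrict) (fact assms(1))
  also have "\<dots> = (\<Sum>j\<in>\<tau>. \<Sum>i\<in>{i\<in>\<tau>. j < i}. - F j i)"
    by (intro sum.cong refl) (auto simp: F)
  finally show ?thesis by (simp add: sum_negf)
qed

text \<open>In \<open>(\<tau>, c)\<close> the set \<tau> is an exterior monomial and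
  \<open>c\<close> a monomial of the face ring. The two terms are the actions of the variable
  \<open>i\<close> on the polynomial factor, where it is set to 1, and on the face ring, where the
  product may vanish; \<open>P c i\<close> says that it does not. With \<open>P\<close> always false
  this is the boundary of a simplex, with \<open>P\<close> always true that of a cube with bottom
  vertex \<open>c\<close>.\<close>

definition koszul_gen ::
  "(nat set \<Rightarrow> nat \<Rightarrow> bool) \<Rightarrow> nat set \<times> nat set \<Rightarrow> (nat set \<times> nat set \<Rightarrow>\<^sub>0 'k::comm_ring_1)"
  where "koszul_gen P b = (\<Sum>i\<in>fst b. scale (vsign i (fst b))
    (gen (fst b - {i}, snd b) - (if P (snd b) i then gen (fst b - {i}, insert i (snd b)) else 0)))"

lemma koszul_gen_pair:
  "koszul_gen P (\<tau>, c) = (\<Sum>i\<in>\<tau>. scale (vsign i \<tau>)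
    (gen (\<tau> - {i}, c) - (if P c i then gen (\<tau> - {i}, insert i c) else 0)))"
  by (simp add: koszul_gen_def cong: if_cong)

definition koszul ::
  "(nat set \<Rightarrow> nat \<Rightarrow> bool) \<Rightarrow> (nat set \<times> nat set \<Rightarrow>\<^sub>0 'k) \<Rightarrow> (nat set \<times> nat set \<Rightarrow>\<^sub>0 'k::comm_ring_1)"
  where "koszul P = extend (koszul_gen P)"

lemma klinear_koszul: "klinear (koszul P)"
  by (simp add: koszul_def klinear_extend)

lemma koszul_gen [simp]: "koszul P (gen b) = koszul_gen P b"
  by (simp add: koszul_def)

lemmas koszul_simps = klinearD[OF klinear_koszul]

text \<open>Expanding twice gives a term \<open>G i j\<close> for each ordered pair of directions.
  It is symmetric in \<open>i\<close> and \<open>j\<close>, because by the condition on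
  \<open>P\<close> the two orders of adding a pair of elements are allowed together, whereas the
  product of signs is antisymmetric.\<close>

lemma koszul_koszul:
  fixes P
  assumes "finite \<tau>"
    and "\<And>i j. i \<in> \<tau> \<Longrightarrow> j \<in> \<tau> \<Longrightarrow> i \<noteq> j \<Longrightarrow> P c i \<and> P (insert i c) j \<longleftrightarrow> P c j \<and> P (insert j c) i"
  shows "koszul P (koszul_gen P (\<tau>, c)) = (0 :: _ \<Rightarrow>\<^sub>0 'k::comm_ring_1)"
proof -
  define G where "G i j = (gen (\<tau> - {i} - {j}, c) :: _ \<Rightarrow>\<^sub>0 'k)
    - (if P c j then gen (\<tau> - {i} - {j}, insert j c) else 0)
    - (if P c i then gen (\<tau> - {i} - {j}, insert i c)
        - (if P (insert i c) j then gen (\<tau> - {i} - {j}, insert j (insert i c)) else 0) else 0)" for i j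
  have "koszul P (koszul_gen P (\<tau>, c)) = (\<Sum>i\<in>\<tau>. \<Sum>j\<in>\<tau> - {i}. scale (vsign i \<tau> * vsign j (\<tau> - {i})) (G i j))"
    unfolding koszul_gen_pair klinearD(2,6)[OF klinear_koszul]
  proof (rule sum.cong[OF refl])
    fix i assume "i \<in> \<tau>"
    have "koszul P (gen (\<tau> - {i}, c) - (if P c i then gen (\<tau> - {i}, insert i c) else 0))
       = (\<Sum>j\<in>\<tau> - {i}. scale (vsign j (\<tau> - {i})) (G i j))"
    proof (rule poly_mapping_eqI)
      fix b
      show "coef (koszul P (gen (\<tau> - {i}, c) - (if P c i then gen (\<tau> - {i}, insert i c) else 0))) b
        = coef (\<Sum>j\<in>\<tau> - {i}. scale (vsign j (\<tau> - {i})) (G i j)) b"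
        by (cases "P c i") (auto simp: koszul_simps koszul_gen_pair G_def lookup_sum lookup_minus right_diff_distrib
          simp flip: sum_subtractf intro!: sum.cong)
    qed
    then show "scale (vsign i \<tau>) (koszul P (gen (\<tau> - {i}, c) - (if P c i then gen (\<tau> - {i}, insert i c) else 0))) =
      (\<Sum>j\<in>\<tau> - {i}. scale (vsign i \<tau> * vsign j (\<tau> - {i})) (G i j))"
      by (simp add: scale_sum)
  qed
  also have "\<dots> = 0"
  proof (rule antisymmetric_sum_zero[OF assms(1)])
    fix i j assume ij: "i \<in> \<tau>" "j \<in> \<tau>" "i < j"
    have "G j i = G i j"
      using ij assms(2)[of i j] by (auto simp: G_def insert_commute Diff_insert2[symmetric])
    moreover have "vsign j \<tau> * vsign i (\<tau> - {j}) = - (vsign i \<tau> * vsign j (\<tau> - {i}) :: 'k)"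
      using ij assms(1) by (simp add: vsign_remove)
    ultimately show "scale (vsign j \<tau> * vsign i (\<tau> - {j})) (G j i) = - scale (vsign i \<tau> * vsign j (\<tau> - {i})) (G i j)"
      by (auto intro!: poly_mapping_eqI)
  qed
  finally show ?thesis .
qed

text \<open>Coning in direction \<open>j\<close>. Subtracting the boundary of the cone over
  \<open>x\<close> leaves terms with \<open>j\<close> in one of their two sets. In a cycle none of
  these can have \<open>j\<close> in \<tau>, since its face without \<open>j\<close> arises from no
  other term and could not cancel. So \<open>j\<close> has moved into the bottom vertex of every
  remaining term. The set \<open>A\<close> of admissible basis elements allows this to be done
  within one filtration degree.\<close>

lemma koszul_eliminate:
  fixes A :: "(nat set \<times> nat set) set" and x :: "nat set \<times> nat set \<Rightarrow>\<^sub>0 'k::comm_ring_1"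
  assumes A: "\<And>\<tau> c. (\<tau>, c) \<in> A \<Longrightarrow> finite \<tau> \<and> \<tau> \<inter> c = {}"
    and cone: "\<And>\<tau> c. (\<tau>, c) \<in> A \<Longrightarrow> j \<notin> \<tau> \<Longrightarrow> j \<notin> c \<Longrightarrow> (insert j \<tau>, c) \<in> A"
    and face: "\<And>\<tau> c i. (\<tau>, c) \<in> A \<Longrightarrow> i \<in> \<tau> \<Longrightarrow> (\<tau> - {i}, c) \<in> A"
      "\<And>\<tau> c i. (\<tau>, c) \<in> A \<Longrightarrow> i \<in> \<tau> \<Longrightarrow> P c i \<Longrightarrow> (\<tau> - {i}, insert i c) \<in> A"
    and comm: "\<And>\<tau> c i j. (\<tau>, c) \<in> A \<Longrightarrow> i \<in> \<tau> \<Longrightarrow> j \<in> \<tau> \<Longrightarrow> i \<noteq> j \<Longrightarrow>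
      P c i \<and> P (insert i c) j \<longleftrightarrow> P c j \<and> P (insert j c) i"
    and x: "x \<in> chains {b \<in> A. card (fst b) = n}" and cycle: "koszul P x = 0"
  shows "\<exists>w\<in>chains {b \<in> A. card (fst b) = Suc n}.
    x - koszul P w \<in> chains {b \<in> A. card (fst b) = n \<and> j \<in> snd b}"
proof -
  \<comment> \<open>The cone operator. Its sign is the one with which direction \<open>j\<close> is
    removed again, so that removal gives back \<open>(\<tau>, c)\<close> with coefficient 1.\<close>
  define co :: "nat set \<times> nat set \<Rightarrow> (nat set \<times> nat set \<Rightarrow>\<^sub>0 'k)" where "co b = (if j \<in> fst b \<or> j \<in> snd b then 0
     else scale (vsign j (fst b)) (gen (insert j (fst b), snd b)))" for b
  define w where "w = extend co x"
  have wc: "w \<in> chains {b \<in> A. card (fst b) = Suc n}"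
    unfolding w_def using x
    by (rule klinear_chains[OF klinear_extend, rotated])
      (use A cone in \<open>auto simp: co_def intro!: chains_closed\<close>)
  define y where "y = x - koszul P w"
  let ?T = "{b \<in> A. card (fst b) = n \<and> (j \<in> fst b \<or> j \<in> snd b)}"
  have "klinear (\<lambda>x. x - koszul P (extend co x))"
    by (rule klinear_diff[OF klinear_id klinear_comp[OF klinear_koszul klinear_extend]])
  from klinear_chains[OF this _ x, of ?T] have y: "y \<in> chains ?T"
    unfolding y_def w_def
  proof
    fix b assume b: "b \<in> {b \<in> A. card (fst b) = n}"
    obtain \<tau> c where [simp]: "b = (\<tau>, c)" by force
    have bA: "(\<tau>, c) \<in> A" "card \<tau> = n" using b by auto
    show "gen b - koszul P (extend co (gen b)) \<in> chains ?T"
    proof (cases "j \<in> \<tau> \<or> j \<in> c")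
      case True
      then show ?thesis using b by (auto simp: co_def koszul_simps intro!: chains_closed)
    next
      case False
      have fin: "finite \<tau>" using A bA by blast
      have "koszul P (extend co (gen b)) = scale (vsign j \<tau>) (koszul_gen P (insert j \<tau>, c))"
        using False by (simp add: co_def koszul_simps del: scale_single)
      also have "koszul_gen P (insert j \<tau>, c) = scale (vsign j (insert j \<tau>)) (gen (insert j \<tau> - {j}, c) - (if P c j then gen (insert j \<tau> - {j}, insert j c) else 0))
        + (\<Sum>i\<in>\<tau>. scale (vsign i (insert j \<tau>)) (gen (insert j \<tau> - {i}, c) - (if P c i then gen (insert j \<tau> - {i}, insert i c) else 0)))"
        using False fin unfolding koszul_gen_pair by simp
      also have "insert j \<tau> - {j} = \<tau>" using False by auto
      also have "vsign j (insert j \<tau>) = vsign j \<tau>" using False fin by (simp add: vsign_insert)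
      finally have "gen b - koszul P (extend co (gen b)) = (if P c j then gen (\<tau>, insert j c) else 0)
        - scale (vsign j \<tau>) (\<Sum>i\<in>\<tau>. scale (vsign i (insert j \<tau>)) (gen (insert j \<tau> - {i}, c) - (if P c i then gen (insert j \<tau> - {i}, insert i c) else 0)))"
        by (auto simp: scale_add_right algebra_simps intro!: poly_mapping_eqI simp: lookup_add lookup_minus)
      moreover have "card (insert j \<tau> - {i}) = n" if "i \<in> \<tau>" for i
        using that False fin bA(2) by (simp add: card_insert_if)
      moreover have "(insert j \<tau>, c) \<in> A" using cone bA False by blast
      then have "(insert j \<tau> - {i}, c) \<in> A" "P c i \<Longrightarrow> (insert j \<tau> - {i}, insert i c) \<in> A"
        if "i \<in> insert j \<tau>" for i
        using face that by blast+
      moreover from this(2)[of j] have "P c j \<Longrightarrow> (\<tau>, insert j c) \<in> A"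
        using False by (simp add: Diff_insert_absorb)
      moreover have "\<And>i. i \<in> \<tau> \<Longrightarrow> j \<in> insert j \<tau> - {i}" using False by auto
      ultimately show ?thesis using bA(2)
        by (auto intro!: chains_closed)
    qed
  qed simp
  have DD_gen: "koszul P (koszul_gen P b) = (0 :: _ \<Rightarrow>\<^sub>0 'k)" if "b \<in> A" for b
  proof -
    obtain \<tau> c where b: "b = (\<tau>, c)" by (cases b)
    with that have bA: "(\<tau>, c) \<in> A" by simp
    show ?thesis
      unfolding b by (rule koszul_koszul[OF conjunct1[OF A[OF bA]] comm[OF bA]])
  qed
  have DD: "koszul P (koszul P w) = 0"
    using wc
    by (rule klinear_eq_on_chains[OF klinear_comp[OF klinear_koszul klinear_koszul], where g = "\<lambda>_. 0", rotated 2])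
      (auto simp: klinear_def DD_gen)
  have y_cycle: "koszul P y = 0" by (simp add: y_def koszul_simps cycle DD)
  have "j \<notin> \<tau>" if b: "(\<tau>, c) \<in> supp y" for \<tau> c
  proof
    assume j: "j \<in> \<tau>"
    have jc: "j \<notin> c" using A y b j by (auto simp: chains_def)
    \<comment> \<open>Each \<open>b'\<close> in the support has \<open>j\<close> in one of its sets
      and keeps it when some \<open>i\<close> other than \<open>j\<close> is removed; an upper face
      contains \<open>j\<close> in any case. Only the lower face in direction \<open>j\<close> can
      avoid \<open>j\<close>, as \<open>(\<tau> - {j}, c)\<close> does.\<close>
    have coeff: "coef (koszul_gen P b' :: _ \<Rightarrow>\<^sub>0 'k) (\<tau> - {j}, c) = (if b' = (\<tau>, c) then vsign j \<tau> else 0)"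
      if b': "b' \<in> supp y" for b'
    proof -
      obtain \<tau>' c' where [simp]: "b' = (\<tau>', c')" by force
      have j': "(\<tau>', c') \<in> A" "j \<in> \<tau>' \<or> j \<in> c'" using b' y by (auto simp: chains_def)
      have fin: "finite \<tau>'" using A j' by blast
      have 1: "(\<tau>' - {i}, c') = (\<tau> - {j}, c) \<longleftrightarrow> i = j \<and> \<tau>' = \<tau> \<and> c' = c" if "i \<in> \<tau>'" for i
        using that j' j jc by blast
      have 2: "(\<tau>' - {i}, insert i c') \<noteq> (\<tau> - {j}, c)" if "i \<in> \<tau>'" for i
        using that j' jc by blast
      have "coef (koszul_gen P b' :: _ \<Rightarrow>\<^sub>0 'k) (\<tau> - {j}, c) =
        (\<Sum>i\<in>\<tau>'. vsign i \<tau>' * (if i = j \<and> \<tau>' = \<tau> \<and> c' = c then 1 else 0))"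
        unfolding \<open>b' = (\<tau>', c')\<close> koszul_gen_pair lookup_sum
      proof (rule sum.cong[OF refl])
        fix i assume i: "i \<in> \<tau>'"
        show "coef (scale (vsign i \<tau>') (gen (\<tau>' - {i}, c') - (if P c' i then gen (\<tau>' - {i}, insert i c') else 0)) :: _ \<Rightarrow>\<^sub>0 'k)
            (\<tau> - {j}, c) = vsign i \<tau>' * (if i = j \<and> \<tau>' = \<tau> \<and> c' = c then 1 else 0)"
        proof -
          have zero: "coef (if P c' i then gen (\<tau>' - {i}, insert i c') else (0 :: _ \<Rightarrow>\<^sub>0 'k)) (\<tau> - {j}, c) = 0"
            using 2[OF i] by (simp add: lookup_single_not_eq)
          show ?thesis
            unfolding coef_scale lookup_minus zero unfolding lookup_single 1[OF i] by (simp add: when_def)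
        qed
      qed
      also have "\<dots> = (\<Sum>i\<in>\<tau>'. if i = j then (if \<tau>' = \<tau> \<and> c' = c then vsign i \<tau>' else 0) else 0)"
        by (rule sum.cong) auto
      also have "\<dots> = (if b' = (\<tau>, c) then vsign j \<tau> else 0)"
        using j fin by (cases "\<tau>' = \<tau>"; cases "c' = c") (simp_all add: sum.delta)
      finally show ?thesis .
    qed
    have "0 = coef (koszul P y) (\<tau> - {j}, c)" by (simp add: y_cycle)
    also have "\<dots> = (\<Sum>b'\<in>supp y. coef y b' * coef (koszul_gen P b') (\<tau> - {j}, c))"
      by (simp add: koszul_def extend_def lookup_sum)
    also have "\<dots> = (\<Sum>b'\<in>supp y. if b' = (\<tau>, c) then coef y b' * vsign j \<tau> else 0)"
      by (rule sum.cong) (auto simp: coeff)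
    also have "\<dots> = vsign j \<tau> * coef y (\<tau>, c)" using b by (simp add: sum.delta mult.commute)
    finally show False using b by (metis in_keys_iff vsign_eq_0)
  qed
  then have "y \<in> chains {b \<in> A. card (fst b) = n \<and> j \<in> snd b}"
    using y by (fastforce simp: chains_def)
  with wc show ?thesis by (auto simp: y_def)
qed

lemma chains_emptyD: "x \<in> chains S \<Longrightarrow> S = {} \<Longrightarrow> x = 0"
  by (simp add: chains_def)

lemma coef_mem_chains: "x \<in> chains S \<Longrightarrow> b \<notin> S \<Longrightarrow> coef x b = 0"
  by (auto simp: chains_def in_keys_iff)

section \<open>Taylor's resolution\<close>

definition taylor_basis :: "nat set list \<Rightarrow> (nat set \<times> nat set) set"
  where "taylor_basis Q = Pow {..<length Q} \<times> {{}}"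

definition taylor_deg :: "nat set list \<Rightarrow> nat set \<times> nat set \<Rightarrow> nat set"
  where "taylor_deg Q b = (\<Union>k\<in>fst b. Q ! k)"

lemma taylor_basis_finite: "b \<in> taylor_basis Q \<Longrightarrow> finite (fst b)"
  by (auto simp: taylor_basis_def intro: finite_subset[of _ "{..<length Q}"])

text \<open>In degree \<open>a\<close> the basis consists of all sets of indices \<open>k\<close>
  with \<open>Q ! k\<close> inside \<open>a\<close>: the full simplex on these indices, with its
  empty face. Coning with any such index contracts it; if there is none, only the empty face
  remains, and \<open>a\<close> is a face of the complex. The basis is labelled by indices, which
  keeps repeated members of \<open>Q\<close> apart; the second component is a dummy that makes
  \<open>koszul\<close> applicable.\<close>

lemma taylor_resolution:
  assumes Q: "simplicial_complement m Q"
  shows "filtered_resolution (complex_of m Q) (taylor_basis Q) (\<lambda>b. card (fst b)) (taylor_deg Q)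
    (koszul (\<lambda>_ _. False) :: _ \<Rightarrow> _ \<Rightarrow>\<^sub>0 'k::comm_ring_1) (\<lambda>x. coef x ({}, {})) {1..m}"
proof
  let ?D = "koszul (\<lambda>_ _. False) :: _ \<Rightarrow> _ \<Rightarrow>\<^sub>0 'k"
  show "klinear ?D" by (rule klinear_koszul)
  show "\<tau> \<in> complex_of m Q" if "\<sigma> \<in> complex_of m Q" "\<tau> \<subseteq> \<sigma>" for \<sigma> \<tau>
    using that unfolding complex_of_def by blast
  show "taylor_deg Q b \<subseteq> {1..m}" if "b \<in> taylor_basis Q" for b
  proof -
    have "Q ! k \<subseteq> {1..m}" if "k \<in> fst b" for k
      using Q \<open>b \<in> taylor_basis Q\<close> that nth_mem[of k Q] unfolding simplicial_complement_def taylor_basis_def by fastforce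
    then show ?thesis unfolding taylor_deg_def by blast
  qed
  show D_0: "?D (gen b) = 0" if "b \<in> taylor_basis Q" "card (fst b) = 0" for b
    using that taylor_basis_finite[OF that(1)] by (simp add: koszul_gen_def)
  show "?D (gen b) \<in> chains {c \<in> taylor_basis Q. card (fst c) = n \<and> taylor_deg Q c \<subseteq> taylor_deg Q b}"
    if "b \<in> taylor_basis Q" "card (fst b) = Suc n" for b n
    using that taylor_basis_finite[OF that(1)]
    by (auto simp: koszul_gen_def taylor_basis_def taylor_deg_def intro!: chains_closed)
  show "?D (?D (gen b)) = 0" if "b \<in> taylor_basis Q" for b
    using taylor_basis_finite[OF that] koszul_koszul[of "fst b" "\<lambda>_ _. False" "snd b"] by simp
  have elim: "\<exists>y\<in>chains {b \<in> taylor_basis Q. card (fst b) = Suc n \<and> taylor_deg Q b \<subseteq> a}. ?D y = x"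
    if x: "x \<in> chains {b \<in> taylor_basis Q. card (fst b) = n \<and> taylor_deg Q b \<subseteq> a}" "?D x = 0"
      and j: "j < length Q" "Q ! j \<subseteq> a" for x :: "_ \<Rightarrow>\<^sub>0 'k" and n a j
  proof -
    let ?A = "{b \<in> taylor_basis Q. taylor_deg Q b \<subseteq> a}"
    have eq: "{b \<in> taylor_basis Q. card (fst b) = n \<and> taylor_deg Q b \<subseteq> a} = {b \<in> ?A. card (fst b) = n}" for n
      by auto
    have "\<exists>w\<in>chains {b \<in> ?A. card (fst b) = Suc n}. x - ?D w \<in> chains {b \<in> ?A. card (fst b) = n \<and> j \<in> snd b}"
      by (rule koszul_eliminate[OF _ _ _ _ _ x(1)[unfolded eq] x(2)])
        (use j taylor_basis_finite in \<open>force simp: taylor_basis_def taylor_deg_def\<close>)+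
    then obtain w where w: "w \<in> chains {b \<in> ?A. card (fst b) = Suc n}"
      "x - ?D w \<in> chains {b \<in> ?A. card (fst b) = n \<and> j \<in> snd b}" by blast
    \<comment> \<open>Second components are empty, so the elimination leaves nothing and the cycle
      is a boundary.\<close>
    have empty: "{b \<in> ?A. card (fst b) = n \<and> j \<in> snd b} = {}" by (auto simp: taylor_basis_def)
    have "?D w = x" using chains_emptyD[OF w(2) empty] by simp
    with w(1) show ?thesis unfolding eq by blast
  qed
  show "\<exists>y\<in>chains {b \<in> taylor_basis Q. card (fst b) = Suc (Suc n) \<and> taylor_deg Q b \<subseteq> a}. ?D y = x"
    if a: "a \<subseteq> {1..m}" and x: "x \<in> chains {b \<in> taylor_basis Q. card (fst b) = Suc n \<and> taylor_deg Q b \<subseteq> a}" "?D x = 0"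
    for a n and x :: "_ \<Rightarrow>\<^sub>0 'k"
  proof (cases "\<exists>j<length Q. Q ! j \<subseteq> a")
    case True
    then show ?thesis using elim[OF x] by blast
  next
    case False
    have "{b \<in> taylor_basis Q. card (fst b) = Suc n \<and> taylor_deg Q b \<subseteq> a} = {}"
    proof (rule ccontr)
      assume "\<not> ?thesis"
      then obtain \<tau> where t: "\<tau> \<subseteq> {..<length Q}" "card \<tau> = Suc n" "(\<Union>k\<in>\<tau>. Q ! k) \<subseteq> a"
        by (auto simp: taylor_basis_def taylor_deg_def)
      then obtain j where "j \<in> \<tau>" by fastforce
      then show False using t False by blast
    qed
    with x(1) have "x = 0" by (rule chains_emptyD)
    then show ?thesis by (intro bexI[of _ 0]) (simp_all add: chains_closed koszul_simps)
  qed
  show "coef (x + y) ({}, {}) = coef x ({}, {}) + coef y ({}, {})" for x y :: "nat set \<times> nat set \<Rightarrow>\<^sub>0 'k"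
    by (rule lookup_add)
  show "coef (scale c x) ({}, {}) = c * coef x ({}, {})" for c and x :: "nat set \<times> nat set \<Rightarrow>\<^sub>0 'k"
    by simp
  show "coef (?D (gen b)) ({}, {}) = 0"
    if b: "b \<in> taylor_basis Q" "card (fst b) = 1" "taylor_deg Q b \<in> complex_of m Q" for b
  proof -
    \<comment> \<open>This case cannot occur: the degree of a single index is a member of
      \<open>Q\<close>, hence a non-face.\<close>
    obtain k where "fst b = {k}" using b(2) by (auto simp: card_1_singleton_iff)
    then show ?thesis using b by (auto simp: taylor_basis_def taylor_deg_def complex_of_def)
  qed
  show "\<exists>y\<in>chains {b \<in> taylor_basis Q. card (fst b) = 1 \<and> taylor_deg Q b \<subseteq> a}. ?D y = x"
    if a: "a \<subseteq> {1..m}" and x: "x \<in> chains {b \<in> taylor_basis Q. card (fst b) = 0 \<and> taylor_deg Q b \<subseteq> a}"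
      and aug: "a \<in> complex_of m Q \<Longrightarrow> coef x ({}, {}) = 0" for a and x :: "_ \<Rightarrow>\<^sub>0 'k"
  proof (cases "\<exists>j<length Q. Q ! j \<subseteq> a")
    case True
    moreover have "?D x = 0"
      by (rule klinear_eq_on_chains[OF klinear_koszul, where g = "\<lambda>_. 0", OF _ _ x])
        (use D_0 in \<open>auto simp: klinear_def\<close>)
    ultimately show ?thesis using elim[OF x] by auto
  next
    case False
    then have "a \<in> complex_of m Q" using a by (auto simp: complex_of_def set_conv_nth)
    then have c: "coef x ({}, {}) = 0" by (rule aug)
    have "coef x b = 0" for b
    proof (cases "b = ({}, {})")
      case False
      then show ?thesis
        using taylor_basis_finite[of b Q] by (intro coef_mem_chains[OF x]) (auto simp: taylor_basis_def)
    qed (use c in simp)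
    then have "x = 0" by (intro poly_mapping_eqI) simp
    then show ?thesis by (intro bexI[of _ 0]) (simp_all add: chains_closed koszul_simps)
  qed
  show "\<exists>x\<in>chains {b \<in> taylor_basis Q. card (fst b) = 0 \<and> taylor_deg Q b \<subseteq> a}. coef x ({}, {}) = (1 :: 'k)"
    if "a \<in> complex_of m Q" for a
    by (intro bexI[of _ "gen ({}, {})"]) (auto simp: taylor_basis_def taylor_deg_def intro!: chains_closed)
qed

section \<open>The cube resolution\<close>

definition cube_basis :: "nat set set \<Rightarrow> nat set \<Rightarrow> (nat set \<times> nat set) set"
  where "cube_basis K U = {(\<tau>, c). \<tau> \<subseteq> U \<and> c \<in> K \<and> \<tau> \<inter> c = {}}"

text \<open>
  The basis elements \<open>(\<tau>, c)\<close> with \<open>\<tau> \<union> c \<subseteq> a\<close> are the faces, with bottom vertex \<open>c\<close> and directions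
  \<open>\<tau>\<close>, of the cube on \<open>a\<close>, modulo those whose bottom vertex is not in \<open>K\<close>. These complexes are the
  squarefree part of the resolution \<open>k[x] \<otimes> \<Lambda> \<otimes> k(K)\<close> of the face ring by Koszul complexes.
\<close>

lemma cube_resolution:
  assumes sub: "\<And>\<sigma> \<tau>. \<sigma> \<in> K \<Longrightarrow> \<tau> \<subseteq> \<sigma> \<Longrightarrow> \<tau> \<in> K" and KU: "\<And>\<sigma>. \<sigma> \<in> K \<Longrightarrow> \<sigma> \<subseteq> U" and U: "finite U"
  shows "filtered_resolution K (cube_basis K U) (\<lambda>b. card (fst b)) (\<lambda>b. fst b \<union> snd b)
    (koszul (\<lambda>c i. insert i c \<in> K) :: _ \<Rightarrow> _ \<Rightarrow>\<^sub>0 'k::comm_ring_1) (\<lambda>x. \<Sum>c\<in>K. coef x ({}, c)) U"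
proof -
  let ?P = "\<lambda>c i. insert i c \<in> K"
  let ?D = "koszul ?P :: _ \<Rightarrow> _ \<Rightarrow>\<^sub>0 'k"
  let ?aug = "\<lambda>x :: _ \<Rightarrow>\<^sub>0 'k. \<Sum>c\<in>K. coef x ({}, c)"
  let ?B = "cube_basis K U"
  have K_fin: "finite K" using KU U by (auto intro: finite_subset[of K "Pow U"])
  have comm: "?P c i \<and> ?P (insert i c) j \<longleftrightarrow> ?P c j \<and> ?P (insert j c) i" for c i j
    using sub[of "insert i (insert j c)"] by (auto simp: insert_commute)
  have B_fin: "finite \<tau>" if "(\<tau>, c) \<in> ?B" for \<tau> c
    using that U by (auto simp: cube_basis_def intro: finite_subset)
  have D_0: "?D (gen b) = 0" if "b \<in> ?B" "card (fst b) = 0" for b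
    using that B_fin by (cases b) (auto simp: koszul_gen_pair)
  have D_gen: "?D (gen b) \<in> chains {c \<in> ?B. card (fst c) = n \<and> fst c \<union> snd c \<subseteq> fst b \<union> snd b}"
    if "b \<in> ?B" "card (fst b) = Suc n" for b n
    using that B_fin by (cases b) (auto simp: koszul_gen_pair cube_basis_def intro!: chains_closed)
  \<comment> \<open>An edge whose degree is a face has both ends in \<open>K\<close>, and every
    vertex has augmentation 1.\<close>
  have aug_D: "?aug (?D (gen b)) = 0" if b: "b \<in> ?B" "card (fst b) = 1" "fst b \<union> snd b \<in> K" for b
  proof -
    obtain k c where kc: "b = ({k}, c)" using b(2) by (cases b) (auto simp: card_1_singleton_iff)
    have "?aug (?D (gen b)) = (\<Sum>e\<in>K. vsign k {k} * ((1 when c = e) - (1 when insert k c = e)))"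
      using b(3) by (simp add: kc koszul_gen_pair lookup_minus lookup_single)
    also have "\<dots> = vsign k {k} * ((\<Sum>e\<in>K. (1 when c = e)) - (\<Sum>e\<in>K. (1 when insert k c = e)))"
      by (simp only: sum_distrib_left flip: sum_subtractf)
    also have "\<dots> = 0"
      using b K_fin by (simp add: when_def kc cube_basis_def)
    finally show ?thesis .
  qed
  have aug_add: "?aug (x + y) = ?aug x + ?aug y" for x y
    by (simp add: lookup_add sum.distrib)
  have aug_scale: "?aug (scale c x) = c * ?aug x" for c x
    by (simp add: sum_distrib_left)
  have DD: "?D (koszul_gen ?P b) = 0" if b: "b \<in> ?B" for b
  proof -
    obtain \<tau> c where tc: "b = (\<tau>, c)" by (cases b)
    with b have "finite \<tau>" using B_fin by simp
    then show ?thesis unfolding tc by (rule koszul_koszul[OF _ comm])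
  qed
  \<comment> \<open>Eliminating the elements of \<open>d\<close> one at a time pushes the bottom
    vertices up until they contain \<open>d\<close>. With \<open>d = a\<close> only the vertex
    \<open>({}, a)\<close> can survive, and it is present only if \<open>a\<close> is a
    face.\<close>
  have reduce: "\<exists>w\<in>chains {b \<in> ?B. card (fst b) = Suc n \<and> fst b \<union> snd b \<subseteq> a}.
      x - ?D w \<in> chains {b \<in> ?B. card (fst b) = n \<and> fst b \<union> snd b \<subseteq> a \<and> d \<subseteq> snd b}"
    if "d \<subseteq> a" "a \<subseteq> U" and x: "x \<in> chains {b \<in> ?B. card (fst b) = n \<and> fst b \<union> snd b \<subseteq> a}" "?D x = 0" for d a n x
    using finite_subset[OF that(1) finite_subset[OF that(2) U]] that(1)
  proof (induction d rule: finite_induct)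
    case empty
    then show ?case using x by (intro bexI[of _ 0]) (auto simp: koszul_simps chains_closed)
  next
    case (insert j d)
    \<comment> \<open>Passing to a face of a cube only enlarges the bottom vertex, so what has been
      achieved for \<open>d\<close> is preserved while \<open>j\<close> is eliminated.\<close>
    define A where "A = {b \<in> ?B. fst b \<union> snd b \<subseteq> a \<and> d \<subseteq> snd b}"
    from insert.prems have "d \<subseteq> a" by blast
    from insert.IH[OF this] obtain w where w: "w \<in> chains {b \<in> ?B. card (fst b) = Suc n \<and> fst b \<union> snd b \<subseteq> a}"
      and y: "x - ?D w \<in> chains {b \<in> ?B. card (fst b) = n \<and> fst b \<union> snd b \<subseteq> a \<and> d \<subseteq> snd b}"
      by blast
    have y': "x - ?D w \<in> chains {b \<in> A. card (fst b) = n}"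
      by (rule chains_mono[OF _ y]) (auto simp: A_def)
    have "?D (?D w) = 0"
      by (rule klinear_eq_on_chains[OF klinear_comp[OF klinear_koszul klinear_koszul], where g = "\<lambda>_. 0", OF _ _ w])
        (auto simp: klinear_def DD)
    then have "?D (x - ?D w) = 0" by (simp add: koszul_simps x)
    have "\<exists>v\<in>chains {b \<in> A. card (fst b) = Suc n}.
       (x - ?D w) - ?D v \<in> chains {b \<in> A. card (fst b) = n \<and> j \<in> snd b}"
    proof (rule koszul_eliminate[OF _ _ _ _ _ y' \<open>?D (x - ?D w) = 0\<close>])
      fix \<tau> c assume tc: "(\<tau>, c) \<in> A"
      then show "finite \<tau> \<and> \<tau> \<inter> c = {}"
        using B_fin[of \<tau> c] by (simp add: A_def cube_basis_def)
      show "(insert j \<tau>, c) \<in> A" if "j \<notin> \<tau>" "j \<notin> c"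
        using tc that insert.prems \<open>a \<subseteq> U\<close> by (auto simp: A_def cube_basis_def)
      show "(\<tau> - {i}, c) \<in> A" if "i \<in> \<tau>" for i
        using tc that by (auto simp: A_def cube_basis_def)
      show "(\<tau> - {i}, insert i c) \<in> A" if "i \<in> \<tau>" "?P c i" for i
        using tc that by (auto simp: A_def cube_basis_def)
    qed (rule comm)
    then obtain v where v: "v \<in> chains {b \<in> A. card (fst b) = Suc n}"
      "(x - ?D w) - ?D v \<in> chains {b \<in> A. card (fst b) = n \<and> j \<in> snd b}" by (elim bexE) (rule that)
    have "w + v \<in> chains {b \<in> ?B. card (fst b) = Suc n \<and> fst b \<union> snd b \<subseteq> a}"
      by (intro chains_closed w chains_mono[OF _ v(1)]) (auto simp: A_def)
    moreover have "x - ?D (w + v) \<in> chains {b \<in> ?B. card (fst b) = n \<and> fst b \<union> snd b \<subseteq> a \<and> insert j d \<subseteq> snd b}"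
    proof -
      have eq: "x - ?D (w + v) = x - ?D w - ?D v" by (simp add: koszul_simps)
      show ?thesis unfolding eq by (rule chains_mono[OF _ v(2)]) (auto simp: A_def)
    qed
    ultimately show ?case by (rule bexI[rotated])
  qed
  have top: "fst b = {} \<and> snd b = a" if "b \<in> ?B" "fst b \<union> snd b \<subseteq> a" "a \<subseteq> snd b" for a b
    using that unfolding cube_basis_def by (cases b) (clarsimp, blast)
  show ?thesis
  proof (rule filtered_resolution.intro)
    show "?D (?D (gen b)) = 0" if "b \<in> ?B" for b
      using DD[OF that] by simp
    show "\<exists>y\<in>chains {b \<in> ?B. card (fst b) = Suc (Suc n) \<and> fst b \<union> snd b \<subseteq> a}. ?D y = x"
      if a: "a \<subseteq> U" and x: "x \<in> chains {b \<in> ?B. card (fst b) = Suc n \<and> fst b \<union> snd b \<subseteq> a}" "?D x = 0" for a n x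
    proof -
      obtain w where w: "w \<in> chains {b \<in> ?B. card (fst b) = Suc (Suc n) \<and> fst b \<union> snd b \<subseteq> a}"
        "x - ?D w \<in> chains {b \<in> ?B. card (fst b) = Suc n \<and> fst b \<union> snd b \<subseteq> a \<and> a \<subseteq> snd b}"
        using reduce[OF subset_refl a x] by (elim bexE) (rule that)
      have "{b \<in> ?B. card (fst b) = Suc n \<and> fst b \<union> snd b \<subseteq> a \<and> a \<subseteq> snd b} = {}"
      proof (rule equals0I)
        fix b assume "b \<in> {b \<in> ?B. card (fst b) = Suc n \<and> fst b \<union> snd b \<subseteq> a \<and> a \<subseteq> snd b}"
        then show False using top[of b a] by simp
      qed
      with w(2) have "x - ?D w = 0" by (rule chains_emptyD)
      then have "?D w = x" by simp
      then show ?thesis using w(1) by (rule bexI)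
    qed
    show "\<exists>y\<in>chains {b \<in> ?B. card (fst b) = 1 \<and> fst b \<union> snd b \<subseteq> a}. ?D y = x"
      if a: "a \<subseteq> U" and x: "x \<in> chains {b \<in> ?B. card (fst b) = 0 \<and> fst b \<union> snd b \<subseteq> a}"
        and aug: "a \<in> K \<Longrightarrow> ?aug x = 0" for a x
    proof -
      have "?D x = 0"
        by (rule klinear_eq_on_chains[OF klinear_koszul, where g = "\<lambda>_. 0", OF _ _ x])
          (use D_0 in \<open>auto simp: klinear_def\<close>)
      obtain w where w: "w \<in> chains {b \<in> ?B. card (fst b) = Suc 0 \<and> fst b \<union> snd b \<subseteq> a}"
        "x - ?D w \<in> chains {b \<in> ?B. card (fst b) = 0 \<and> fst b \<union> snd b \<subseteq> a \<and> a \<subseteq> snd b}"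
        using reduce[OF subset_refl a x \<open>?D x = 0\<close>] by (elim bexE) (rule that)
      \<comment> \<open>Only the coefficient at \<open>({}, a)\<close> is left undetermined, and for
        a face \<open>a\<close> the augmentation equals it.\<close>
      have zero: "coef (x - ?D w) b = 0" if "b \<noteq> ({}, a) \<or> a \<notin> K" for b
      proof (rule coef_mem_chains[OF w(2)], rule notI)
        assume "b \<in> {b \<in> ?B. card (fst b) = 0 \<and> fst b \<union> snd b \<subseteq> a \<and> a \<subseteq> snd b}"
        then show False using top[of b a] that by (cases b) (auto simp: cube_basis_def)
      qed
      have "coef (x - ?D w) ({}, a) = 0"
      proof (cases "a \<in> K")
        case True
        have "?aug (?D w) = 0"
        proof -
          have "?aug (?D (gen b)) = 0" if "b \<in> supp w" for b
            using that w(1) True sub by (intro aug_D) (auto simp: chains_def)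
          moreover have "?aug (?D w) = (\<Sum>b\<in>supp w. coef w b * ?aug (?D (gen b)))"
            unfolding klinear_eq_extend[OF klinear_koszul, of _ w] extend_def lookup_sum
            by (subst sum.swap) (simp add: sum_distrib_left)
          ultimately show ?thesis by simp
        qed
        then have "?aug (x - ?D w) = 0" using aug[OF True] by (simp add: lookup_minus sum_subtractf)
        moreover have "?aug (x - ?D w) = (\<Sum>c\<in>K. if c = a then coef (x - ?D w) ({}, a) else 0)"
          by (rule sum.cong[OF refl]) (use zero in auto)
        ultimately show ?thesis using True K_fin by simp
      qed (rule zero, simp)
      then have "coef (x - ?D w) b = 0" for b using zero[of b] by (cases "b = ({}, a)") simp_all
      then have "x - ?D w = 0" by (intro poly_mapping_eqI) simp
      then have "?D w = x" by simp
      then show ?thesis using w(1) unfolding One_nat_def by (rule bexI)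
    qed
    show "\<exists>x\<in>chains {b \<in> ?B. card (fst b) = 0 \<and> fst b \<union> snd b \<subseteq> a}. ?aug x = 1" if "a \<in> K" for a
      using sub[OF that, of "{}"] K_fin
      by (intro bexI[of _ "gen ({}, {})"]) (auto simp: cube_basis_def lookup_single when_def intro!: chains_closed)
    show "fst b \<union> snd b \<subseteq> U" if "b \<in> ?B" for b
      using that KU[of "snd b"] by (auto simp: cube_basis_def)
  qed (fact sub klinear_koszul D_0 D_gen aug_D aug_add aug_scale)+
qed

section \<open>Quotients presented by chains\<close>

definition subspace :: "('b \<Rightarrow>\<^sub>0 'k::comm_ring_1) set \<Rightarrow> bool"
  where "subspace Z \<longleftrightarrow> 0 \<in> Z \<and> (\<forall>x\<in>Z. \<forall>y\<in>Z. x + y \<in> Z) \<and> (\<forall>c. \<forall>x\<in>Z. scale c x \<in> Z)"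

lemma subspaceD:
  assumes "subspace Z"
  shows "0 \<in> Z" "x \<in> Z \<Longrightarrow> y \<in> Z \<Longrightarrow> x + y \<in> Z" "x \<in> Z \<Longrightarrow> scale c x \<in> Z"
    "x \<in> Z \<Longrightarrow> y \<in> Z \<Longrightarrow> x - y \<in> Z"
proof -
  show add: "x + y \<in> Z" if "x \<in> Z" "y \<in> Z" for x y using assms that by (simp add: subspace_def)
  show scl: "scale c x \<in> Z" if "x \<in> Z" for c x using assms that by (simp add: subspace_def)
  show "0 \<in> Z" using assms by (simp add: subspace_def)
  show "x - y \<in> Z" if "x \<in> Z" "y \<in> Z" using add[OF that(1) scl[OF that(2), of "-1"]] by simp
qed

text \<open>The homology modules to be compared are quotients of quite different carriers: functions
  on lists, functions on faces, cosets of tensors. Each is described as \<open>Z\<close> modulo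
  \<open>Bd\<close> for two spaces of chains, transported along \<open>g\<close>; the laws of the
  quotient are then those of chains.\<close>

locale presented_quotient =
  fixes N :: "('k::comm_ring_1, 'n, 'u) module_scheme" and H :: "'n set" and g :: "('b \<Rightarrow>\<^sub>0 'k) \<Rightarrow> 'n"
    and Z Bd :: "('b \<Rightarrow>\<^sub>0 'k) set"
  assumes Z: "subspace Z" and Bd: "subspace Bd" and Bd_Z: "Bd \<subseteq> Z"
    and carrier: "carrier N = g ` Z" and inj: "inj_on g Z" and H: "H = g ` Bd"
    and g_add: "x \<in> Z \<Longrightarrow> y \<in> Z \<Longrightarrow> g (x + y) = g x \<oplus>\<^bsub>N\<^esub> g y"
    and g_scale: "x \<in> Z \<Longrightarrow> g (scale c x) = c \<odot>\<^bsub>N\<^esub> g x"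
begin

text \<open>The coset of \<open>g x\<close>, computed among chains instead of with the addition of
  \<open>N\<close>.\<close>

definition cls :: "('b \<Rightarrow>\<^sub>0 'k) \<Rightarrow> 'n set"
  where "cls x = g ` {y \<in> Z. y - x \<in> Bd}"

lemma cls_eq_iff:
  assumes "x \<in> Z" "y \<in> Z"
  shows "cls x = cls y \<longleftrightarrow> x - y \<in> Bd"
proof
  assume "cls x = cls y"
  moreover have "g x \<in> cls x" using assms subspaceD(1)[OF Bd] by (simp add: cls_def)
  ultimately obtain z where z: "g x = g z" "z \<in> Z" "z - y \<in> Bd" by (auto simp: cls_def)
  then have "x = z" using inj assms(1) by (simp add: inj_on_eq_iff)
  then show "x - y \<in> Bd" using z by simp
next
  assume xy: "x - y \<in> Bd"
  have "z - x \<in> Bd \<longleftrightarrow> z - y \<in> Bd" for z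
    using subspaceD(2)[OF Bd _ xy, of "z - x"] subspaceD(4)[OF Bd _ xy, of "z - y"] by auto
  then show "cls x = cls y" by (simp add: cls_def)
qed

lemma coset: "x \<in> Z \<Longrightarrow> H +>\<^bsub>N\<^esub> g x = cls x"
proof -
  assume x: "x \<in> Z"
  have "H +>\<^bsub>N\<^esub> g x = (\<lambda>b. g b \<oplus>\<^bsub>N\<^esub> g x) ` Bd"
    by (auto simp: a_r_coset_def' H)
  also have "\<dots> = (\<lambda>b. g (b + x)) ` Bd"
    using x Bd_Z by (intro image_cong refl g_add[symmetric]) auto
  also have "\<dots> = g ` ((\<lambda>b. b + x) ` Bd)" by (simp add: image_image)
  also have "(\<lambda>b. b + x) ` Bd = {y \<in> Z. y - x \<in> Bd}"
  proof (intro Set.set_eqI iffI)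
    fix y assume "y \<in> {y \<in> Z. y - x \<in> Bd}"
    then show "y \<in> (\<lambda>b. b + x) ` Bd" by (intro image_eqI[of _ _ "y - x"]) auto
  next
    fix y assume "y \<in> (\<lambda>b. b + x) ` Bd"
    then show "y \<in> {y \<in> Z. y - x \<in> Bd}" using x Bd_Z subspaceD(2)[OF Z] by auto
  qed
  finally show ?thesis by (simp add: cls_def)
qed

lemma carrier_quotient: "carrier (quotient_module N H) = cls ` Z"
  by (auto simp: quotient_module_def A_RCOSETS_def' carrier coset)

lemma add_quotient:
  assumes "x \<in> Z" "y \<in> Z"
  shows "cls x \<oplus>\<^bsub>quotient_module N H\<^esub> cls y = cls (x + y)"
proof -
  have "cls x \<oplus>\<^bsub>quotient_module N H\<^esub> cls y = {g u \<oplus>\<^bsub>N\<^esub> g v | u v. u \<in> Z \<and> u - x \<in> Bd \<and> v \<in> Z \<and> v - y \<in> Bd}"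
    by (auto simp: quotient_module_def set_add_def' cls_def)
  also have "\<dots> = {g (u + v) | u v. u \<in> Z \<and> u - x \<in> Bd \<and> v \<in> Z \<and> v - y \<in> Bd}"
    using g_add by (metis (no_types, lifting))
  also have "\<dots> = g ` {u + v | u v. u \<in> Z \<and> u - x \<in> Bd \<and> v \<in> Z \<and> v - y \<in> Bd}" by blast
  also have "{u + v | u v. u \<in> Z \<and> u - x \<in> Bd \<and> v \<in> Z \<and> v - y \<in> Bd} = {w \<in> Z. w - (x + y) \<in> Bd}"
  proof (intro Set.set_eqI iffI)
    fix w assume "w \<in> {w \<in> Z. w - (x + y) \<in> Bd}"
    then have "w = (w - y) + y \<and> w - y \<in> Z \<and> (w - y) - x \<in> Bd \<and> y \<in> Z \<and> y - y \<in> Bd"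
      using assms(2) subspaceD(1)[OF Bd] subspaceD(4)[OF Z] by (simp add: algebra_simps)
    then show "w \<in> {u + v | u v. u \<in> Z \<and> u - x \<in> Bd \<and> v \<in> Z \<and> v - y \<in> Bd}" by blast
  next
    fix w assume "w \<in> {u + v | u v. u \<in> Z \<and> u - x \<in> Bd \<and> v \<in> Z \<and> v - y \<in> Bd}"
    then obtain u v where uv: "w = u + v" "u \<in> Z" "u - x \<in> Bd" "v \<in> Z" "v - y \<in> Bd" by blast
    have "u + v - (x + y) = (u - x) + (v - y)" by simp
    then have "w - (x + y) \<in> Bd" using subspaceD(2)[OF Bd uv(3,5)] by (simp only: uv(1))
    then show "w \<in> {w \<in> Z. w - (x + y) \<in> Bd}" using subspaceD(2)[OF Z uv(2,4)] uv(1) by simp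
  qed
  finally show ?thesis by (simp add: cls_def)
qed

lemma smult_quotient:
  assumes "x \<in> Z"
  shows "c \<odot>\<^bsub>quotient_module N H\<^esub> cls x = cls (scale c x)"
proof -
  have "H +>\<^bsub>N\<^esub> (c \<odot>\<^bsub>N\<^esub> s) = cls (scale c x)" if s: "s \<in> cls x" for s
  proof -
    obtain y where y: "s = g y" "y \<in> Z" "y - x \<in> Bd" using s by (auto simp: cls_def)
    have "scale c y - scale c x = scale c (y - x)"
      by (simp add: poly_mapping_eq_iff fun_eq_iff lookup_minus right_diff_distrib)
    then have "scale c y - scale c x \<in> Bd" using subspaceD(3)[OF Bd y(3)] by simp
    then have "cls (scale c y) = cls (scale c x)"
      using assms y subspaceD(3)[OF Z] by (subst cls_eq_iff) auto
    then show ?thesis using coset[OF subspaceD(3)[OF Z y(2)]] g_scale[OF y(2)] y(1) by simp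
  qed
  moreover have "cls x \<noteq> {}" using assms subspaceD(1)[OF Bd] by (auto simp: cls_def)
  ultimately show ?thesis by (simp add: quotient_module_def)
qed

end

text \<open>The assumptions make the map induced by \<open>f\<close> on classes well-defined,
  injective and surjective; \<open>F\<close> evaluates it on a chosen representative.\<close>

theorem presented_quotient_iso:
  fixes N :: "('k::comm_ring_1, 'n, 'u) module_scheme" and N' :: "('k, 'p, 'v) module_scheme"
  assumes "presented_quotient N H g Z Bd" "presented_quotient N' H' g' Z' Bd'"
    and f: "klinear f" and f_Z: "\<And>x. x \<in> Z \<Longrightarrow> f x \<in> Z'"
    and f_Bd: "\<And>x. x \<in> Z \<Longrightarrow> f x \<in> Bd' \<longleftrightarrow> x \<in> Bd"
    and f_onto: "\<And>y. y \<in> Z' \<Longrightarrow> \<exists>x\<in>Z. y - f x \<in> Bd'"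
  shows "module_isomorphic (coeff_ring :: 'k ring) (quotient_module N H) (quotient_module N' H')"
proof -
  interpret P: presented_quotient N H g Z Bd by fact
  interpret P': presented_quotient N' H' g' Z' Bd' by fact
  define F where "F S = P'.cls (f (SOME x. x \<in> Z \<and> P.cls x = S))" for S
  have key: "P'.cls (f x) = P'.cls (f y) \<longleftrightarrow> P.cls x = P.cls y" if "x \<in> Z" "y \<in> Z" for x y
    using that f_Bd[OF subspaceD(4)[OF P.Z that]]
    by (simp add: P.cls_eq_iff P'.cls_eq_iff f_Z klinearD[OF f])
  have F: "F (P.cls x) = P'.cls (f x)" if "x \<in> Z" for x
    using someI[of "\<lambda>y. y \<in> Z \<and> P.cls y = P.cls x" x] that key by (simp add: F_def)
  have "linear_map (coeff_ring :: 'k ring) (quotient_module N H) (quotient_module N' H') F"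
    unfolding linear_map_def
  proof (intro conjI ballI funcsetI)
    fix S assume "S \<in> carrier (quotient_module N H)"
    then obtain x where x: "x \<in> Z" "S = P.cls x" by (auto simp: P.carrier_quotient)
    show "F S \<in> carrier (quotient_module N' H')"
      using x F f_Z by (simp add: P'.carrier_quotient)
    show "F (c \<odot>\<^bsub>quotient_module N H\<^esub> S) = c \<odot>\<^bsub>quotient_module N' H'\<^esub> F S" for c
      using x F[OF x(1)] F[OF subspaceD(3)[OF P.Z x(1)]] f_Z[OF x(1)]
      by (simp add: P.smult_quotient P'.smult_quotient klinearD[OF f])
    fix T assume "T \<in> carrier (quotient_module N H)"
    then obtain y where y: "y \<in> Z" "T = P.cls y" by (auto simp: P.carrier_quotient)
    show "F (S \<oplus>\<^bsub>quotient_module N H\<^esub> T) = F S \<oplus>\<^bsub>quotient_module N' H'\<^esub> F T"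
      using x y F[OF x(1)] F[OF y(1)] F[OF subspaceD(2)[OF P.Z x(1) y(1)]] f_Z[OF x(1)] f_Z[OF y(1)]
      by (simp add: P.add_quotient P'.add_quotient klinearD[OF f])
  qed
  moreover have "bij_betw F (carrier (quotient_module N H)) (carrier (quotient_module N' H'))"
    unfolding bij_betw_def
  proof
    show "inj_on F (carrier (quotient_module N H))"
      by (rule inj_onI) (auto simp: P.carrier_quotient F key)
    show "F ` carrier (quotient_module N H) = carrier (quotient_module N' H')"
    proof
      show "F ` carrier (quotient_module N H) \<subseteq> carrier (quotient_module N' H')"
        by (auto simp: P.carrier_quotient P'.carrier_quotient F f_Z)
      show "carrier (quotient_module N' H') \<subseteq> F ` carrier (quotient_module N H)"
      proof
        fix T assume "T \<in> carrier (quotient_module N' H')"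
        then obtain y where y: "y \<in> Z'" "T = P'.cls y" by (auto simp: P'.carrier_quotient)
        obtain x where x: "x \<in> Z" "y - f x \<in> Bd'" using f_onto[OF y(1)] by blast
        then have "T = F (P.cls x)" using y by (simp add: F f_Z P'.cls_eq_iff)
        then show "T \<in> F ` carrier (quotient_module N H)" using x by (auto simp: P.carrier_quotient)
      qed
    qed
  qed
  ultimately show ?thesis unfolding module_isomorphic_def by blast
qed

lemma subspace_chains: "subspace (chains S)"
  by (simp add: subspace_def chains_closed)

context filtered_resolution
begin

lemma subspace_str: "subspace (str n a)"
  by (simp add: str_def subspace_chains)

lemma subspace_grZ: "subspace (grZ n a)"
  using subspace_str[of n a] by (simp add: subspace_def grZ_def klinearD[OF klinear_grD])

lemma subspace_grB: "subspace (grB n a)"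
  unfolding subspace_def
proof (intro conjI ballI allI)
  show "0 \<in> grB n a" unfolding grB_def
    by (rule image_eqI[of _ _ 0]) (simp_all add: klinearD[OF klinear_grD] subspaceD(1)[OF subspace_str])
  fix x assume "x \<in> grB n a"
  then obtain u where u: "u \<in> str (Suc n) a" "x = grD a u" by (auto simp: grB_def)
  show "scale c x \<in> grB n a" for c
    unfolding grB_def u(2) klinearD(2)[OF klinear_grD, symmetric] by (intro imageI subspaceD(3)[OF subspace_str] u(1))
  fix y assume "y \<in> grB n a"
  then obtain v where v: "v \<in> str (Suc n) a" "y = grD a v" by (auto simp: grB_def)
  show "x + y \<in> grB n a"
    unfolding grB_def u(2) v(2) klinearD(1)[OF klinear_grD, symmetric]
    by (intro imageI subspaceD(2)[OF subspace_str] u(1) v(1))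
qed

text \<open>The factor \<open>s\<close> allows for a differential that agrees with
  \<open>grD\<close> up to a global sign only; as \<open>s\<close> is invertible, cycles and
  boundaries are the same.\<close>

lemma presented_homology:
  fixes C :: "nat \<Rightarrow> ('k, 'n, 'u) module_scheme" and s :: 'k
  assumes carrier: "\<And>n. carrier (C n) = g n ` str n a" and inj: "\<And>n. inj_on (g n) (str n a)"
    and add: "\<And>n x y. x \<in> str n a \<Longrightarrow> y \<in> str n a \<Longrightarrow> g n (x + y) = g n x \<oplus>\<^bsub>C n\<^esub> g n y"
    and scale: "\<And>n x c. x \<in> str n a \<Longrightarrow> g n (scale c x) = c \<odot>\<^bsub>C n\<^esub> g n x"
    and zero: "\<And>n. \<zero>\<^bsub>C n\<^esub> = g n 0"
    and s: "s * s = 1"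
    and d: "\<And>n x. x \<in> str (Suc n) a \<Longrightarrow> d n (g (Suc n) x) = g n (scale s (grD a x))"
  shows "presented_quotient ((C q)\<lparr>carrier := cycles C d q\<rparr>) (d q ` carrier (C (Suc q))) (g q) (grZ q a) (grB q a)"
proof
  have Z_str: "grZ q a \<subseteq> str q a" by (auto simp: grZ_def)
  show "subspace (grZ q a)" "subspace (grB q a)" by (rule subspace_grZ subspace_grB)+
  show "grB q a \<subseteq> grZ q a" using grB_grZ by blast
  show "inj_on (g q) (grZ q a)" using inj_on_subset[OF inj Z_str] .
  have s_grB: "(\<lambda>x. scale s (grD a x)) ` str (Suc q) a = grB q a"
  proof (intro Set.set_eqI iffI)
    fix y assume "y \<in> grB q a"
    then have "scale s y \<in> grB q a" by (rule subspaceD(3)[OF subspace_grB])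
    then obtain x where "x \<in> str (Suc q) a" "scale s y = grD a x" by (auto simp: grB_def)
    moreover from this(2) have "y = scale s (grD a x)" using s by (metis scale_scale scale_simps(1))
    ultimately show "y \<in> (\<lambda>x. scale s (grD a x)) ` str (Suc q) a" by blast
  next
    fix y assume "y \<in> (\<lambda>x. scale s (grD a x)) ` str (Suc q) a"
    then show "y \<in> grB q a" using subspaceD(3)[OF subspace_grB] by (auto simp: grB_def)
  qed
  have "d q ` carrier (C (Suc q)) = g q ` (\<lambda>x. scale s (grD a x)) ` str (Suc q) a"
    by (simp add: carrier image_image d cong: image_cong)
  then show "d q ` carrier (C (Suc q)) = g q ` grB q a" by (simp add: s_grB)
  have "cycles C d q = g q ` grZ q a"
  proof (cases q)
    case 0
    have "grZ 0 a = str 0 a" by (auto simp: grZ_def grD_str_0)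
    then show ?thesis by (simp add: cycles_def 0 carrier)
  next
    case (Suc n)
    have "d n (g (Suc n) x) = \<zero>\<^bsub>C n\<^esub> \<longleftrightarrow> grD a x = 0" if x: "x \<in> str (Suc n) a" for x
    proof -
      have "d n (g (Suc n) x) = \<zero>\<^bsub>C n\<^esub> \<longleftrightarrow> scale s (grD a x) = 0"
        unfolding d[OF x] zero
        using inj_on_eq_iff[OF inj] subspaceD(1,3)[OF subspace_str] grD_str[OF x] by blast
      also have "\<dots> \<longleftrightarrow> grD a x = 0" using s by (metis scale_scale scale_simps(1,3))
      finally show ?thesis .
    qed
    then show ?thesis by (auto simp: cycles_def Suc carrier grZ_def)
  qed
  then show "carrier ((C q)\<lparr>carrier := cycles C d q\<rparr>) = g q ` grZ q a" by simp
qed (use add scale in \<open>auto simp: grZ_def\<close>)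

end

text \<open>Reads a chain as a function through a relabelling \<beta> of the basis, with a sign
  \<theta> attached to each basis element.\<close>

definition cochain_of :: "'y set \<Rightarrow> ('y \<Rightarrow> 'k) \<Rightarrow> ('y \<Rightarrow> 'b) \<Rightarrow> ('b \<Rightarrow>\<^sub>0 'k::comm_ring_1) \<Rightarrow> 'y \<Rightarrow> 'k"
  where "cochain_of S \<theta> \<beta> x = (\<lambda>y. if y \<in> S then \<theta> y * coef x (\<beta> y) else 0)"

text \<open>The signs square to 1, so multiplying by them once more inverts the passage from chains
  to functions.\<close>

lemma free_module_presented:
  fixes S :: "'y set" and \<theta> :: "'y \<Rightarrow> 'k::comm_ring_1"
  assumes S: "finite S" and \<beta>: "bij_betw \<beta> S T" and \<theta>: "\<And>y. y \<in> S \<Longrightarrow> \<theta> y * \<theta> y = 1"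
  shows "carrier (free_module (coeff_ring :: 'k ring) S) = cochain_of S \<theta> \<beta> ` chains T" (is ?carr)
    and "inj_on (cochain_of S \<theta> \<beta>) (chains T)" (is ?inj)
    and "cochain_of S \<theta> \<beta> (x + y) = cochain_of S \<theta> \<beta> x \<oplus>\<^bsub>free_module coeff_ring S\<^esub> cochain_of S \<theta> \<beta> y"
    and "cochain_of S \<theta> \<beta> (scale c x) = c \<odot>\<^bsub>free_module coeff_ring S\<^esub> cochain_of S \<theta> \<beta> x"
    and "\<zero>\<^bsub>free_module coeff_ring S\<^esub> = cochain_of S \<theta> \<beta> 0"
proof -
  note simps = cochain_of_def free_module_def coeff_ring_def
  show "cochain_of S \<theta> \<beta> (x + y) = cochain_of S \<theta> \<beta> x \<oplus>\<^bsub>free_module coeff_ring S\<^esub> cochain_of S \<theta> \<beta> y"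
    by (simp add: simps lookup_add fun_eq_iff distrib_left)
  show "cochain_of S \<theta> \<beta> (scale c x) = c \<odot>\<^bsub>free_module coeff_ring S\<^esub> cochain_of S \<theta> \<beta> x"
    by (simp add: simps fun_eq_iff mult.left_commute)
  show "\<zero>\<^bsub>free_module coeff_ring S\<^esub> = cochain_of S \<theta> \<beta> 0"
    by (simp add: simps fun_eq_iff)
  have undo: "\<theta> y * (\<theta> y * c) = c" if "y \<in> S" for y c
    using \<theta>[OF that] by (simp flip: mult.assoc)
  show ?inj
  proof (rule inj_onI, rule poly_mapping_eqI)
    fix x x' b assume x: "x \<in> chains T" "x' \<in> chains T" "cochain_of S \<theta> \<beta> x = cochain_of S \<theta> \<beta> x'"
    show "coef x b = coef x' b"
    proof (cases "b \<in> T")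
      case True
      then obtain y where y: "y \<in> S" "b = \<beta> y" using \<beta> by (auto simp: bij_betw_def)
      have "\<theta> y * coef x b = \<theta> y * coef x' b" using fun_cong[OF x(3), of y] y by (simp add: cochain_of_def)
      then show ?thesis using undo[OF y(1)] by metis
    next
      case False
      then show ?thesis using coef_mem_chains[OF x(1)] coef_mem_chains[OF x(2)] by simp
    qed
  qed
  show ?carr
  proof (intro Set.set_eqI iffI)
    fix f assume "f \<in> cochain_of S \<theta> \<beta> ` chains T"
    then obtain x where f: "f = cochain_of S \<theta> \<beta> x" by blast
    have "finite {y. f y \<noteq> 0}" by (rule finite_subset[OF _ S]) (auto simp: f cochain_of_def)
    moreover have "f y = 0" if "y \<notin> S" for y using that by (simp add: f cochain_of_def)
    ultimately show "f \<in> carrier (free_module coeff_ring S)"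
      by (simp add: free_module_def coeff_ring_def)
  next
    fix f assume "f \<in> carrier (free_module (coeff_ring :: 'k ring) S)"
    then have f: "f y = 0" if "y \<notin> S" for y using that by (simp add: simps)
    define x where "x = (\<Sum>y\<in>S. Poly_Mapping.single (\<beta> y) (\<theta> y * f y))"
    have "coef x (\<beta> y) = \<theta> y * f y" if y: "y \<in> S" for y
    proof -
      have "coef x (\<beta> y) = (\<Sum>z\<in>S. if z = y then \<theta> y * f y else 0)"
        unfolding x_def lookup_sum
        by (rule sum.cong[OF refl])
          (use \<beta> y in \<open>auto simp: lookup_single when_def bij_betw_def inj_on_eq_iff\<close>)
      then show ?thesis using S y by simp
    qed
    then have "cochain_of S \<theta> \<beta> x = f"
      using f undo by (auto simp: cochain_of_def fun_eq_iff)
    moreover have "x \<in> chains T"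
      unfolding x_def using \<beta> by (intro chains_closed) (auto simp: bij_betw_def)
    ultimately show "f \<in> cochain_of S \<theta> \<beta> ` chains T" by blast
  qed
qed

section \<open>The two sides as graded pieces of resolutions\<close>

text \<open>For passing from signs by list position to \<open>vsign\<close>: with positions counted
  from 0, the position of an element is the number of smaller ones.\<close>

lemma sorted_list_of_set_position:
  fixes \<tau> :: "nat set"
  assumes "finite \<tau>" "i < card \<tau>"
  shows "card {y \<in> \<tau>. y < sorted_list_of_set \<tau> ! i} = i"
    and "take i (sorted_list_of_set \<tau>) @ drop (Suc i) (sorted_list_of_set \<tau>)
      = sorted_list_of_set (\<tau> - {sorted_list_of_set \<tau> ! i})"
proof -
  let ?l = "sorted_list_of_set \<tau>"
  have len: "length ?l = card \<tau>" and s: "sorted_wrt (<) ?l" and d: "distinct ?l" and set: "set ?l = \<tau>"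
    using assms by auto
  have mono: "?l ! a < ?l ! b \<longleftrightarrow> a < b" if "a < card \<tau>" "b < card \<tau>" for a b
    using sorted_wrt_nth_less[OF s] that len by (metis linorder_less_linear order_less_asym)
  have "{y \<in> \<tau>. y < ?l ! i} = (!) ?l ` {..<i}"
  proof (intro Set.set_eqI iffI)
    fix y assume y: "y \<in> {y \<in> \<tau>. y < ?l ! i}"
    then obtain k where "k < card \<tau>" "y = ?l ! k" using set len by (metis CollectD in_set_conv_nth)
    then show "y \<in> (!) ?l ` {..<i}" using y mono assms(2) by auto
  next
    fix y assume "y \<in> (!) ?l ` {..<i}"
    then show "y \<in> {y \<in> \<tau>. y < ?l ! i}" using mono assms(2) set len nth_mem[of _ ?l] by fastforce
  qed
  moreover have "inj_on ((!) ?l) {..<i}"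
    using d assms(2) len by (auto simp: inj_on_def nth_eq_iff_index_eq)
  ultimately show "card {y \<in> \<tau>. y < ?l ! i} = i" by (simp add: card_image)
  have l: "?l = take i ?l @ ?l ! i # drop (Suc i) ?l" using assms(2) len by (simp add: id_take_nth_drop)
  have "remove1 (?l ! i) (take i ?l @ ?l ! i # drop (Suc i) ?l) = take i ?l @ drop (Suc i) ?l"
    using d l by (metis distinct_append list.set_intros(1) disjoint_iff remove1.simps(2) remove1_append)
  then show "take i ?l @ drop (Suc i) ?l = sorted_list_of_set (\<tau> - {?l ! i})"
    using l assms(1) by (simp add: sorted_list_of_set_remove)
qed

lemma sum_sorted_list_of_set:
  fixes h :: "nat \<Rightarrow> 'k::comm_ring_1"
  assumes "finite \<tau>"
  shows "(\<Sum>i<card \<tau>. (- 1) ^ i * h (sorted_list_of_set \<tau> ! i)) = (\<Sum>k\<in>\<tau>. vsign k \<tau> * h k)"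
proof -
  have "bij_betw ((!) (sorted_list_of_set \<tau>)) {..<card \<tau>} \<tau>"
    using assms by (intro bij_betw_nth) auto
  then have "(\<Sum>k\<in>\<tau>. vsign k \<tau> * h k)
    = (\<Sum>i<card \<tau>. vsign (sorted_list_of_set \<tau> ! i) \<tau> * h (sorted_list_of_set \<tau> ! i))"
    by (rule sum.reindex_bij_betw[symmetric])
  also have "\<dots> = (\<Sum>i<card \<tau>. (- 1) ^ i * h (sorted_list_of_set \<tau> ! i))"
    using sorted_list_of_set_position(1)[OF assms] by (intro sum.cong refl) (auto simp: vsign_def)
  finally show ?thesis by simp
qed

lemma coef_extend: "x \<in> chains S \<Longrightarrow> finite S \<Longrightarrow> coef (extend \<phi> x) c = (\<Sum>b\<in>S. coef x b * coef (\<phi> b) c)"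
  by (simp add: extend_superset[of S] chains_def lookup_sum)

abbreviation (input) taylor_stratum :: "nat set list \<Rightarrow> nat \<Rightarrow> nat set \<Rightarrow> (nat set \<times> nat set) set"
  where "taylor_stratum Q n \<sigma> \<equiv> {b \<in> taylor_basis Q. card (fst b) = n \<and> taylor_deg Q b = \<sigma>}"

section \<open>The exterior complex of a simplicial complement as a graded piece of Taylor's
  resolution\<close>

lemma \<Lambda>_gens_bij: "bij_betw (\<lambda>v. (set v, {})) (\<Lambda>_gens Q n \<sigma>) (taylor_stratum Q n \<sigma>)"
proof (rule bij_betwI[where g = "\<lambda>b. sorted_list_of_set (fst b)"])
  show "(\<lambda>v. (set v, {})) \<in> \<Lambda>_gens Q n \<sigma> \<rightarrow> taylor_stratum Q n \<sigma>"
    by (auto simp: \<Lambda>_gens_def taylor_basis_def taylor_deg_def total_subset_def strict_sorted_iff distinct_card)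
  show "(\<lambda>b. sorted_list_of_set (fst b)) \<in> taylor_stratum Q n \<sigma> \<rightarrow> \<Lambda>_gens Q n \<sigma>"
    by (rule funcsetI)
      (use taylor_basis_finite in \<open>auto simp: \<Lambda>_gens_def taylor_basis_def taylor_deg_def total_subset_def\<close>)
  show "sorted_list_of_set (fst (set v, {})) = v" if "v \<in> \<Lambda>_gens Q n \<sigma>" for v
    using that by (simp add: \<Lambda>_gens_def strict_sorted_iff sorted_list_of_set.idem_if_sorted_distinct)
  show "(set (sorted_list_of_set (fst b)), {}) = b" if "b \<in> taylor_stratum Q n \<sigma>" for b
    using that taylor_basis_finite[of b Q] by (auto simp: taylor_basis_def)
qed

lemma taylor_basis_fin: "finite (taylor_basis Q)"
  by (simp add: taylor_basis_def)

lemma \<Lambda>_gens_finite: "finite (\<Lambda>_gens Q n \<sigma>)"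
  using bij_betw_finite[OF \<Lambda>_gens_bij] taylor_basis_fin by simp

text \<open>One side counts positions from 1, the other counts smaller elements, whence the minus.
  The condition that omitting an index keeps the total subset says that the face stays in the
  stratum at \<sigma>; the other faces of the simplex are dropped.\<close>

lemma \<Lambda>_diff_gen_koszul:
  assumes b: "b \<in> taylor_stratum Q (Suc n) \<sigma>"
  shows "\<Lambda>_diff_gen Q (sorted_list_of_set (fst b)) v
    = (if v \<in> \<Lambda>_gens Q n \<sigma> then - coef (koszul_gen (\<lambda>_ _. False) b :: _ \<Rightarrow>\<^sub>0 'k) (set v, {}) else 0 :: 'k::comm_ring_1)"
proof -
  define \<tau> where "\<tau> = fst b"
  have \<tau>: "b = (\<tau>, {})" "finite \<tau>" "card \<tau> = Suc n" "\<tau> \<subseteq> {..<length Q}" "(\<Union>k\<in>\<tau>. Q ! k) = \<sigma>"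
    using b taylor_basis_finite[of b Q] by (auto simp: \<tau>_def taylor_basis_def taylor_deg_def)
  have tot: "total_subset Q (sorted_list_of_set \<tau>) = \<sigma>" using \<tau> by (simp add: total_subset_def)
  define h :: "nat \<Rightarrow> 'k" where "h k = - (if total_subset Q (sorted_list_of_set (\<tau> - {k})) = \<sigma> then 1 else 0)
    * (if v = sorted_list_of_set (\<tau> - {k}) then 1 else 0)" for k
  have "\<Lambda>_diff_gen Q (sorted_list_of_set \<tau>) v = (\<Sum>i<card \<tau>. (- 1) ^ i * h (sorted_list_of_set \<tau> ! i))"
    unfolding \<Lambda>_diff_gen_def tot using \<tau>
    by (intro sum.cong) (auto simp: omit_def sorted_list_of_set_position(2) h_def free_gen_def coeff_ring_def)
  also have "\<dots> = (\<Sum>k\<in>\<tau>. vsign k \<tau> * h k)" using \<tau> by (intro sum_sorted_list_of_set)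
  also have "\<dots> = (if v \<in> \<Lambda>_gens Q n \<sigma> then - coef (koszul_gen (\<lambda>_ _. False) b :: _ \<Rightarrow>\<^sub>0 'k) (set v, {}) else 0)"
  proof (cases "v \<in> \<Lambda>_gens Q n \<sigma>")
    case True
    then have v: "v = sorted_list_of_set (set v)" "total_subset Q v = \<sigma>"
      by (auto simp: \<Lambda>_gens_def strict_sorted_iff sorted_list_of_set.idem_if_sorted_distinct)
    have "vsign k \<tau> * h k = - (vsign k \<tau> * (1 when (\<tau> - {k}, {}) = (set v, {})))" for k
    proof (cases "\<tau> - {k} = set v")
      case True
      then show ?thesis using v by (simp add: h_def)
    next
      case False
      then have "v \<noteq> sorted_list_of_set (\<tau> - {k})" using \<tau>(2) by (metis finite_Diff set_sorted_list_of_set)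
      then show ?thesis using False by (simp add: h_def)
    qed
    then show ?thesis using True
      by (simp add: \<tau>(1) koszul_gen_pair lookup_sum lookup_single sum_negf mult_when)
  next
    case False
    have "h k = 0" if k: "k \<in> \<tau>" for k
    proof (rule ccontr)
      assume "h k \<noteq> 0"
      then have v: "total_subset Q (sorted_list_of_set (\<tau> - {k})) = \<sigma>" "v = sorted_list_of_set (\<tau> - {k})"
        by (auto simp: h_def split: if_splits)
      then have "v \<in> \<Lambda>_gens Q n \<sigma>"
        using \<tau> k by (auto simp: \<Lambda>_gens_def)
      with False show False by blast
    qed
    then show ?thesis using False by simp
  qed
  finally show ?thesis by (simp add: \<tau>_def)
qed

text \<open>The factor \<delta> in the differential deletes the faces of lower degree, which is what
  \<open>gr\<close> does to Taylor's differential. The choice \<open>s = - 1\<close> reflects the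
  position count starting at 1.\<close>

lemma \<Lambda>_homology_presented:
  assumes Q: "simplicial_complement m Q"
  defines "D \<equiv> koszul (\<lambda>_ _. False) :: _ \<Rightarrow> (nat set \<times> nat set) \<Rightarrow>\<^sub>0 'k::comm_ring_1"
  shows "presented_quotient ((\<Lambda>_component Q \<sigma> q)\<lparr>carrier := cycles (\<Lambda>_component Q \<sigma>) (\<lambda>_. \<Lambda>_diff Q) q\<rparr>)
     (\<Lambda>_diff Q ` carrier (\<Lambda>_component Q \<sigma> (Suc q)))
     (cochain_of (\<Lambda>_gens Q q \<sigma>) (\<lambda>_. 1) (\<lambda>v. (set v, {})))
     (filtered_resolution.grZ (taylor_basis Q) (\<lambda>b. card (fst b)) (taylor_deg Q) D q \<sigma>)
     (filtered_resolution.grB (taylor_basis Q) (\<lambda>b. card (fst b)) (taylor_deg Q) D q \<sigma>)"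
proof -
  interpret T: filtered_resolution "complex_of m Q" "taylor_basis Q" "\<lambda>b. card (fst b)" "taylor_deg Q"
    D "\<lambda>x. coef x ({}, {})" "{1..m}"
    unfolding D_def by (rule taylor_resolution[OF Q])
  note pres = free_module_presented[OF \<Lambda>_gens_finite \<Lambda>_gens_bij, where \<theta> = "\<lambda>_. 1 :: 'k"]
  show ?thesis
  proof (rule T.presented_homology[where s = "- 1"])
    fix n and x :: "nat set \<times> nat set \<Rightarrow>\<^sub>0 'k"
    let ?g = "\<lambda>n. cochain_of (\<Lambda>_gens Q n \<sigma>) (\<lambda>_. 1 :: 'k) (\<lambda>v. (set v, {} :: nat set))"
    assume x: "x \<in> T.str (Suc n) \<sigma>"
    then have xc: "x \<in> chains (taylor_stratum Q (Suc n) \<sigma>)" by (simp add: T.str_def)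
    have fin: "finite (taylor_stratum Q (Suc n) \<sigma>)" using taylor_basis_fin by simp
    show "\<Lambda>_diff Q (?g (Suc n) x) = ?g n (scale (- 1) (T.grD \<sigma> x))"
    proof
      fix v
      have "\<Lambda>_diff Q (?g (Suc n) x) v = (\<Sum>u\<in>\<Lambda>_gens Q (Suc n) \<sigma>. coef x (set u, {}) * \<Lambda>_diff_gen Q u v)"
        unfolding \<Lambda>_diff_def
        by (rule sum.mono_neutral_cong_left[OF \<Lambda>_gens_finite]) (auto simp: cochain_of_def)
      also have "\<dots> = (\<Sum>u\<in>\<Lambda>_gens Q (Suc n) \<sigma>. coef x (set u, {}) * \<Lambda>_diff_gen Q (sorted_list_of_set (set u)) v)"
        by (intro sum.cong refl) (auto simp: \<Lambda>_gens_def strict_sorted_iff sorted_list_of_set.idem_if_sorted_distinct)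
      also have "\<dots> = (\<Sum>b\<in>taylor_stratum Q (Suc n) \<sigma>. coef x b * \<Lambda>_diff_gen Q (sorted_list_of_set (fst b)) v)"
        using sum.reindex_bij_betw[OF \<Lambda>_gens_bij, of "\<lambda>b. coef x b * \<Lambda>_diff_gen Q (sorted_list_of_set (fst b)) v"]
        by simp
      also have "\<dots> = (if v \<in> \<Lambda>_gens Q n \<sigma> then - coef (D x) (set v, {}) else 0)"
        unfolding D_def koszul_def coef_extend[OF xc fin]
        by (simp add: \<Lambda>_diff_gen_koszul sum_negf)
      also have "\<dots> = ?g n (scale (- 1) (T.grD \<sigma> x)) v"
        using bij_betwE[OF \<Lambda>_gens_bij[of Q n \<sigma>]] by (auto simp: cochain_of_def T.grD_def)
      finally show "\<Lambda>_diff Q (?g (Suc n) x) v = ?g n (scale (- 1) (T.grD \<sigma> x)) v" .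
    qed
  qed (use pres in \<open>auto simp: \<Lambda>_component_def T.str_def\<close>)
qed

section \<open>The cochains of a full subcomplex as a graded piece of the cube resolution\<close>

lemma coboundary_vsign:
  assumes "finite \<tau>"
  shows "coboundary K p f \<tau> = (if \<tau> \<in> K \<and> int (card \<tau>) = p + 2 then \<Sum>k\<in>\<tau>. vsign k \<tau> * f (\<tau> - {k}) else 0)"
  using sum_sorted_list_of_set[OF assms, of "\<lambda>k. f (\<tau> - {k})"] by (simp add: coboundary_def)

text \<open>
  Relates \<open>(V - c, c)\<close> to the cochain dual to \<open>c\<close>: the sign absorbs the difference between
  counting the vertices below \<open>k\<close> in \<open>V - c\<close> and in \<open>c\<close>.
\<close>

definition cube_sign :: "nat set \<Rightarrow> nat set \<Rightarrow> 'k::comm_ring_1"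
  where "cube_sign V c = (\<Prod>y\<in>c. vsign y V)"

lemma cube_sign_square: "cube_sign V c * cube_sign V c = 1"
  by (simp add: cube_sign_def flip: prod.distrib)

text \<open>Counting the elements of \<open>V\<close> below \<open>k\<close> separately in
  \<open>c\<close> and in \<open>V - (c - {k})\<close> writes \<open>vsign k V\<close> as a product
  of two signs, and \<open>vsign k V\<close> is the factor that \<open>cube_sign V c\<close> loses
  when \<open>k\<close> leaves \<open>c\<close>.\<close>

lemma cube_sign_remove:
  assumes V: "finite V" "c \<subseteq> V" "k \<in> c"
  shows "vsign k c * cube_sign V (c - {k}) = (cube_sign V c * vsign k (V - (c - {k})) :: 'k::comm_ring_1)"
proof -
  have c: "finite c" using V finite_subset by blast
  have 1: "cube_sign V c = vsign k V * (cube_sign V (c - {k}) :: 'k)"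
    unfolding cube_sign_def by (rule prod.remove[OF c V(3)])
  have "{y \<in> V. y < k} = {y \<in> c. y < k} \<union> {y \<in> V - (c - {k}). y < k}" using V by auto
  moreover have "card ({y \<in> c. y < k} \<union> {y \<in> V - (c - {k}). y < k}) = card {y \<in> c. y < k} + card {y \<in> V - (c - {k}). y < k}"
    using V c by (intro card_Un_disjoint) auto
  ultimately have 2: "vsign k V = vsign k c * (vsign k (V - (c - {k})) :: 'k)"
    by (simp add: vsign_def power_add)
  show ?thesis unfolding 1 2 by (simp add: mult.commute mult.left_commute)
qed

text \<open>In the stratum at \<open>V\<close> the first term of \<open>koszul_gen\<close> is lost,
  since it drops \<open>i\<close> from the degree; the second leads from \<open>(V - c, c)\<close>
  to pairs with one more vertex in \<open>c\<close>, a coboundary up to sign. The argument runs in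
  integer degrees, which rise as the homological degree falls and can leave the range of dimensions
  of faces at both ends.\<close>

lemma reduced_cohomology_presented:
  fixes K :: "nat set set"
  assumes K: "\<And>\<sigma> \<tau>. \<sigma> \<in> K \<Longrightarrow> \<tau> \<subseteq> \<sigma> \<Longrightarrow> \<tau> \<in> K" "\<And>\<sigma>. \<sigma> \<in> K \<Longrightarrow> \<sigma> \<subseteq> U" "finite U" and V: "V \<subseteq> U"
    and p: "p = int (card V) - int q - 1"
  defines "L \<equiv> {c \<in> K. c \<subseteq> V}"
    and "D \<equiv> koszul (\<lambda>c i. insert i c \<in> K) :: _ \<Rightarrow> (nat set \<times> nat set) \<Rightarrow>\<^sub>0 'k::comm_ring_1"
  shows "presented_quotient
      ((cochains L p)\<lparr>carrier := {f \<in> carrier (cochains L p). coboundary L p f = \<zero>\<^bsub>cochains L (p + 1)\<^esub>}\<rparr>)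
      (coboundary L (p - 1) ` carrier (cochains L (p - 1)))
      (cochain_of {c \<in> L. int (card c) = p + 1} (cube_sign V) (\<lambda>c. (V - c, c)))
      (filtered_resolution.grZ (cube_basis K U) (\<lambda>b. card (fst b)) (\<lambda>b. fst b \<union> snd b) D q V)
      (filtered_resolution.grB (cube_basis K U) (\<lambda>b. card (fst b)) (\<lambda>b. fst b \<union> snd b) D q V)"
proof -
  interpret T: filtered_resolution K "cube_basis K U" "\<lambda>b. card (fst b)" "\<lambda>b. fst b \<union> snd b"
    D "\<lambda>x. \<Sum>c\<in>K. coef x ({}, c)" U
    unfolding D_def by (rule cube_resolution[OF K])
  have finV: "finite V" using V K(3) by (rule finite_subset)
  have finL: "finite L" unfolding L_def by (rule finite_subset[of _ "Pow V"]) (use finV in auto)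
  define g where "g p = cochain_of {c \<in> L. int (card c) = p + 1} (cube_sign V :: _ \<Rightarrow> 'k) (\<lambda>c. (V - c, c))" for p
  define S where "S n = {b \<in> cube_basis K U. card (fst b) = n \<and> fst b \<union> snd b = V}" for n
  have bij: "bij_betw (\<lambda>c. (V - c, c)) {c \<in> L. int (card c) = p + 1} (S n)" if "p = int (card V) - int n - 1" for p n
  proof (rule bij_betwI[where g = snd])
    have card: "card (V - c) = n \<longleftrightarrow> int (card c) = p + 1" if "c \<subseteq> V" for c
      using card_Diff_subset[OF finite_subset[OF that finV] that] card_mono[OF finV that] \<open>p = _\<close> by linarith
    show "(\<lambda>c. (V - c, c)) \<in> {c \<in> L. int (card c) = p + 1} \<rightarrow> S n"
      using card V by (auto simp: S_def L_def cube_basis_def)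
    have split: "fst b = V - snd b \<and> snd b \<in> L" if "b \<in> S n" for b
      using that by (cases b) (auto simp: S_def L_def cube_basis_def)
    show "snd \<in> S n \<rightarrow> {c \<in> L. int (card c) = p + 1}"
    proof
      fix b assume b: "b \<in> S n"
      then have "card (V - snd b) = n" using split[OF b] by (simp add: S_def)
      then show "snd b \<in> {c \<in> L. int (card c) = p + 1}"
        using split[OF b] card[of "snd b"] by (simp add: L_def)
    qed
    show "(V - snd b, snd b) = b" if "b \<in> S n" for b using split[OF that] by (cases b) simp
  qed simp
  have str: "T.str n V = chains (S n)" for n by (simp add: T.str_def S_def)
  note pres = free_module_presented[where \<theta> = "cube_sign V :: _ \<Rightarrow> 'k", OF _ bij cube_sign_square, folded g_def]
  have fin_faces: "finite {c \<in> L. int (card c) = p + 1}" for p using finL by simp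
  have carrier: "carrier (cochains L p) = g p ` T.str n V" and inj: "inj_on (g p) (T.str n V)"
    if "p = int (card V) - int n - 1" for p n
    using pres(1,2)[OF fin_faces that] by (simp_all add: cochains_def str)
  \<comment> \<open>The sign is that of the upper face in \<open>koszul_gen\<close>; the signs that
    depend on the position are absorbed by \<open>cube_sign\<close>.\<close>
  have cob: "coboundary L p (g p x) = g (p + 1) (scale (- 1) (T.grD V x))"
    if x: "x \<in> T.str n V" and p: "p = int (card V) - int n - 1" for p n x
  proof
    fix c
    show "coboundary L p (g p x) c = g (p + 1) (scale (- 1) (T.grD V x)) c"
    proof (cases "c \<in> L \<and> int (card c) = p + 2")
      case True
      then have c: "c \<in> K" "c \<subseteq> V" "finite c" using finV finite_subset by (auto simp: L_def)
      have x': "x \<in> chains (S n)" using x by (simp add: str)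
      have fin: "finite (S n)" using bij_betw_finite[OF bij[OF p]] fin_faces by blast
      have kg: "coef (koszul_gen (\<lambda>c i. insert i c \<in> K) b :: _ \<Rightarrow>\<^sub>0 'k) (V - c, c)
        = - (\<Sum>i\<in>c. if b = (V - (c - {i}), c - {i}) then vsign i (V - (c - {i})) else 0)" if b: "b \<in> S n" for b
      proof -
        obtain \<tau> e where te: "b = (\<tau>, e)" by (cases b)
        have e: "\<tau> = V - e" "e \<subseteq> V" "\<tau> \<subseteq> V" "finite \<tau>" "e \<in> K"
          using b finV by (auto simp: te S_def cube_basis_def intro: finite_subset)
        have *: "coef (gen (\<tau> - {i}, e) - (if insert i e \<in> K then gen (\<tau> - {i}, insert i e) else 0) :: _ \<Rightarrow>\<^sub>0 'k) (V - c, c)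
          = - (if i \<in> c \<and> e = c - {i} then 1 else 0)" if "i \<in> \<tau>" for i
        proof -
          \<comment> \<open>The lower face has degree \<open>V - {i}\<close> and so never lies in
            the stratum.\<close>
          have 1: "(\<tau> - {i}, e) \<noteq> (V - c, c)" using e that by auto
          have 2: "insert i e \<in> K \<and> (\<tau> - {i}, insert i e) = (V - c, c) \<longleftrightarrow> i \<in> c \<and> e = c - {i}"
          proof
            assume "insert i e \<in> K \<and> (\<tau> - {i}, insert i e) = (V - c, c)"
            then have "c = insert i e" by simp
            moreover have "i \<notin> e" using e(1) that by simp
            ultimately show "i \<in> c \<and> e = c - {i}" by simp
          next
            assume "i \<in> c \<and> e = c - {i}"
            then have ce: "c = insert i e" by blast
            have "\<tau> - {i} = V - c" unfolding ce e(1) by blast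
            then show "insert i e \<in> K \<and> (\<tau> - {i}, insert i e) = (V - c, c)" using ce c(1) by simp
          qed
          show ?thesis
            using 1 2 by (cases "insert i e \<in> K"; cases "i \<in> c \<and> e = c - {i}")
              (simp_all add: lookup_minus lookup_single when_def del: prod.inject)
        qed
        have eq: "b = (V - (c - {i}), c - {i}) \<longleftrightarrow> e = c - {i}" for i using e te by auto
        have "coef (koszul_gen (\<lambda>c i. insert i c \<in> K) b :: _ \<Rightarrow>\<^sub>0 'k) (V - c, c)
          = (\<Sum>i\<in>\<tau>. vsign i \<tau> * - (if i \<in> c \<and> e = c - {i} then 1 else 0))"
          unfolding te koszul_gen_pair lookup_sum coef_scale by (rule sum.cong[OF refl]) (simp only: *)
        also have "\<dots> = - (\<Sum>i\<in>\<tau>. if i \<in> c \<and> e = c - {i} then vsign i \<tau> else 0)"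
          unfolding sum_negf[symmetric] by (rule sum.cong[OF refl]) simp
        also have "(\<Sum>i\<in>\<tau>. if i \<in> c \<and> e = c - {i} then vsign i \<tau> else 0)
          = (\<Sum>i\<in>V. if i \<in> c \<and> e = c - {i} then vsign i \<tau> else (0 :: 'k))"
          using e by (intro sum.mono_neutral_left finV) auto
        also have "\<dots> = (\<Sum>i\<in>c. if e = c - {i} then vsign i \<tau> else 0)"
          using c by (intro sum.mono_neutral_cong_right finV) auto
        also have "\<dots> = (\<Sum>i\<in>c. if b = (V - (c - {i}), c - {i}) then vsign i (V - (c - {i})) else 0)"
          by (intro sum.cong refl) (auto simp: eq e(1))
        finally show ?thesis .
      qed
      \<comment> \<open>If the pair is not in \<open>S n\<close>, then \<open>x\<close> has
        coefficient 0 there and both sides vanish.\<close>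
      have pick: "(\<Sum>b\<in>S n. if b = (V - (c - {i}), c - {i}) then coef x b * vsign i (V - (c - {i})) else 0)
        = vsign i (V - (c - {i})) * coef x (V - (c - {i}), c - {i})" for i
        using fin coef_mem_chains[OF x'] by (simp add: sum.delta' sum.delta mult.commute)
      have "coef (D x) (V - c, c) = (\<Sum>b\<in>S n. coef x b * coef (koszul_gen (\<lambda>c i. insert i c \<in> K) b) (V - c, c))"
        unfolding D_def koszul_def by (rule coef_extend[OF x' fin])
      also have "\<dots> = (\<Sum>b\<in>S n. - (\<Sum>i\<in>c. if b = (V - (c - {i}), c - {i}) then coef x b * vsign i (V - (c - {i})) else 0))"
      proof (rule sum.cong[OF refl])
        fix b assume b: "b \<in> S n"
        show "coef x b * coef (koszul_gen (\<lambda>c i. insert i c \<in> K) b) (V - c, c)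
          = - (\<Sum>i\<in>c. if b = (V - (c - {i}), c - {i}) then coef x b * vsign i (V - (c - {i})) else 0)"
          unfolding kg[OF b] mult_minus_right sum_distrib_left
          by (intro arg_cong[where f = uminus] sum.cong refl) (simp only: mult_zero_right if_distrib[of "(*) _"])
      qed
      also have "\<dots> = - (\<Sum>b\<in>S n. \<Sum>i\<in>c. if b = (V - (c - {i}), c - {i}) then coef x b * vsign i (V - (c - {i})) else 0)"
        by (rule sum_negf)
      also have "\<dots> = - (\<Sum>i\<in>c. vsign i (V - (c - {i})) * coef x (V - (c - {i}), c - {i}))"
        by (subst sum.swap) (simp add: pick)
      finally have Dx: "coef (D x) (V - c, c) = - (\<Sum>i\<in>c. vsign i (V - (c - {i})) * coef x (V - (c - {i}), c - {i}))" .
      have face: "c - {k} \<in> L \<and> int (card (c - {k})) = p + 1" if "k \<in> c" for k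
      proof
        show "c - {k} \<in> L" using c K(1)[OF c(1), of "c - {k}"] by (auto simp: L_def)
        show "int (card (c - {k})) = p + 1" using card.remove[OF c(3) that] True by linarith
      qed
      have "coboundary L p (g p x) c = (\<Sum>k\<in>c. vsign k c * (cube_sign V (c - {k}) * coef x (V - (c - {k}), c - {k})))"
        using True face by (simp add: coboundary_vsign[OF c(3)] g_def cochain_of_def)
      also have "\<dots> = (\<Sum>k\<in>c. cube_sign V c * (vsign k (V - (c - {k})) * coef x (V - (c - {k}), c - {k})))"
        using cube_sign_remove[OF finV c(2), where 'k = 'k] by (intro sum.cong refl) (simp flip: mult.assoc)
      also have "\<dots> = cube_sign V c * - coef (D x) (V - c, c)" by (simp add: Dx sum_distrib_left)
      also have "\<dots> = g (p + 1) (scale (- 1) (T.grD V x)) c"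
        using True c by (auto simp: g_def cochain_of_def T.grD_def)
      finally show ?thesis .
    next
      case False
      then show ?thesis by (auto simp: coboundary_def g_def cochain_of_def)
    qed
  qed
  have g0: "\<zero>\<^bsub>cochains L p\<^esub> = g p 0" for p
    by (simp add: cochains_def free_module_def coeff_ring_def g_def cochain_of_def fun_eq_iff)
  have im: "coboundary L (p - 1) ` carrier (cochains L (p - 1)) = g p ` T.grB q V"
  proof -
    have p': "p - 1 = int (card V) - int (Suc q) - 1" using p by simp
    have "coboundary L (p - 1) ` carrier (cochains L (p - 1)) = (\<lambda>x. g p (scale (- 1) (T.grD V x))) ` T.str (Suc q) V"
      using cob[OF _ p'] by (simp add: carrier[OF p'] image_image cong: image_cong)
    also have "\<dots> = g p ` (\<lambda>x. scale (- 1) x) ` T.grB q V" by (simp add: T.grB_def image_image)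
    also have "(\<lambda>x. scale (- 1) x) ` T.grB q V = T.grB q V"
      using subspaceD(3)[OF T.subspace_grB, of _ q V "- 1"] by (force simp: image_iff)
    finally show ?thesis .
  qed
  have ker: "{f \<in> carrier (cochains L p). coboundary L p f = \<zero>\<^bsub>cochains L (p + 1)\<^esub>} = g p ` T.grZ q V"
  proof -
    have "coboundary L p (g p x) = \<zero>\<^bsub>cochains L (p + 1)\<^esub> \<longleftrightarrow> T.grD V x = 0" if x: "x \<in> T.str q V" for x
    proof (cases q)
      \<comment> \<open>There is no lower stratum whose injectivity could be used;
        \<open>grD\<close> vanishes in homological degree 0, so both conditions hold.\<close>
      case 0
      then show ?thesis using x T.grD_str_0[of x V] by (simp add: cob[OF x p] g0)
    next
      case (Suc n)
      have p': "p + 1 = int (card V) - int n - 1" using p Suc by simp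
      have "T.grD V x \<in> T.str n V" using x T.grD_str Suc by simp
      then have "scale (- 1) (T.grD V x) \<in> T.str n V" by (rule subspaceD(3)[OF T.subspace_str])
      then have "coboundary L p (g p x) = \<zero>\<^bsub>cochains L (p + 1)\<^esub> \<longleftrightarrow> scale (- 1) (T.grD V x) = 0"
        unfolding cob[OF x p] g0 using inj_on_eq_iff[OF inj[OF p']] subspaceD(1)[OF T.subspace_str] by blast
      then show ?thesis by simp
    qed
    then show ?thesis by (auto simp: carrier[OF p] T.grZ_def)
  qed
  show ?thesis
    unfolding g_def[symmetric]
  proof
    show "subspace (T.grZ q V)" "subspace (T.grB q V)" by (rule T.subspace_grZ T.subspace_grB)+
    show "T.grB q V \<subseteq> T.grZ q V" using T.grB_grZ by blast
    show "inj_on (g p) (T.grZ q V)" using inj_on_subset[OF inj[OF p]] by (auto simp: T.grZ_def)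
  qed (use im ker pres(3,4)[OF fin_faces p] in \<open>simp_all add: cochains_def\<close>)
qed

section \<open>Graded modules over the polynomial ring\<close>

lemma mpoly_ring_simps [simp]:
  "carrier (mpoly_ring m) = {p. supp p \<subseteq> degrees m}"
  "mult (mpoly_ring m) = (*)" "one (mpoly_ring m) = 1" "zero (mpoly_ring m) = 0" "add (mpoly_ring m) = (+)"
  by (simp_all add: mpoly_ring_def)

lemma degrees_0 [simp]: "0 \<in> degrees m"
  by (simp add: degrees_def)

lemma keys_add_nat: "supp (a + b :: expo) = supp a \<union> supp b"
  by (auto simp: in_keys_iff lookup_add)

lemma degrees_add: "a + b \<in> degrees m \<longleftrightarrow> a \<in> degrees m \<and> b \<in> degrees m"
  by (auto simp: degrees_def keys_add_nat)

lemma mult_degrees: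
  assumes "supp p \<subseteq> degrees m" "supp q \<subseteq> degrees m"
  shows "supp (p * q :: 'k::comm_ring_1 mpoly) \<subseteq> degrees m"
  using keys_mult[of p q] assms by (fastforce simp: degrees_add)

lemma mpoly_cring: "cring (mpoly_ring m :: 'k::comm_ring_1 mpoly ring)"
proof (rule cringI)
  show "abelian_group (mpoly_ring m :: 'k mpoly ring)"
  proof (rule abelian_groupI)
    fix x y :: "'k mpoly" assume "x \<in> carrier (mpoly_ring m)" "y \<in> carrier (mpoly_ring m)"
    then show "x \<oplus>\<^bsub>mpoly_ring m\<^esub> y \<in> carrier (mpoly_ring m)"
      using keys_add[of x y] by auto
    show "\<exists>y\<in>carrier (mpoly_ring m). y \<oplus>\<^bsub>mpoly_ring m\<^esub> x = \<zero>\<^bsub>mpoly_ring m\<^esub>"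
      using \<open>x \<in> _\<close> by (intro bexI[of _ "- x"]) (auto simp: in_keys_iff subset_iff)
  qed (simp_all add: add.assoc add.commute)
  show "comm_monoid (mpoly_ring m :: 'k mpoly ring)"
    by (rule comm_monoidI) (auto simp: mult.assoc mult.commute dest: mult_degrees[THEN subsetD])
qed (simp add: distrib_right)

lemma term_poly_carrier [simp]: "a \<in> degrees m \<Longrightarrow> term_poly a c \<in> carrier (mpoly_ring m)"
  by (simp add: term_poly_def)

lemma term_poly_mult: "term_poly a c * term_poly b e = term_poly (a + b) (c * e)"
  by (simp add: term_poly_def mult_single)

lemma term_poly_simps [simp]: "term_poly a 0 = 0" "term_poly 0 1 = 1"
  by (simp_all add: term_poly_def)

lemma term_poly_add: "term_poly a (c + e) = term_poly a c + term_poly a e"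
  by (simp add: term_poly_def single_add)

lemma keys_term_poly: "supp (term_poly a c) \<subseteq> {a}"
  by (simp add: term_poly_def)

lemma coef_term_poly: "coef (term_poly a c) b = (if a = b then c else 0)"
  by (simp add: term_poly_def lookup_single when_def)

text \<open>The exponent 0 is a sum of two exponents only as 0 + 0. This multiplicativity is what
  the action of polynomials on the trivial module rests on.\<close>

lemma coef_mult_0: "coef (p * q :: 'k::comm_ring_1 mpoly) 0 = coef p 0 * coef q 0"
proof -
  have "coef (p * q) 0 = prod_fun (coef p) (coef q) 0" by (simp add: times_poly_mapping.rep_eq)
  also have "\<dots> = (\<Sum>(a, b). coef p a * coef q b when (0 :: expo) = a + b)"
    by (rule prod_fun_unfold_prod) simp_all
  also have "\<dots> = (\<Sum>ab. (coef p 0 * coef q 0) when ab = (0 :: expo, 0 :: expo))"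
  proof (rule Sum_any.cong)
    fix ab :: "expo \<times> expo"
    have "(0 :: expo) = a + b \<longleftrightarrow> a = 0 \<and> b = 0" for a b
      by (auto simp: poly_mapping_eq_iff fun_eq_iff lookup_add)
    then show "(case ab of (a, b) \<Rightarrow> coef p a * coef q b when (0 :: expo) = a + b) = (coef p 0 * coef q 0 when ab = (0, 0))"
      by (cases ab) (auto simp: when_def)
  qed
  also have "\<dots> = coef p 0 * coef q 0" by simp
  finally show ?thesis .
qed

lemma additive_finsum:
  assumes M: "abelian_monoid M" and N: "abelian_monoid N"
    and f: "f \<in> carrier M \<rightarrow> carrier N" and f0: "f \<zero>\<^bsub>M\<^esub> = \<zero>\<^bsub>N\<^esub>"
    and add: "\<And>x y. x \<in> carrier M \<Longrightarrow> y \<in> carrier M \<Longrightarrow> f (x \<oplus>\<^bsub>M\<^esub> y) = f x \<oplus>\<^bsub>N\<^esub> f y"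
    and A: "finite A" "h \<in> A \<rightarrow> carrier M"
  shows "f (finsum M h A) = finsum N (\<lambda>i. f (h i)) A"
proof -
  interpret M: abelian_monoid M by fact
  interpret N: abelian_monoid N by fact
  show ?thesis using A
  proof (induction A rule: finite_induct)
    case (insert i A)
    then have "h \<in> A \<rightarrow> carrier M" "h i \<in> carrier M" by auto
    moreover from this have "(\<lambda>i. f (h i)) \<in> A \<rightarrow> carrier N" "f (h i) \<in> carrier N" using f by auto
    ultimately show ?case using insert by (simp add: add M.finsum_closed)
  qed (simp add: f0)
qed

lemma additive_sum:
  fixes \<chi> :: "'a \<Rightarrow> 'x::ab_group_add"
  assumes M: "abelian_monoid M"
    and add: "\<And>x y. x \<in> carrier M \<Longrightarrow> y \<in> carrier M \<Longrightarrow> \<chi> (x \<oplus>\<^bsub>M\<^esub> y) = \<chi> x + \<chi> y"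
    and A: "finite A" "h \<in> A \<rightarrow> carrier M"
  shows "\<chi> (finsum M h A) = (\<Sum>i\<in>A. \<chi> (h i))"
proof -
  interpret M: abelian_monoid M by fact
  have \<chi>0: "\<chi> \<zero>\<^bsub>M\<^esub> = 0" using add[of "\<zero>\<^bsub>M\<^esub>" "\<zero>\<^bsub>M\<^esub>"] by simp
  show ?thesis using A
  proof (induction A rule: finite_induct)
    case (insert i A)
    then have "h \<in> A \<rightarrow> carrier M" "h i \<in> carrier M" by auto
    then show ?case using insert by (simp add: add M.finsum_closed)
  qed (simp add: \<chi>0)
qed

lemma linear_mapD:
  assumes "linear_map R M N f"
  shows "x \<in> carrier M \<Longrightarrow> f x \<in> carrier N"
    "x \<in> carrier M \<Longrightarrow> y \<in> carrier M \<Longrightarrow> f (x \<oplus>\<^bsub>M\<^esub> y) = f x \<oplus>\<^bsub>N\<^esub> f y"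
    "r \<in> carrier R \<Longrightarrow> x \<in> carrier M \<Longrightarrow> f (r \<odot>\<^bsub>M\<^esub> x) = r \<odot>\<^bsub>N\<^esub> f x"
  using assms by (auto simp: linear_map_def)

lemma linear_map_zero:
  assumes "linear_map R M N f" "abelian_group M" "abelian_group N"
  shows "f \<zero>\<^bsub>M\<^esub> = \<zero>\<^bsub>N\<^esub>"
proof -
  interpret M: abelian_group M by fact
  interpret N: abelian_group N by fact
  have "f \<zero>\<^bsub>M\<^esub> \<oplus>\<^bsub>N\<^esub> f \<zero>\<^bsub>M\<^esub> = f \<zero>\<^bsub>M\<^esub>"
    using linear_mapD(2)[OF assms(1), of "\<zero>\<^bsub>M\<^esub>" "\<zero>\<^bsub>M\<^esub>"] by simp
  then show ?thesis
    using linear_mapD(1)[OF assms(1) M.zero_closed] by (metis N.add.r_cancel_one')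
qed

locale graded_mod =
  fixes m :: nat and M :: "('k::comm_ring_1 mpoly, 'a) graded_module"
  assumes graded: "graded_module m M"
begin

sublocale module "mpoly_ring m" M
  using graded by (simp add: graded_module_def)

lemma homog_subgroup: "a \<in> degrees m \<Longrightarrow> additive_subgroup (homog M a) M"
  using graded by (simp add: graded_module_def)

lemma homog_closed:
  assumes "a \<in> degrees m"
  shows "x \<in> homog M a \<Longrightarrow> x \<in> carrier M" "\<zero>\<^bsub>M\<^esub> \<in> homog M a"
    "x \<in> homog M a \<Longrightarrow> y \<in> homog M a \<Longrightarrow> x \<oplus>\<^bsub>M\<^esub> y \<in> homog M a"
proof -
  interpret additive_subgroup "homog M a" M using homog_subgroup[OF assms] .
  show "x \<in> homog M a \<Longrightarrow> x \<in> carrier M" "\<zero>\<^bsub>M\<^esub> \<in> homog M a"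
    "x \<in> homog M a \<Longrightarrow> y \<in> homog M a \<Longrightarrow> x \<oplus>\<^bsub>M\<^esub> y \<in> homog M a"
    using a_subset by auto
qed

lemma homog_term:
  "a \<in> degrees m \<Longrightarrow> b \<in> degrees m \<Longrightarrow> x \<in> homog M b \<Longrightarrow> term_poly a c \<odot>\<^bsub>M\<^esub> x \<in> homog M (a + b)"
  using graded by (simp add: graded_module_def)

lemma homog_finsum:
  assumes a: "a \<in> degrees m" and A: "finite A" "\<And>i. i \<in> A \<Longrightarrow> h i \<in> homog M a"
  shows "finsum M h A \<in> homog M a"
  using A
proof (induction A rule: finite_induct)
  case (insert i A)
  then have "h \<in> A \<rightarrow> carrier M" "h i \<in> carrier M" using homog_closed(1)[OF a] by auto
  then show ?case using insert homog_closed(3)[OF a] by simp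
qed (simp add: homog_closed[OF a])

lemma finsum_delta:
  assumes "finite E" "a \<in> E" "x \<in> carrier M"
  shows "finsum M (\<lambda>e. if e = a then x else \<zero>\<^bsub>M\<^esub>) E = x"
  using add.finprod_singleton[of a E "\<lambda>_. x"] assms by (simp add: eq_commute[of a])

text \<open>Families on a finite set \<open>E\<close> of degrees are extended by 0 to all degrees,
  where the uniqueness built into \<open>graded_module\<close> applies. The common index set spares
  the comparison of supports.\<close>

lemma decomposition_unique:
  assumes E: "finite E" "E \<subseteq> degrees m"
    and u: "\<And>e. e \<in> E \<Longrightarrow> u e \<in> homog M e" and v: "\<And>e. e \<in> E \<Longrightarrow> v e \<in> homog M e"
    and eq: "finsum M u E = finsum M v E" and e: "e \<in> E"
  shows "u e = v e"
proof -
  let ?Q = "\<lambda>x u. (\<forall>a\<in>degrees m. u a \<in> homog M a) \<and> (\<forall>a. a \<notin> degrees m \<longrightarrow> u a = \<zero>\<^bsub>M\<^esub>) \<and>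
       finite {a. u a \<noteq> \<zero>\<^bsub>M\<^esub>} \<and> x = (\<Oplus>\<^bsub>M\<^esub>a\<in>{a. u a \<noteq> \<zero>\<^bsub>M\<^esub>}. u a)"
  define cut where "cut w e = (if e \<in> E then w e else \<zero>\<^bsub>M\<^esub>)" for w :: "expo \<Rightarrow> 'a" and e
  have Q: "?Q (finsum M w E) (cut w)" if w: "\<And>e. e \<in> E \<Longrightarrow> w e \<in> homog M e" for w
  proof (intro conjI ballI allI impI)
    show "cut w a \<in> homog M a" if "a \<in> degrees m" for a
      using w homog_closed(2)[OF that] by (simp add: cut_def)
    show "cut w a = \<zero>\<^bsub>M\<^esub>" if "a \<notin> degrees m" for a
      using that E by (auto simp: cut_def)
    have sub: "{a. cut w a \<noteq> \<zero>\<^bsub>M\<^esub>} \<subseteq> E" by (auto simp: cut_def)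
    show "finite {a. cut w a \<noteq> \<zero>\<^bsub>M\<^esub>}" using finite_subset[OF sub E(1)] .
    have w': "w \<in> E \<rightarrow> carrier M" using w homog_closed(1) E(2) by blast
    show "finsum M w E = finsum M (cut w) {a. cut w a \<noteq> \<zero>\<^bsub>M\<^esub>}"
      by (rule add.finprod_mono_neutral_cong_right[OF E(1) sub]) (use w' in \<open>auto simp: cut_def\<close>)
  qed
  have "finsum M u E \<in> carrier M"
    using u homog_closed(1) E(2) by (intro finsum_closed) blast
  then have "\<exists>!w. ?Q (finsum M u E) w" using graded unfolding graded_module_def by blast
  with Q[OF u] Q[OF v] have "cut u = cut v" unfolding eq by blast
  then have "cut u e = cut v e" by simp
  with e show ?thesis by (simp add: cut_def)
qed

text \<open>The given degree \<open>a\<close> is put into \<open>E\<close> even if its component is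
  0, so that this component can be singled out.\<close>

lemma decomposition_exists:
  assumes x: "x \<in> carrier M" and a: "a \<in> degrees m"
  obtains E u where "finite E" "a \<in> E" "E \<subseteq> degrees m" "\<And>e. e \<in> E \<Longrightarrow> u e \<in> homog M e" "x = finsum M u E"
proof -
  obtain u where u: "\<forall>a\<in>degrees m. u a \<in> homog M a" "\<forall>a. a \<notin> degrees m \<longrightarrow> u a = \<zero>\<^bsub>M\<^esub>"
    "finite {a. u a \<noteq> \<zero>\<^bsub>M\<^esub>}" "x = (\<Oplus>\<^bsub>M\<^esub>a\<in>{a. u a \<noteq> \<zero>\<^bsub>M\<^esub>}. u a)"
    using graded x unfolding graded_module_def by blast
  define E where "E = insert a {a. u a \<noteq> \<zero>\<^bsub>M\<^esub>}"
  have E: "finite E" "a \<in> E" "E \<subseteq> degrees m" using u a by (auto simp: E_def)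
  have hom: "u e \<in> homog M e" if "e \<in> E" for e using u(1) E(3) that by blast
  have "u \<in> E \<rightarrow> carrier M" using hom homog_closed(1) E(3) by blast
  then have "x = finsum M u E"
    unfolding u(4) by (intro add.finprod_mono_neutral_cong_left E(1)) (auto simp: E_def)
  with E hom that show ?thesis by blast
qed

end

text \<open>The component of \<open>w\<close> in degree \<open>a\<close> does it: \<open>f\<close>
  carries the decomposition of \<open>w\<close> to one of \<open>f w\<close>, which is concentrated
  in degree \<open>a\<close>. In this way exactness of a graded resolution gives exactness in each
  degree.\<close>

lemma graded_map_homog_preimage:
  assumes M: "graded_mod m M" and N: "graded_mod m N" and f: "graded_map m M N f"
    and a: "a \<in> degrees m" and w: "w \<in> carrier M" "f w \<in> homog N a"
  shows "\<exists>w'\<in>homog M a. f w' = f w"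
proof -
  interpret M: graded_mod m M by fact
  interpret N: graded_mod m N by fact
  have lin: "linear_map (mpoly_ring m) M N f" and hom: "\<And>e x. e \<in> degrees m \<Longrightarrow> x \<in> homog M e \<Longrightarrow> f x \<in> homog N e"
    using f by (auto simp: graded_map_def)
  obtain E u where E: "finite E" "a \<in> E" "E \<subseteq> degrees m" and u: "\<And>e. e \<in> E \<Longrightarrow> u e \<in> homog M e"
    and wu: "w = finsum M u E" using M.decomposition_exists[OF w(1) a] by blast
  have f0: "f \<zero>\<^bsub>M\<^esub> = \<zero>\<^bsub>N\<^esub>"
    using linear_map_zero[OF lin M.abelian_group_axioms N.abelian_group_axioms] .
  have uc: "u \<in> E \<rightarrow> carrier M" using u E(3) M.homog_closed(1) by blast
  have "f w = finsum N (\<lambda>e. f (u e)) E"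
    unfolding wu using linear_mapD[OF lin] f0 uc E(1)
    by (intro additive_finsum M.abelian_monoid_axioms N.abelian_monoid_axioms) auto
  moreover have "f w = finsum N (\<lambda>e. if e = a then f w else \<zero>\<^bsub>N\<^esub>) E"
    using N.finsum_delta[OF E(1,2)] linear_mapD(1)[OF lin w(1)] by simp
  ultimately have "f (u a) = (if a = a then f w else \<zero>\<^bsub>N\<^esub>)"
    using E u hom w(2) N.homog_closed(2)
    by (intro N.decomposition_unique[OF E(1,3), where v = "\<lambda>e. if e = a then f w else \<zero>\<^bsub>N\<^esub>"]) auto
  then show ?thesis using u[OF E(2)] by auto
qed

lemma coef_sqf: "finite \<sigma> \<Longrightarrow> coef (squarefree_expo \<sigma>) i = (if i \<in> \<sigma> then 1 else 0)"
  by (simp add: squarefree_expo_def lookup_sum lookup_single when_def)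

lemma keys_sqf: "finite \<sigma> \<Longrightarrow> supp (squarefree_expo \<sigma>) = \<sigma>"
  by (auto simp: in_keys_iff coef_sqf split: if_splits)

lemma sqf_degrees: "\<sigma> \<subseteq> {1..m} \<Longrightarrow> squarefree_expo \<sigma> \<in> degrees m"
  using finite_subset[of \<sigma> "{1..m}"] by (simp add: degrees_def keys_sqf)

lemma sqf_add: "finite \<sigma> \<Longrightarrow> \<tau> \<subseteq> \<sigma> \<Longrightarrow> squarefree_expo (\<sigma> - \<tau>) + squarefree_expo \<tau> = squarefree_expo \<sigma>"
  by (rule poly_mapping_eqI) (auto simp: lookup_add coef_sqf finite_subset[of \<tau> \<sigma>])

text \<open>Summands of a 0/1 vector are 0/1 vectors with complementary supports. This confines the
  computation in degree \<sigma> to basis elements of squarefree degree inside \<sigma>.\<close>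

lemma sqf_summand:
  assumes "finite \<sigma>" "e + e' = squarefree_expo \<sigma>"
  shows "e' = squarefree_expo (supp e')" "supp e' \<subseteq> \<sigma>" "e = squarefree_expo (\<sigma> - supp e')"
proof -
  have sum: "coef e i + coef e' i = (if i \<in> \<sigma> then 1 else 0)" for i
    using arg_cong[OF assms(2), of "\<lambda>p. coef p i"] by (simp add: lookup_add coef_sqf[OF assms(1)])
  have le: "coef e' i \<le> 1" for i using sum[of i] by (simp split: if_splits)
  show sub: "supp e' \<subseteq> \<sigma>"
  proof
    fix i assume "i \<in> supp e'"
    then show "i \<in> \<sigma>" using sum[of i] by (simp add: in_keys_iff split: if_splits)
  qed
  show e': "e' = squarefree_expo (supp e')"
  proof (rule poly_mapping_eqI)
    fix i show "coef e' i = coef (squarefree_expo (supp e')) i"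
      using le[of i] by (auto simp: coef_sqf in_keys_iff)
  qed
  have "e + e' = squarefree_expo (\<sigma> - supp e') + squarefree_expo (supp e')"
    by (simp only: sqf_add[OF assms(1) sub] assms(2))
  also have "\<dots> = squarefree_expo (\<sigma> - supp e') + e'" by (simp only: e'[symmetric])
  finally show "e = squarefree_expo (\<sigma> - supp e')" by simp
qed

section \<open>Graded free modules in squarefree degrees\<close>

locale graded_free_mod = graded_mod m M for m :: nat and M :: "('k::comm_ring_1 mpoly, 'a) graded_module" +
  fixes B :: "'a set"
  assumes B_homog: "B \<subseteq> (\<Union>a\<in>degrees m. homog M a)"
    and coords: "x \<in> carrier M \<Longrightarrow> \<exists>!c. c \<in> carrier (free_module (mpoly_ring m) B) \<and>
         x = (\<Oplus>\<^bsub>M\<^esub>b\<in>{b. c b \<noteq> 0}. c b \<odot>\<^bsub>M\<^esub> b)"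
begin

definition FB :: "('a \<Rightarrow> 'k mpoly) set"
  where "FB = {c. (\<forall>b. supp (c b) \<subseteq> degrees m) \<and> (\<forall>b. b \<notin> B \<longrightarrow> c b = 0) \<and> finite {b. c b \<noteq> 0}}"

lemma FB_free_module: "carrier (free_module (mpoly_ring m) B) = FB"
proof -
  have "supp (c b) \<subseteq> degrees m" if "\<forall>x\<in>B. supp (c x) \<subseteq> degrees m" "\<forall>x. x \<notin> B \<longrightarrow> c x = 0" for c b
    using that by (cases "b \<in> B") auto
  then show ?thesis unfolding FB_def by (simp add: free_module_def) blast
qed

lemma FB_D: "c \<in> FB \<Longrightarrow> c b \<in> carrier (mpoly_ring m)" "c \<in> FB \<Longrightarrow> c b \<noteq> 0 \<Longrightarrow> b \<in> B" "c \<in> FB \<Longrightarrow> finite {b. c b \<noteq> 0}"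
  by (auto simp: FB_def)

definition rep :: "('a \<Rightarrow> 'k mpoly) \<Rightarrow> 'a"
  where "rep c = (\<Oplus>\<^bsub>M\<^esub>b\<in>{b. c b \<noteq> 0}. c b \<odot>\<^bsub>M\<^esub> b)"

lemma B_carrier: "b \<in> B \<Longrightarrow> b \<in> carrier M"
  using B_homog homog_closed(1) by blast

lemma term_carrier: "c \<in> FB \<Longrightarrow> b \<in> B \<Longrightarrow> c b \<odot>\<^bsub>M\<^esub> b \<in> carrier M"
  using FB_D(1) B_carrier by (intro smult_closed)

lemma rep_superset:
  assumes c: "c \<in> FB" and S: "finite S" "S \<subseteq> B" "\<And>b. c b \<noteq> 0 \<Longrightarrow> b \<in> S"
  shows "rep c = (\<Oplus>\<^bsub>M\<^esub>b\<in>S. c b \<odot>\<^bsub>M\<^esub> b)"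
  unfolding rep_def
proof (rule add.finprod_mono_neutral_cong_left[OF S(1)])
  show "{b. c b \<noteq> 0} \<subseteq> S" using S by blast
  show "(\<lambda>b. c b \<odot>\<^bsub>M\<^esub> b) \<in> S \<rightarrow> carrier M" using term_carrier[OF c] S by blast
  show "c b \<odot>\<^bsub>M\<^esub> b = \<zero>\<^bsub>M\<^esub>" if "b \<in> S - {b. c b \<noteq> 0}" for b
    using that B_carrier S smult_l_null[of b] by auto
qed simp

lemma rep_closed: "c \<in> FB \<Longrightarrow> rep c \<in> carrier M"
  unfolding rep_def by (rule finsum_closed, rule funcsetI, rule term_carrier) (auto dest: FB_D(2))

lemma FB_add: "c \<in> FB \<Longrightarrow> c' \<in> FB \<Longrightarrow> (\<lambda>b. c b + c' b) \<in> FB"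
proof -
  assume c: "c \<in> FB" "c' \<in> FB"
  have "{b. c b + c' b \<noteq> 0} \<subseteq> {b. c b \<noteq> 0} \<union> {b. c' b \<noteq> 0}" by auto
  then have "finite {b. c b + c' b \<noteq> 0}"
    by (rule finite_subset) (use c in \<open>simp add: FB_def\<close>)
  moreover have "supp (c b + c' b) \<subseteq> degrees m" for b
    using c by (intro order_trans[OF keys_add] Un_least) (simp_all add: FB_def)
  ultimately show ?thesis using c by (simp add: FB_def)
qed

lemma rep_add: "c \<in> FB \<Longrightarrow> c' \<in> FB \<Longrightarrow> rep (\<lambda>b. c b + c' b) = rep c \<oplus>\<^bsub>M\<^esub> rep c'"
proof -
  assume c: "c \<in> FB" and c': "c' \<in> FB"
  let ?S = "{b. c b \<noteq> 0} \<union> {b. c' b \<noteq> 0}"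
  have S: "finite ?S" "?S \<subseteq> B" using c c' FB_D by auto
  have "rep (\<lambda>b. c b + c' b) = (\<Oplus>\<^bsub>M\<^esub>b\<in>?S. (c b + c' b) \<odot>\<^bsub>M\<^esub> b)"
    by (rule rep_superset[OF FB_add[OF c c'] S]) auto
  also have "\<dots> = (\<Oplus>\<^bsub>M\<^esub>b\<in>?S. c b \<odot>\<^bsub>M\<^esub> b \<oplus>\<^bsub>M\<^esub> c' b \<odot>\<^bsub>M\<^esub> b)"
  proof (rule finsum_cong')
    show "(\<lambda>b. c b \<odot>\<^bsub>M\<^esub> b \<oplus>\<^bsub>M\<^esub> c' b \<odot>\<^bsub>M\<^esub> b) \<in> ?S \<rightarrow> carrier M"
      using term_carrier[OF c] term_carrier[OF c'] S by blast
    show "(c b + c' b) \<odot>\<^bsub>M\<^esub> b = c b \<odot>\<^bsub>M\<^esub> b \<oplus>\<^bsub>M\<^esub> c' b \<odot>\<^bsub>M\<^esub> b" if "b \<in> ?S" for b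
      using smult_l_distr[OF FB_D(1)[OF c] FB_D(1)[OF c'] B_carrier, of b b b] S that by auto
  qed simp
  also have "\<dots> = (\<Oplus>\<^bsub>M\<^esub>b\<in>?S. c b \<odot>\<^bsub>M\<^esub> b) \<oplus>\<^bsub>M\<^esub> (\<Oplus>\<^bsub>M\<^esub>b\<in>?S. c' b \<odot>\<^bsub>M\<^esub> b)"
    using term_carrier[OF c] term_carrier[OF c'] S by (intro finsum_addf) blast+
  also have "\<dots> = rep c \<oplus>\<^bsub>M\<^esub> rep c'"
    using rep_superset[OF c S] rep_superset[OF c' S] by simp
  finally show ?thesis .
qed

lemma FB_mult: "r \<in> carrier (mpoly_ring m) \<Longrightarrow> c \<in> FB \<Longrightarrow> (\<lambda>b. r * c b) \<in> FB"
proof -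
  assume r: "r \<in> carrier (mpoly_ring m)" and c: "c \<in> FB"
  have "finite {b. r * c b \<noteq> 0}"
    by (rule finite_subset[OF _ FB_D(3)[OF c]]) auto
  then show ?thesis using r c mult_degrees[of r m] by (simp add: FB_def)
qed

lemma rep_mult: "r \<in> carrier (mpoly_ring m) \<Longrightarrow> c \<in> FB \<Longrightarrow> rep (\<lambda>b. r * c b) = r \<odot>\<^bsub>M\<^esub> rep c"
proof -
  assume r: "r \<in> carrier (mpoly_ring m)" and c: "c \<in> FB"
  let ?S = "{b. c b \<noteq> 0}"
  have S: "finite ?S" "?S \<subseteq> B" using c FB_D by auto
  have "rep (\<lambda>b. r * c b) = (\<Oplus>\<^bsub>M\<^esub>b\<in>?S. (r * c b) \<odot>\<^bsub>M\<^esub> b)"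
    by (rule rep_superset[OF FB_mult[OF r c] S]) auto
  also have "\<dots> = (\<Oplus>\<^bsub>M\<^esub>b\<in>?S. r \<odot>\<^bsub>M\<^esub> (c b \<odot>\<^bsub>M\<^esub> b))"
  proof (rule finsum_cong')
    show "(\<lambda>b. r \<odot>\<^bsub>M\<^esub> (c b \<odot>\<^bsub>M\<^esub> b)) \<in> ?S \<rightarrow> carrier M"
      using term_carrier[OF c] S r by blast
    show "(r * c b) \<odot>\<^bsub>M\<^esub> b = r \<odot>\<^bsub>M\<^esub> (c b \<odot>\<^bsub>M\<^esub> b)" if "b \<in> ?S" for b
      using smult_assoc1[OF r FB_D(1)[OF c] B_carrier, of b b] S that by auto
  qed simp
  also have "\<dots> = r \<odot>\<^bsub>M\<^esub> (\<Oplus>\<^bsub>M\<^esub>b\<in>?S. c b \<odot>\<^bsub>M\<^esub> b)"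
    using term_carrier[OF c] S by (intro finsum_smult_ldistr[OF _ r, symmetric]) blast+
  finally show ?thesis by (simp add: rep_def)
qed

lemma rep_bij: "x \<in> carrier M \<Longrightarrow> \<exists>!c. c \<in> FB \<and> x = rep c"
  using coords unfolding rep_def FB_free_module .

lemma rep_inj: "c \<in> FB \<Longrightarrow> c' \<in> FB \<Longrightarrow> rep c = rep c' \<Longrightarrow> c = c'"
  using rep_bij[OF rep_closed, of c] by blast

lemma rep_surj: "x \<in> carrier M \<Longrightarrow> \<exists>c\<in>FB. rep c = x"
  using rep_bij[of x] by blast

lemma FB_single: "r \<in> carrier (mpoly_ring m) \<Longrightarrow> b \<in> B \<Longrightarrow> (\<lambda>b'. if b' = b then r else 0) \<in> FB"
proof -
  assume "r \<in> carrier (mpoly_ring m)" "b \<in> B"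
  moreover have "finite {b'. (if b' = b then r else 0) \<noteq> 0}" by (rule finite_subset[of _ "{b}"]) auto
  ultimately show ?thesis by (simp add: FB_def)
qed

lemma rep_single:
  assumes "r \<in> carrier (mpoly_ring m)" "b \<in> B"
  shows "rep (\<lambda>b'. if b' = b then r else 0) = r \<odot>\<^bsub>M\<^esub> b"
proof -
  have "rep (\<lambda>b'. if b' = b then r else 0) = (\<Oplus>\<^bsub>M\<^esub>b'\<in>{b}. (if b' = b then r else 0) \<odot>\<^bsub>M\<^esub> b')"
    by (rule rep_superset[OF FB_single[OF assms]]) (use assms(2) in \<open>simp_all split: if_splits\<close>)
  also have "\<dots> = r \<odot>\<^bsub>M\<^esub> b"
    using smult_closed[OF assms(1) B_carrier[OF assms(2)]] by (simp add: finsum_insert)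
  finally show ?thesis .
qed

lemma FB_zero: "(\<lambda>_. 0) \<in> FB"
  by (simp add: FB_def)

lemma rep_zero: "rep (\<lambda>_. 0) = \<zero>\<^bsub>M\<^esub>"
  by (simp add: rep_def)

lemma FB_sum: "finite I \<Longrightarrow> (\<And>i. i \<in> I \<Longrightarrow> c i \<in> FB) \<Longrightarrow> (\<lambda>b. \<Sum>i\<in>I. c i b) \<in> FB"
proof (induction I rule: finite_induct)
  case (insert i I)
  then show ?case using FB_add[of "c i" "\<lambda>b. \<Sum>i\<in>I. c i b"] by simp
qed (simp add: FB_zero)

lemma rep_sum:
  "finite I \<Longrightarrow> (\<And>i. i \<in> I \<Longrightarrow> c i \<in> FB) \<Longrightarrow> rep (\<lambda>b. \<Sum>i\<in>I. c i b) = (\<Oplus>\<^bsub>M\<^esub>i\<in>I. rep (c i))"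
proof (induction I rule: finite_induct)
  case (insert i I)
  have "(\<lambda>i. rep (c i)) \<in> I \<rightarrow> carrier M" "rep (c i) \<in> carrier M" using insert rep_closed by auto
  then show ?case using insert rep_add[of "c i" "\<lambda>b. \<Sum>i\<in>I. c i b"] FB_sum[of I c] by simp
qed (simp add: rep_zero)

text \<open>Basis elements are known to be homogeneous but carry no designated degree, so one is
  selected.\<close>

definition bdeg :: "'a \<Rightarrow> expo"
  where "bdeg b = (SOME a. a \<in> degrees m \<and> b \<in> homog M a)"

lemma bdeg: assumes "b \<in> B" shows "bdeg b \<in> degrees m" "b \<in> homog M (bdeg b)"
proof -
  have "\<exists>a. a \<in> degrees m \<and> b \<in> homog M a" using B_homog assms by blast
  from someI_ex[OF this] show "bdeg b \<in> degrees m" "b \<in> homog M (bdeg b)" by (auto simp: bdeg_def)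
qed

lemma homog_rep:
  assumes c: "c \<in> FB" and a: "a \<in> degrees m"
    and e: "\<And>b e. b \<in> B \<Longrightarrow> e \<in> supp (c b) \<Longrightarrow> e + bdeg b = a"
  shows "rep c \<in> homog M a"
  unfolding rep_def
proof (rule homog_finsum[OF a FB_D(3)[OF c]])
  fix b assume "b \<in> {b. c b \<noteq> 0}"
  then have b: "b \<in> B" "c b \<noteq> 0" using FB_D(2)[OF c] by auto
  then obtain f where f: "f \<in> supp (c b)" by (metis keys_eq_empty equals0I)
  have fa: "f + bdeg b = a" using e b f by blast
  have "c b = term_poly f (coef (c b) f)"
  proof (rule poly_mapping_eqI)
    fix g
    have "g \<in> supp (c b) \<longleftrightarrow> g = f" using e[OF b(1)] fa f by (metis add_right_cancel)
    then show "coef (c b) g = coef (term_poly f (coef (c b) f)) g"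
      by (auto simp: coef_term_poly in_keys_iff)
  qed
  moreover have "f \<in> degrees m" using FB_D(1)[OF c, of b] f by auto
  ultimately show "c b \<odot>\<^bsub>M\<^esub> b \<in> homog M a"
    using homog_term[OF _ bdeg[OF b(1)], of f "coef (c b) f"] fa by simp
qed

text \<open>Splitting \<open>c\<close> by total degree decomposes \<open>rep c\<close> into
  homogeneous elements. By uniqueness of this decomposition the part of degree \<open>a\<close>
  represents all of \<open>rep c\<close>, and by uniqueness of coordinates it equals
  \<open>c\<close>.\<close>

lemma rep_homog:
  assumes c: "c \<in> FB" and a: "a \<in> degrees m" and x: "rep c \<in> homog M a"
    and b: "b \<in> B" "e \<in> supp (c b)"
  shows "e + bdeg b = a"
proof -
  define part where "part e b = restr {f. f + bdeg b = e} (c b)" for e b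
  define E where "E = insert a (\<Union>b\<in>{b. c b \<noteq> 0}. (\<lambda>f. f + bdeg b) ` supp (c b))"
  have "f + bdeg b \<in> degrees m" if "c b \<noteq> 0" "f \<in> supp (c b)" for b f
    using FB_D(1)[OF c, of b] that(2) bdeg(1)[OF FB_D(2)[OF c that(1)]] by (auto simp: degrees_add)
  then have E: "finite E" "a \<in> E" "E \<subseteq> degrees m"
    using FB_D(3)[OF c] a by (auto simp: E_def)
  have part_FB: "part e \<in> FB" for e
  proof -
    have "finite {b. part e b \<noteq> 0}"
      by (rule finite_subset[OF _ FB_D(3)[OF c]]) (auto simp: part_def poly_mapping_eq_iff fun_eq_iff)
    moreover have "supp (part e b) \<subseteq> degrees m" for b
      using FB_D(1)[OF c, of b] by (auto simp: part_def in_keys_iff subset_iff split: if_splits)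
    moreover have "part e b = 0" if "b \<notin> B" for b
      using that c by (auto simp: part_def FB_def intro!: poly_mapping_eqI)
    ultimately show ?thesis by (simp add: FB_def)
  qed
  have part_homog: "rep (part e) \<in> homog M e" if "e \<in> E" for e
    using that E(3) by (intro homog_rep part_FB) (auto simp: part_def in_keys_iff split: if_splits)
  have "c = (\<lambda>b. \<Sum>e\<in>E. part e b)"
  proof (intro ext poly_mapping_eqI)
    fix b f
    have "(\<Sum>e\<in>E. coef (part e b) f) = (\<Sum>e\<in>E. if e = f + bdeg b then coef (c b) f else 0)"
      by (rule sum.cong) (auto simp: part_def)
    also have "\<dots> = coef (c b) f"
    proof (cases "coef (c b) f = 0")
      case False
      then have "c b \<noteq> 0" by auto
      with False have "f + bdeg b \<in> E" unfolding E_def by (auto simp: in_keys_iff)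
      then show ?thesis using E(1) by simp
    next
      case True
      then show ?thesis by (simp only: True if_cancel sum.neutral_const)
    qed
    finally show "coef (c b) f = coef (\<Sum>e\<in>E. part e b) f" by (simp add: lookup_sum)
  qed
  then have "rep c = (\<Oplus>\<^bsub>M\<^esub>e\<in>E. rep (part e))" using rep_sum[OF E(1) part_FB] by simp
  moreover have "rep c = finsum M (\<lambda>e. if e = a then rep c else \<zero>\<^bsub>M\<^esub>) E"
    using finsum_delta[OF E(1,2) rep_closed[OF c]] by simp
  ultimately have "rep (part a) = (if a = a then rep c else \<zero>\<^bsub>M\<^esub>)"
    using part_homog x homog_closed(2) E
    by (intro decomposition_unique[OF E(1,3), where u = "\<lambda>e. rep (part e)" and v = "\<lambda>e. if e = a then rep c else \<zero>\<^bsub>M\<^esub>"]) auto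
  then have "part a = c" using rep_inj[OF part_FB c] by simp
  then have "coef (part a b) e = coef (c b) e" by simp
  with b(2) show ?thesis by (auto simp: part_def in_keys_iff split: if_splits)
qed

definition sB :: "'a set"
  where "sB = {b \<in> B. \<exists>\<tau>\<subseteq>{1..m}. bdeg b = squarefree_expo \<tau>}"

definition sdeg :: "'a \<Rightarrow> nat set"
  where "sdeg b = supp (bdeg b)"

lemma sdeg: "b \<in> sB \<Longrightarrow> sdeg b \<subseteq> {1..m}" "b \<in> sB \<Longrightarrow> bdeg b = squarefree_expo (sdeg b)"
proof -
  assume "b \<in> sB"
  then obtain \<tau> where t: "\<tau> \<subseteq> {1..m}" "bdeg b = squarefree_expo \<tau>" by (auto simp: sB_def)
  have "finite \<tau>" using t(1) by (rule finite_subset) simp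
  then show "sdeg b \<subseteq> {1..m}" "bdeg b = squarefree_expo (sdeg b)" using t by (simp_all add: sdeg_def keys_sqf)
qed

text \<open>The basis elements are tagged by \<open>n\<close> as those of the \<open>n\<close>-th module of a resolution.\<close>

definition tagged :: "nat \<Rightarrow> nat set \<Rightarrow> (nat \<times> 'a) set"
  where "tagged n \<sigma> = {(n, b) | b. b \<in> sB \<and> sdeg b \<subseteq> \<sigma>}"

definition lcoords :: "nat \<Rightarrow> nat set \<Rightarrow> (nat \<times> 'a \<Rightarrow>\<^sub>0 'k) \<Rightarrow> 'a \<Rightarrow> 'k mpoly"
  where "lcoords n \<sigma> x b = term_poly (squarefree_expo (\<sigma> - sdeg b)) (coef x (n, b))"

text \<open>Homogenization, the inverse of setting the variables to 1: each scalar is completed to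
  the monomial that raises the degree of its basis element to \<sigma>. This identifies the chains
  of degree inside \<sigma> with the component of degree
  \<open>squarefree_expo \<sigma>\<close>.\<close>

definition lift :: "nat \<Rightarrow> nat set \<Rightarrow> (nat \<times> 'a \<Rightarrow>\<^sub>0 'k) \<Rightarrow> 'a"
  where "lift n \<sigma> x = rep (lcoords n \<sigma> x)"

lemma tagged_coef: "x \<in> chains (tagged n \<sigma>) \<Longrightarrow> coef x (n, b) \<noteq> 0 \<Longrightarrow> b \<in> sB \<and> sdeg b \<subseteq> \<sigma>"
  using coef_mem_chains[of x "tagged n \<sigma>" "(n, b)"] by (auto simp: tagged_def)

lemma lcoords_zero_iff: "lcoords n \<sigma> x b = 0 \<longleftrightarrow> coef x (n, b) = 0"
proof
  assume "lcoords n \<sigma> x b = 0"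
  then have "coef (lcoords n \<sigma> x b) (squarefree_expo (\<sigma> - sdeg b)) = 0" by simp
  then show "coef x (n, b) = 0" by (simp add: lcoords_def coef_term_poly)
qed (simp add: lcoords_def)

lemma lcoords_FB:
  assumes s: "\<sigma> \<subseteq> {1..m}" and x: "x \<in> chains (tagged n \<sigma>)"
  shows "lcoords n \<sigma> x \<in> FB"
proof -
  have "{b. lcoords n \<sigma> x b \<noteq> 0} \<subseteq> snd ` supp x"
    by (auto simp: lcoords_zero_iff in_keys_iff image_iff intro!: bexI[of _ "(n, _)"])
  then have "finite {b. lcoords n \<sigma> x b \<noteq> 0}" by (rule finite_subset) simp
  moreover have "supp (lcoords n \<sigma> x b) \<subseteq> degrees m" for b
    using sqf_degrees[of "\<sigma> - sdeg b" m] s keys_term_poly[of "squarefree_expo (\<sigma> - sdeg b)" "coef x (n, b)"]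
    by (auto simp: lcoords_def)
  moreover have "lcoords n \<sigma> x b = 0" if "b \<notin> B" for b
    using tagged_coef[OF x, of b] that by (auto simp: lcoords_zero_iff sB_def)
  ultimately show ?thesis by (simp add: FB_def)
qed

lemma lift_homog:
  assumes s: "\<sigma> \<subseteq> {1..m}" and x: "x \<in> chains (tagged n \<sigma>)"
  shows "lift n \<sigma> x \<in> homog M (squarefree_expo \<sigma>)"
  unfolding lift_def
proof (rule homog_rep[OF lcoords_FB[OF s x] sqf_degrees[OF s]])
  fix b e assume b: "b \<in> B" "e \<in> supp (lcoords n \<sigma> x b)"
  then have e: "e = squarefree_expo (\<sigma> - sdeg b)" and "coef x (n, b) \<noteq> 0"
    using lcoords_zero_iff[of n \<sigma> x b] by (auto simp: lcoords_def term_poly_def split: if_splits)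
  then have "b \<in> sB" "sdeg b \<subseteq> \<sigma>" using tagged_coef[OF x] by auto
  then show "e + bdeg b = squarefree_expo \<sigma>"
    using sqf_add[of \<sigma> "sdeg b"] finite_subset[OF s] e sdeg(2) by simp
qed

lemma lift_closed: "\<sigma> \<subseteq> {1..m} \<Longrightarrow> x \<in> chains (tagged n \<sigma>) \<Longrightarrow> lift n \<sigma> x \<in> carrier M"
  unfolding lift_def by (intro rep_closed lcoords_FB)

lemma lift_add:
  assumes "\<sigma> \<subseteq> {1..m}" "x \<in> chains (tagged n \<sigma>)" "y \<in> chains (tagged n \<sigma>)"
  shows "lift n \<sigma> (x + y) = lift n \<sigma> x \<oplus>\<^bsub>M\<^esub> lift n \<sigma> y"
proof -
  have "lcoords n \<sigma> (x + y) = (\<lambda>b. lcoords n \<sigma> x b + lcoords n \<sigma> y b)"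
    by (simp add: lcoords_def lookup_add term_poly_add fun_eq_iff)
  then show ?thesis using assms by (simp add: lift_def rep_add lcoords_FB)
qed

lemma lift_zero: "lift n \<sigma> 0 = \<zero>\<^bsub>M\<^esub>"
  by (simp add: lift_def lcoords_def[abs_def] rep_zero)

lemma lift_sum:
  assumes "\<sigma> \<subseteq> {1..m}" "finite I" "\<And>i. i \<in> I \<Longrightarrow> f i \<in> chains (tagged n \<sigma>)"
  shows "lift n \<sigma> (\<Sum>i\<in>I. f i) = (\<Oplus>\<^bsub>M\<^esub>i\<in>I. lift n \<sigma> (f i))"
  using assms(2,3)
proof (induction I rule: finite_induct)
  case (insert i I)
  have "(\<lambda>i. lift n \<sigma> (f i)) \<in> I \<rightarrow> carrier M" "lift n \<sigma> (f i) \<in> carrier M"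
    using insert lift_closed[OF assms(1)] by auto
  then show ?case using insert lift_add[OF assms(1), of "f i" n "\<Sum>i\<in>I. f i"] by (simp add: chains_closed(6))
qed (simp add: lift_zero)

lemma lift_inj:
  assumes "\<sigma> \<subseteq> {1..m}" "x \<in> chains (tagged n \<sigma>)" "y \<in> chains (tagged n \<sigma>)" "lift n \<sigma> x = lift n \<sigma> y"
  shows "x = y"
proof (rule poly_mapping_eqI)
  have eq: "lcoords n \<sigma> x = lcoords n \<sigma> y"
    using assms by (intro rep_inj lcoords_FB) (simp_all add: lift_def)
  fix b' :: "nat \<times> 'a"
  show "coef x b' = coef y b'"
  proof (cases "fst b' = n")
    case True
    then obtain b where b: "b' = (n, b)" by (cases b') simp
    have "coef (lcoords n \<sigma> x b) (squarefree_expo (\<sigma> - sdeg b)) = coef (lcoords n \<sigma> y b) (squarefree_expo (\<sigma> - sdeg b))"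
      by (simp add: eq)
    then show ?thesis by (simp add: b lcoords_def coef_term_poly)
  next
    case False
    then have "b' \<notin> tagged n \<sigma>" by (auto simp: tagged_def)
    then show ?thesis using coef_mem_chains assms(2,3) by metis
  qed
qed

text \<open>In degree \<sigma> each coordinate of a homogeneous element is a scalar times one
  monomial, whose exponent is \<sigma> minus the degree of the basis element; the scalars form the
  chain. A basis element that occurs has squarefree degree by \<open>sqf_summand\<close>.\<close>

lemma lift_surj:
  assumes s: "\<sigma> \<subseteq> {1..m}" and y: "y \<in> homog M (squarefree_expo \<sigma>)"
  shows "\<exists>x\<in>chains (tagged n \<sigma>). lift n \<sigma> x = y"
proof -
  have fin: "finite \<sigma>" using s finite_subset by blast
  obtain c where c: "c \<in> FB" "rep c = y" using rep_surj homog_closed(1)[OF sqf_degrees[OF s] y] by blast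
  have deg: "e + bdeg b = squarefree_expo \<sigma>" if "e \<in> supp (c b)" for b e
  proof -
    have "c b \<noteq> 0" using that by auto
    then have "b \<in> B" by (rule FB_D(2)[OF c(1)])
    then show ?thesis using rep_homog[OF c(1) sqf_degrees[OF s]] that y c(2) by blast
  qed
  define x where "x = (\<Sum>b\<in>{b. c b \<noteq> 0}. Poly_Mapping.single (n, b) (coef (c b) (squarefree_expo (\<sigma> - sdeg b))))"
  have coef_x: "coef x (n, b) = coef (c b) (squarefree_expo (\<sigma> - sdeg b))" for b
  proof -
    have "coef x (n, b) = (\<Sum>b'\<in>{b. c b \<noteq> 0}. if b' = b then coef (c b) (squarefree_expo (\<sigma> - sdeg b)) else 0)"
      unfolding x_def lookup_sum by (rule sum.cong) (auto simp: lookup_single when_def)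
    then show ?thesis using FB_D(3)[OF c(1)] by auto
  qed
  have b_sB: "b \<in> sB \<and> sdeg b \<subseteq> \<sigma>" if "c b \<noteq> 0" for b
  proof -
    obtain e where "e \<in> supp (c b)" using \<open>c b \<noteq> 0\<close> by (metis keys_eq_empty equals0I)
    from sqf_summand(1,2)[OF fin deg[OF this]] show ?thesis
      using FB_D(2)[OF c(1) that] s unfolding sB_def sdeg_def by blast
  qed
  have "x \<in> chains (tagged n \<sigma>)"
    unfolding x_def by (intro chains_closed) (use b_sB in \<open>auto simp: tagged_def\<close>)
  moreover have "lcoords n \<sigma> x = c"
  proof (intro ext poly_mapping_eqI)
    fix b e
    show "coef (lcoords n \<sigma> x b) e = coef (c b) e"
    proof (cases "e \<in> supp (c b)")
      case True
      then have "e = squarefree_expo (\<sigma> - sdeg b)"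
        using sqf_summand(3)[OF fin deg] by (simp add: sdeg_def)
      then show ?thesis by (simp add: lcoords_def coef_term_poly coef_x)
    next
      case False
      then show ?thesis by (auto simp: lcoords_def coef_term_poly coef_x in_keys_iff)
    qed
  qed
  ultimately show ?thesis using c(2) by (auto simp: lift_def)
qed

text \<open>The complementary exponents add up, so that multiplication by a monomial becomes the
  inclusion of chains.\<close>

lemma lift_mult:
  assumes s: "\<sigma> \<subseteq> {1..m}" "\<tau> \<subseteq> \<sigma>" and x: "x \<in> chains (tagged n \<tau>)"
  shows "term_poly (squarefree_expo (\<sigma> - \<tau>)) c \<odot>\<^bsub>M\<^esub> lift n \<tau> x = lift n \<sigma> (scale c x)"
proof -
  have t: "\<tau> \<subseteq> {1..m}" using s by blast
  have fin: "finite \<sigma>" using s finite_subset by blast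
  have "lcoords n \<sigma> (scale c x) = (\<lambda>b. term_poly (squarefree_expo (\<sigma> - \<tau>)) c * lcoords n \<tau> x b)"
  proof
    fix b
    show "lcoords n \<sigma> (scale c x) b = term_poly (squarefree_expo (\<sigma> - \<tau>)) c * lcoords n \<tau> x b"
    proof (cases "coef x (n, b) = 0")
      case False
      then have b: "sdeg b \<subseteq> \<tau>" using tagged_coef[OF x] by blast
      have "squarefree_expo ((\<sigma> - sdeg b) - (\<tau> - sdeg b)) + squarefree_expo (\<tau> - sdeg b) = squarefree_expo (\<sigma> - sdeg b)"
        using fin s by (intro sqf_add) auto
      moreover have "(\<sigma> - sdeg b) - (\<tau> - sdeg b) = \<sigma> - \<tau>" using b by blast
      ultimately show ?thesis by (simp add: lcoords_def term_poly_mult)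
    qed (simp add: lcoords_def)
  qed
  moreover have "term_poly (squarefree_expo (\<sigma> - \<tau>)) c \<in> carrier (mpoly_ring m)"
    using s by (intro term_poly_carrier sqf_degrees) blast
  ultimately show ?thesis
    using rep_mult[OF _ lcoords_FB[OF t x]] by (simp add: lift_def)
qed

lemma lift_expand:
  assumes s: "\<sigma> \<subseteq> {1..m}" and x: "x \<in> chains (tagged n \<sigma>)"
  shows "lift n \<sigma> x = (\<Oplus>\<^bsub>M\<^esub>b\<in>{b. coef x (n, b) \<noteq> 0}. term_poly (squarefree_expo (\<sigma> - sdeg b)) (coef x (n, b)) \<odot>\<^bsub>M\<^esub> b)"
  unfolding lift_def rep_def lcoords_zero_iff by (simp add: lcoords_def)

end

section \<open>The face ring\<close>

text \<open>The parameter \<open>coeffs\<close> only serves to fix the type of the coefficients.\<close>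

locale face_ring_of =
  fixes m :: nat and K :: "nat set set" and coeffs :: "'k::comm_ring_1 itself"
  assumes K_subset: "\<sigma> \<in> K \<Longrightarrow> \<tau> \<subseteq> \<sigma> \<Longrightarrow> \<tau> \<in> K" and K_U: "\<sigma> \<in> K \<Longrightarrow> \<sigma> \<subseteq> {1..m}"
begin

abbreviation "I \<equiv> Stanley_Reisner_ideal m K :: 'k mpoly set"
abbreviation "R \<equiv> mpoly_ring m :: 'k mpoly ring"
abbreviation "M \<equiv> face_ring m K :: ('k mpoly, 'k mpoly set) graded_module"

sublocale cring R
  by (rule mpoly_cring)

lemma sqf_monomial_carrier: "\<sigma> \<subseteq> {1..m} \<Longrightarrow> squarefree_monomial \<sigma> \<in> carrier R"
  unfolding squarefree_monomial_def by (intro term_poly_carrier sqf_degrees)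

lemma gens_carrier: "{squarefree_monomial \<sigma> | \<sigma>. \<sigma> \<subseteq> {1..m} \<and> \<sigma> \<notin> K} \<subseteq> carrier R"
  using sqf_monomial_carrier by blast

lemma I_ideal: "ideal I R"
  unfolding Stanley_Reisner_ideal_def by (rule genideal_ideal[OF gens_carrier])

sublocale I: ideal I R
  by (rule I_ideal)

text \<open>The polynomials all of whose monomials have non-face support form an ideal, since
  multiplication enlarges supports and \<open>K\<close> is closed under subsets. It contains the
  generators, hence all of \<open>I\<close>.\<close>

lemma I_coef: "p \<in> I \<Longrightarrow> supp e \<in> K \<Longrightarrow> coef p e = 0"
proof -
  let ?J = "{p \<in> carrier R. \<forall>e\<in>supp p. supp e \<notin> K}"
  have "ideal ?J R"
  proof (rule idealI)
    show "ring R" by (rule ring_axioms)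
    show "subgroup ?J (add_monoid R)"
    proof (rule add.subgroupI)
      show "?J \<subseteq> carrier R" by blast
      have "0 \<in> ?J" by simp
      then show "?J \<noteq> {}" by blast
      fix p assume p: "p \<in> ?J"
      have "p \<oplus>\<^bsub>R\<^esub> - p = \<zero>\<^bsub>R\<^esub>" "- p \<in> carrier R" "p \<in> carrier R" using p by (auto simp: in_keys_iff subset_iff)
      then have "\<ominus>\<^bsub>R\<^esub> p = - p" by (metis minus_equality add.m_comm)
      then show "\<ominus>\<^bsub>R\<^esub> p \<in> ?J" using p by (auto simp: in_keys_iff subset_iff)
      fix q assume q: "q \<in> ?J"
      show "p \<oplus>\<^bsub>R\<^esub> q \<in> ?J" using p q keys_add[of p q] by auto
    qed
    fix p r assume p: "p \<in> ?J" and r: "r \<in> carrier R"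
    have "r * p \<in> ?J"
    proof -
      have "supp e \<notin> K" if "e \<in> supp (r * p)" for e
      proof
        assume "supp e \<in> K"
        obtain a b where ab: "e = a + b" "b \<in> supp p" using keys_mult[of r p] \<open>e \<in> supp (r * p)\<close> by auto
        then have "supp b \<in> K" using K_subset[OF \<open>supp e \<in> K\<close>] by (simp add: keys_add_nat)
        then show False using p ab(2) by blast
      qed
      then show ?thesis using m_closed[OF r, of p] p by simp
    qed
    then show "r \<otimes>\<^bsub>R\<^esub> p \<in> ?J" "p \<otimes>\<^bsub>R\<^esub> r \<in> ?J" by (simp_all add: mult.commute)
  qed
  moreover have "{squarefree_monomial \<sigma> | \<sigma>. \<sigma> \<subseteq> {1..m} \<and> \<sigma> \<notin> K} \<subseteq> ?J"
  proof
    fix p :: "'k mpoly" assume "p \<in> {squarefree_monomial \<sigma> | \<sigma>. \<sigma> \<subseteq> {1..m} \<and> \<sigma> \<notin> K}"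
    then obtain \<sigma> where s: "p = squarefree_monomial \<sigma>" "\<sigma> \<subseteq> {1..m}" "\<sigma> \<notin> K" by blast
    then have "finite \<sigma>" using finite_subset by blast
    then show "p \<in> ?J"
      using s sqf_monomial_carrier[OF s(2)] by (auto simp: squarefree_monomial_def term_poly_def keys_sqf)
  qed
  ultimately have "I \<subseteq> ?J"
    unfolding Stanley_Reisner_ideal_def by (rule genideal_minimal)
  then show "p \<in> I \<Longrightarrow> supp e \<in> K \<Longrightarrow> coef p e = 0"
    using in_keys_iff[of e p] by blast
qed

lemma nonface_I:
  assumes "\<sigma> \<subseteq> {1..m}" "\<sigma> \<notin> K"
  shows "term_poly (squarefree_expo \<sigma>) c \<in> I"
proof -
  have "squarefree_monomial \<sigma> \<in> I"
    unfolding Stanley_Reisner_ideal_def using genideal_self[OF gens_carrier] assms by blast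
  then have "term_poly 0 c \<otimes>\<^bsub>R\<^esub> squarefree_monomial \<sigma> \<in> I"
    by (rule I.I_l_closed) (rule term_poly_carrier, simp)
  then show ?thesis by (simp add: squarefree_monomial_def term_poly_mult)
qed

lemma M_carrier: "carrier M = {I +>\<^bsub>R\<^esub> p | p. p \<in> carrier R}"
  by (auto simp: face_ring_def Let_def FactRing_def A_RCOSETS_def')

lemma M_zero: "\<zero>\<^bsub>M\<^esub> = I" "I +>\<^bsub>R\<^esub> 0 = I"
  by (simp_all add: face_ring_def Let_def FactRing_def I.a_subset a_coset_add_zero[OF I.a_subset, simplified])

lemma M_add: "p \<in> carrier R \<Longrightarrow> q \<in> carrier R \<Longrightarrow> (I +>\<^bsub>R\<^esub> p) \<oplus>\<^bsub>M\<^esub> (I +>\<^bsub>R\<^esub> q) = I +>\<^bsub>R\<^esub> (p + q)"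
  using I.a_rcos_sum[of p q] by (simp add: face_ring_def Let_def FactRing_def)

lemma M_smult: "p \<in> carrier R \<Longrightarrow> q \<in> carrier R \<Longrightarrow> p \<odot>\<^bsub>M\<^esub> (I +>\<^bsub>R\<^esub> q) = I +>\<^bsub>R\<^esub> (p * q)"
  using I.rcoset_mult_add[of p q] by (simp add: face_ring_def Let_def FactRing_def)

lemma M_homog: "homog M a = range (\<lambda>c. I +>\<^bsub>R\<^esub> term_poly a c)"
  by (simp add: face_ring_def Let_def)

lemma coset_mem_I: "p \<in> I \<Longrightarrow> I +>\<^bsub>R\<^esub> p = I"
  by (rule I.a_rcos_const)

text \<open>A coefficient functional on residue classes. The representative is arbitrary; for
  exponents with face support the value does not depend on it.\<close>

definition face_coef :: "expo \<Rightarrow> 'k mpoly set \<Rightarrow> 'k"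
  where "face_coef e S = coef (SOME p. p \<in> S) e"

lemma face_coef:
  assumes "supp e \<in> K" "p \<in> carrier R"
  shows "face_coef e (I +>\<^bsub>R\<^esub> p) = coef p e"
proof -
  have "p \<in> I +>\<^bsub>R\<^esub> p" by (rule I.a_rcos_self[OF assms(2)])
  then have "(SOME q. q \<in> I +>\<^bsub>R\<^esub> p) \<in> I +>\<^bsub>R\<^esub> p" by (rule someI)
  then obtain i where "i \<in> I" "(SOME q. q \<in> I +>\<^bsub>R\<^esub> p) = i + p" by (auto simp: a_r_coset_def')
  then show ?thesis using I_coef[OF _ assms(1)] by (simp add: face_coef_def lookup_add)
qed

lemma face_coef_add:
  "supp e \<in> K \<Longrightarrow> S \<in> carrier M \<Longrightarrow> T \<in> carrier M \<Longrightarrow> face_coef e (S \<oplus>\<^bsub>M\<^esub> T) = face_coef e S + face_coef e T"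
  using add.m_closed unfolding M_carrier
  by (auto simp del: mpoly_ring_simps(1) simp: M_add face_coef lookup_add)

end

section \<open>From a graded free resolution of the face ring to a filtered resolution\<close>

locale graded_resolution = face_ring_of m K coeffs
  for m :: nat and K :: "nat set set" and coeffs :: "'k::comm_ring_1 itself" +
  fixes F :: "nat \<Rightarrow> ('k mpoly, 'f) graded_module" and d :: "nat \<Rightarrow> 'f \<Rightarrow> 'f" and \<epsilon> :: "'f \<Rightarrow> 'k mpoly set"
    and B :: "nat \<Rightarrow> 'f set"
  assumes res: "graded_free_resolution m (face_ring m K) F d \<epsilon>"
    and B: "graded_free_mod m (F n) (B n)"
begin

sublocale F: graded_free_mod m "F n" "B n" for n
  by (rule B)

lemma d_graded: "graded_map m (F (Suc n)) (F n) (d n)"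
  and \<epsilon>_graded: "graded_map m (F 0) M \<epsilon>"
  and \<epsilon>_onto: "\<epsilon> ` carrier (F 0) = carrier M"
  and exact_0': "d 0 ` carrier (F 1) = {x \<in> carrier (F 0). \<epsilon> x = \<zero>\<^bsub>M\<^esub>}"
  and exact_Suc: "d (Suc n) ` carrier (F (Suc (Suc n))) = {x \<in> carrier (F (Suc n)). d n x = \<zero>\<^bsub>F n\<^esub>}"
  using res by (simp_all add: graded_free_resolution_def)

lemma d_linear: "linear_map R (F (Suc n)) (F n) (d n)"
  and d_homog: "a \<in> degrees m \<Longrightarrow> x \<in> homog (F (Suc n)) a \<Longrightarrow> d n x \<in> homog (F n) a"
  using d_graded[of n] by (auto simp: graded_map_def)

lemma \<epsilon>_linear: "linear_map R (F 0) M \<epsilon>"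
  and \<epsilon>_homog: "a \<in> degrees m \<Longrightarrow> x \<in> homog (F 0) a \<Longrightarrow> \<epsilon> x \<in> homog M a"
  using \<epsilon>_graded by (auto simp: graded_map_def)

lemma d_zero: "d n \<zero>\<^bsub>F (Suc n)\<^esub> = \<zero>\<^bsub>F n\<^esub>"
  by (rule linear_map_zero[OF d_linear F.abelian_group_axioms F.abelian_group_axioms])

definition sbasis :: "(nat \<times> 'f) set"
  where "sbasis = {(n, b). b \<in> F.sB n}"

definition smdeg :: "nat \<times> 'f \<Rightarrow> nat set"
  where "smdeg b = F.sdeg (fst b) (snd b)"

abbreviation "tg n \<sigma> \<equiv> F.tagged n n \<sigma>"

lemma tg_eq: "tg n \<sigma> = {b \<in> sbasis. fst b = n \<and> smdeg b \<subseteq> \<sigma>}"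
  by (auto simp: F.tagged_def sbasis_def smdeg_def)

text \<open>Dehomogenizes \<open>d\<close> on a basis element: the chain whose homogenization, in
  the degree of that basis element, is its image under \<open>d\<close>.\<close>

definition Dgen :: "nat \<times> 'f \<Rightarrow> (nat \<times> 'f \<Rightarrow>\<^sub>0 'k)"
  where "Dgen b = (case fst b of 0 \<Rightarrow> 0
    | Suc n \<Rightarrow> SOME y. y \<in> chains (tg n (smdeg b)) \<and> F.lift n n (smdeg b) y = d n (snd b))"

definition D :: "(nat \<times> 'f \<Rightarrow>\<^sub>0 'k) \<Rightarrow> (nat \<times> 'f \<Rightarrow>\<^sub>0 'k)"
  where "D = extend Dgen"

lemma D_lin: "klinear D"
  by (simp add: D_def klinear_extend)

lemma D_gen: "D (gen b) = Dgen b"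
  by (simp add: D_def)

lemma sB_homog: "b \<in> F.sB n \<Longrightarrow> b \<in> homog (F n) (squarefree_expo (F.sdeg n b))"
  using F.bdeg(2)[of b n] F.sdeg(2)[of b n] by (simp add: F.sB_def)

lemma Dgen:
  assumes b: "b \<in> F.sB (Suc n)"
  shows "Dgen (Suc n, b) \<in> chains (tg n (F.sdeg (Suc n) b))"
    and "F.lift n n (F.sdeg (Suc n) b) (Dgen (Suc n, b)) = d n b"
proof -
  have s: "F.sdeg (Suc n) b \<subseteq> {1..m}" by (rule F.sdeg(1)[OF b])
  have "d n b \<in> homog (F n) (squarefree_expo (F.sdeg (Suc n) b))"
    by (rule d_homog[OF sqf_degrees[OF s] sB_homog[OF b]])
  then have "\<exists>y. y \<in> chains (tg n (smdeg (Suc n, b))) \<and> F.lift n n (smdeg (Suc n, b)) y = d n b"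
    using F.lift_surj[OF s, of _ n n] by (auto simp: smdeg_def)
  from someI_ex[OF this]
  show "Dgen (Suc n, b) \<in> chains (tg n (F.sdeg (Suc n) b))"
    and "F.lift n n (F.sdeg (Suc n) b) (Dgen (Suc n, b)) = d n b"
    by (simp_all add: Dgen_def smdeg_def)
qed

lemma tg_support:
  assumes x: "x \<in> chains (tg n \<sigma>)"
  defines "S \<equiv> {b. coef x (n, b) \<noteq> 0}"
  shows "supp x = Pair n ` S" "finite S" "b \<in> S \<Longrightarrow> b \<in> F.sB n" "b \<in> S \<Longrightarrow> F.sdeg n b \<subseteq> \<sigma>"
    "b \<in> S \<Longrightarrow> b \<in> carrier (F n)"
proof -
  show eq: "supp x = Pair n ` S"
  proof (intro Set.set_eqI iffI)
    fix b assume b: "b \<in> supp x"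
    then have "fst b = n" using x by (auto simp: chains_def F.tagged_def)
    with b show "b \<in> Pair n ` S" by (cases b) (auto simp: S_def in_keys_iff)
  qed (auto simp: S_def in_keys_iff)
  have inj: "inj_on (Pair n) S" by (simp add: inj_on_def)
  show "finite S" using finite_keys[of x] unfolding eq finite_image_iff[OF inj] .
  show "b \<in> F.sB n" "F.sdeg n b \<subseteq> \<sigma>" if "b \<in> S"
    using F.tagged_coef[OF x, of b] that by (auto simp: S_def)
  then show "b \<in> S \<Longrightarrow> b \<in> carrier (F n)"
    using F.B_carrier[of b n] by (simp add: F.sB_def)
qed

lemma D_tg:
  assumes x: "x \<in> chains (tg (Suc n) \<sigma>)"
  shows "D x \<in> chains (tg n \<sigma>)"
proof (rule klinear_chains_subset[OF D_lin x, where T = "\<lambda>b. tg n (smdeg b)"])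
  fix b assume "b \<in> tg (Suc n) \<sigma>"
  then obtain b' where b: "b = (Suc n, b')" "b' \<in> F.sB (Suc n)" "F.sdeg (Suc n) b' \<subseteq> \<sigma>"
    by (auto simp: F.tagged_def)
  show "D (gen b) \<in> chains (tg n (smdeg b))" using Dgen(1)[OF b(2)] by (simp add: D_gen b(1) smdeg_def)
  show "tg n (smdeg b) \<subseteq> tg n \<sigma>" using b(3) by (auto simp: b(1) smdeg_def F.tagged_def)
qed

text \<open>\<open>D\<close> is defined on each basis element in its own degree. Multiplication by
  the complementary monomial, an inclusion on the side of chains, brings all these equations to the
  common degree \<sigma>.\<close>

lemma lift_D:
  assumes s: "\<sigma> \<subseteq> {1..m}" and x: "x \<in> chains (tg (Suc n) \<sigma>)"
  shows "F.lift n n \<sigma> (D x) = d n (F.lift (Suc n) (Suc n) \<sigma> x)"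
proof -
  define S where "S = {b. coef x (Suc n, b) \<noteq> 0}"
  note supp_x = tg_support(1)[OF x, folded S_def] and fin = tg_support(2)[OF x, folded S_def]
    and bS = tg_support(3,4)[OF x, folded S_def] and b_carr = tg_support(5)[OF x, folded S_def]
  have inj: "inj_on (Pair (Suc n)) S" by (simp add: inj_on_def)
  let ?t = "\<lambda>b. term_poly (squarefree_expo (\<sigma> - F.sdeg (Suc n) b)) (coef x (Suc n, b))"
  have t_carr: "?t b \<in> carrier R" for b
    using s by (intro term_poly_carrier sqf_degrees) blast
  have chain: "scale (coef x (Suc n, b)) (Dgen (Suc n, b)) \<in> chains (tg n \<sigma>)" if "b \<in> S" for b
    by (intro chains_closed(5) chains_mono[OF _ Dgen(1)[OF bS(1)[OF that]]])
      (use bS[OF that] in \<open>auto simp: F.tagged_def\<close>)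
  have "d n (F.lift (Suc n) (Suc n) \<sigma> x) = d n (\<Oplus>\<^bsub>F (Suc n)\<^esub>b\<in>S. ?t b \<odot>\<^bsub>F (Suc n)\<^esub> b)"
    by (simp add: F.lift_expand[OF s x] S_def)
  also have "\<dots> = (\<Oplus>\<^bsub>F n\<^esub>b\<in>S. d n (?t b \<odot>\<^bsub>F (Suc n)\<^esub> b))"
    using linear_mapD[OF d_linear] F.smult_closed[OF t_carr b_carr]
    by (intro additive_finsum[where f = "d n" and M = "F (Suc n)" and N = "F n",
          OF F.abelian_monoid_axioms F.abelian_monoid_axioms _ d_zero _ fin]) auto
  also have "\<dots> = (\<Oplus>\<^bsub>F n\<^esub>b\<in>S. F.lift n n \<sigma> (scale (coef x (Suc n, b)) (Dgen (Suc n, b))))"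
  proof (rule F.finsum_cong')
    show "(\<lambda>b. F.lift n n \<sigma> (scale (coef x (Suc n, b)) (Dgen (Suc n, b)))) \<in> S \<rightarrow> carrier (F n)"
      by (rule funcsetI) (rule F.lift_closed[OF s chain])
    fix b assume b: "b \<in> S"
    have "d n (?t b \<odot>\<^bsub>F (Suc n)\<^esub> b) = ?t b \<odot>\<^bsub>F n\<^esub> d n b"
      by (rule linear_mapD(3)[OF d_linear t_carr b_carr[OF b]])
    also have "\<dots> = F.lift n n \<sigma> (scale (coef x (Suc n, b)) (Dgen (Suc n, b)))"
      unfolding Dgen(2)[OF bS(1)[OF b], symmetric]
      by (rule F.lift_mult[OF s bS(2)[OF b] Dgen(1)[OF bS(1)[OF b]]])
    finally show "d n (?t b \<odot>\<^bsub>F (Suc n)\<^esub> b) = F.lift n n \<sigma> (scale (coef x (Suc n, b)) (Dgen (Suc n, b)))" .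
  qed simp
  also have "\<dots> = F.lift n n \<sigma> (\<Sum>b\<in>S. scale (coef x (Suc n, b)) (Dgen (Suc n, b)))"
    by (rule F.lift_sum[OF s fin chain, symmetric])
  also have "(\<Sum>b\<in>S. scale (coef x (Suc n, b)) (Dgen (Suc n, b))) = D x"
    unfolding D_def extend_def supp_x by (simp add: sum.reindex[OF inj])
  finally show ?thesis ..
qed

text \<open>A basis element of face degree is sent by \<epsilon> to a multiple of the monomial of
  that degree; this is the multiple.\<close>

definition aug_gen :: "'f \<Rightarrow> 'k"
  where "aug_gen b = (if F.sdeg 0 b \<in> K then face_coef (squarefree_expo (F.sdeg 0 b)) (\<epsilon> b) else 0)"

text \<open>Routing the functional through chains on a one-point type lets \<open>extend\<close>
  supply its linearity.\<close>

definition aug :: "(nat \<times> 'f \<Rightarrow>\<^sub>0 'k) \<Rightarrow> 'k"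
  where "aug x = coef (extend (\<lambda>b. Poly_Mapping.single () (aug_gen (snd b))) x) ()"

text \<open>Multiplying by the complementary monomial preserves the scalar, since the monomial of
  the face \<sigma> survives in the face ring; so the one functional computes \<epsilon> in every
  face degree.\<close>

lemma aug_face_coef:
  assumes s: "\<sigma> \<in> K" and x: "x \<in> chains (tg 0 \<sigma>)"
  shows "face_coef (squarefree_expo \<sigma>) (\<epsilon> (F.lift 0 0 \<sigma> x)) = aug x"
proof -
  have sU: "\<sigma> \<subseteq> {1..m}" and fin\<sigma>: "finite \<sigma>" using K_U[OF s] finite_subset by auto
  have suppK: "supp (squarefree_expo \<sigma>) \<in> K" using s fin\<sigma> by (simp add: keys_sqf)
  define \<chi> where "\<chi> y = face_coef (squarefree_expo \<sigma>) (\<epsilon> y)" for y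
  define S where "S = {b. coef x (0, b) \<noteq> 0}"
  note supp_x = tg_support(1)[OF x, folded S_def] and fin = tg_support(2)[OF x, folded S_def]
    and bS = tg_support(3,4)[OF x, folded S_def] and b_carr = tg_support(5)[OF x, folded S_def]
  have inj: "inj_on (Pair 0) S" by (simp add: inj_on_def)
  let ?t = "\<lambda>b. term_poly (squarefree_expo (\<sigma> - F.sdeg 0 b)) (coef x (0, b))"
  have t_carr: "?t b \<in> carrier R" for b
    using sU by (intro term_poly_carrier sqf_degrees) blast
  have "\<chi> (F.lift 0 0 \<sigma> x) = (\<Sum>b\<in>S. \<chi> (?t b \<odot>\<^bsub>F 0\<^esub> b))"
    unfolding F.lift_expand[OF sU x] S_def[symmetric] \<chi>_def
    using linear_mapD(1,2)[OF \<epsilon>_linear] F.smult_closed[OF t_carr b_carr]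
    by (intro additive_sum[OF F.abelian_monoid_axioms _ fin]) (auto simp: face_coef_add[OF suppK])
  also have "\<dots> = (\<Sum>b\<in>S. coef x (0, b) * aug_gen b)"
  proof (rule sum.cong[OF refl])
    fix b assume b: "b \<in> S"
    let ?\<tau> = "F.sdeg 0 b"
    have tK: "?\<tau> \<in> K" using K_subset[OF s bS(2)[OF b]] .
    have tfin: "finite ?\<tau>" using finite_subset[OF bS(2)[OF b] fin\<sigma>] .
    obtain v where v: "\<epsilon> b = I +>\<^bsub>R\<^esub> term_poly (squarefree_expo ?\<tau>) v"
      using \<epsilon>_homog[OF sqf_degrees[OF F.sdeg(1)[OF bS(1)[OF b]]] sB_homog[OF bS(1)[OF b]]] by (auto simp: M_homog)
    have v_carr: "term_poly (squarefree_expo ?\<tau>) v \<in> carrier R"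
      by (rule term_poly_carrier[OF sqf_degrees[OF K_U[OF tK]]])
    have "\<epsilon> (?t b \<odot>\<^bsub>F 0\<^esub> b) = I +>\<^bsub>R\<^esub> (?t b * term_poly (squarefree_expo ?\<tau>) v)"
      unfolding linear_mapD(3)[OF \<epsilon>_linear t_carr b_carr[OF b]] v by (rule M_smult[OF t_carr v_carr])
    also have "?t b * term_poly (squarefree_expo ?\<tau>) v = term_poly (squarefree_expo \<sigma>) (coef x (0, b) * v)"
      by (simp add: term_poly_mult sqf_add[OF fin\<sigma> bS(2)[OF b]])
    finally have "\<chi> (?t b \<odot>\<^bsub>F 0\<^esub> b) = coef x (0, b) * v"
      unfolding \<chi>_def using face_coef[OF suppK term_poly_carrier[OF sqf_degrees[OF sU]]]
      by (simp add: coef_term_poly)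
    moreover have "aug_gen b = v"
      unfolding aug_gen_def v using face_coef[OF _ v_carr, of "squarefree_expo ?\<tau>"] tK tfin
      by (simp add: keys_sqf coef_term_poly)
    ultimately show "\<chi> (?t b \<odot>\<^bsub>F 0\<^esub> b) = coef x (0, b) * aug_gen b" by simp
  qed
  also have "\<dots> = aug x"
    unfolding aug_def extend_def supp_x by (simp add: sum.reindex[OF inj] lookup_sum)
  finally show ?thesis by (simp add: \<chi>_def)
qed

lemma D_tg_0: "x \<in> chains (tg 0 \<sigma>) \<Longrightarrow> D x = 0"
  by (rule klinear_eq_on_chains[OF D_lin, where g = "\<lambda>_. 0"])
    (auto simp: klinear_def D_gen Dgen_def F.tagged_def)

text \<open>A preimage under \<open>d\<close> may be taken homogeneous and is then the
  homogenization of a chain; \<open>lift_inj\<close> removes the homogenization from the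
  equation.\<close>

lemma preimage_chain:
  assumes s: "\<sigma> \<subseteq> {1..m}" and x: "x \<in> chains (tg n \<sigma>)"
    and w: "w \<in> carrier (F (Suc n))" "d n w = F.lift n n \<sigma> x"
  shows "\<exists>y\<in>chains (tg (Suc n) \<sigma>). D y = x"
proof -
  have "d n w \<in> homog (F n) (squarefree_expo \<sigma>)" unfolding w(2) by (rule F.lift_homog[OF s x])
  from graded_map_homog_preimage[OF F.graded_mod_axioms F.graded_mod_axioms d_graded sqf_degrees[OF s] w(1) this]
  obtain w' where w': "w' \<in> homog (F (Suc n)) (squarefree_expo \<sigma>)" "d n w' = d n w" by blast
  obtain y where y: "y \<in> chains (tg (Suc n) \<sigma>)" "F.lift (Suc n) (Suc n) \<sigma> y = w'"
    using F.lift_surj[OF s w'(1), of "Suc n"] by blast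
  have "F.lift n n \<sigma> (D y) = F.lift n n \<sigma> x"
    unfolding lift_D[OF s y(1)] y(2) w'(2) w(2) ..
  then have "D y = x" using F.lift_inj[OF s D_tg[OF y(1)] x] by blast
  with y(1) show ?thesis by blast
qed

lemma dd_zero: "x \<in> carrier (F (Suc (Suc n))) \<Longrightarrow> d n (d (Suc n) x) = \<zero>\<^bsub>F n\<^esub>"
  using exact_Suc[of n] by blast

text \<open>The requirements hold for the components of the given resolution in degrees
  \<open>squarefree_expo \<sigma>\<close> and are carried over by \<open>lift\<close>, which is
  injective on chains and surjective onto these components.\<close>

lemma F_resolution: "filtered_resolution K sbasis fst smdeg D aug {1..m}"
proof (rule filtered_resolution.intro, unfold tg_eq[symmetric])
  show "\<tau> \<in> K" if "\<sigma> \<in> K" "\<tau> \<subseteq> \<sigma>" for \<sigma> \<tau> using K_subset[OF that] .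
  show "klinear D" by (rule D_lin)
  show "smdeg b \<subseteq> {1..m}" if "b \<in> sbasis" for b
    using that F.sdeg(1)[of "snd b" "fst b"] by (cases b) (simp add: sbasis_def smdeg_def)
  show "D (gen b) = 0" if "b \<in> sbasis" "fst b = 0" for b
    using that(2) by (simp add: D_gen Dgen_def)
  show D_gen_tg: "D (gen b) \<in> chains (tg n (smdeg b))" if "b \<in> sbasis" "fst b = Suc n" for b n
    using that Dgen(1)[of "snd b" n] by (cases b) (simp add: D_gen sbasis_def smdeg_def)
  show "D (D (gen b)) = 0" if b: "b \<in> sbasis" for b
  proof (cases "fst b")
    case 0
    then show ?thesis by (simp add: D_gen Dgen_def klinearD[OF D_lin])
  next
    case (Suc n)
    note Dg = D_gen_tg[OF b Suc]
    show ?thesis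
    proof (cases n)
      case 0
      then show ?thesis using D_tg_0 Dg by blast
    next
      case (Suc l)
      obtain b' where b': "b = (Suc (Suc l), b')" "b' \<in> F.sB (Suc (Suc l))"
        using b \<open>fst b = Suc n\<close> Suc by (cases b) (simp add: sbasis_def)
      have s: "smdeg b \<subseteq> {1..m}" using F.sdeg(1)[OF b'(2)] by (simp add: b'(1) smdeg_def)
      have Dg': "D (gen b) \<in> chains (tg (Suc l) (smdeg b))" using Dg Suc by simp
      have "F.lift (Suc l) (Suc l) (smdeg b) (D (gen b)) = d (Suc l) b'"
        using Dgen(2)[OF b'(2)] by (simp add: D_gen b'(1) smdeg_def)
      moreover have "b' \<in> carrier (F (Suc (Suc l)))"
        using b'(2) F.B_carrier by (simp add: F.sB_def)
      ultimately have "F.lift l l (smdeg b) (D (D (gen b))) = F.lift l l (smdeg b) 0"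
        unfolding lift_D[OF s Dg'] F.lift_zero by (simp add: dd_zero)
      then show ?thesis
        using F.lift_inj[OF s D_tg[OF Dg'], of 0] by (simp add: chains_closed)
    qed
  qed
  show "\<exists>y\<in>chains (tg (Suc (Suc n)) \<sigma>). D y = x"
    if s: "\<sigma> \<subseteq> {1..m}" and x: "x \<in> chains (tg (Suc n) \<sigma>)" "D x = 0" for \<sigma> n x
  proof -
    have "d n (F.lift (Suc n) (Suc n) \<sigma> x) = \<zero>\<^bsub>F n\<^esub>"
      using lift_D[OF s x(1)] by (simp add: x(2) F.lift_zero)
    then have "F.lift (Suc n) (Suc n) \<sigma> x \<in> d (Suc n) ` carrier (F (Suc (Suc n)))"
      unfolding exact_Suc using F.lift_closed[OF s x(1)] by blast
    then obtain w where "w \<in> carrier (F (Suc (Suc n)))" "d (Suc n) w = F.lift (Suc n) (Suc n) \<sigma> x" by auto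
    then show ?thesis by (rule preimage_chain[OF s x(1)])
  qed
  show "aug (x + y) = aug x + aug y" for x y
    by (simp add: aug_def klinearD[OF klinear_extend] lookup_add)
  show "aug (scale c x) = c * aug x" for c x
    by (simp add: aug_def klinearD[OF klinear_extend])
  show "aug (D (gen b)) = 0" if b: "b \<in> sbasis" "fst b = 1" "smdeg b \<in> K" for b
  proof -
    obtain b' where b': "b = (Suc 0, b')" "b' \<in> F.sB (Suc 0)" using b by (cases b) (simp add: sbasis_def)
    have Dg: "D (gen b) \<in> chains (tg 0 (smdeg b))" using D_gen_tg[OF b(1), of 0] b(2) by simp
    have "F.lift 0 0 (smdeg b) (D (gen b)) = d 0 b'"
      using Dgen(2)[OF b'(2)] by (simp add: D_gen b'(1) smdeg_def)
    moreover have "b' \<in> carrier (F 1)"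
      using b'(2) F.B_carrier[of b' "Suc 0"] by (simp add: F.sB_def)
    then have "\<epsilon> (d 0 b') = \<zero>\<^bsub>M\<^esub>" using exact_0' by blast
    ultimately have "aug (D (gen b)) = face_coef (squarefree_expo (smdeg b)) (I +>\<^bsub>R\<^esub> 0)"
      using aug_face_coef[OF b(3) Dg] by (simp add: M_zero)
    also have "\<dots> = 0"
      using face_coef[of "squarefree_expo (smdeg b)" 0] b(3) finite_subset[OF K_U[OF b(3)]] by (simp add: keys_sqf)
    finally show ?thesis .
  qed
  show "\<exists>y\<in>chains (tg 1 \<sigma>). D y = x"
    if s: "\<sigma> \<subseteq> {1..m}" and x: "x \<in> chains (tg 0 \<sigma>)" and a: "\<sigma> \<in> K \<Longrightarrow> aug x = 0" for \<sigma> x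
  proof -
    let ?y = "F.lift 0 0 \<sigma> x"
    have y: "?y \<in> homog (F 0) (squarefree_expo \<sigma>)" by (rule F.lift_homog[OF s x])
    obtain v where v: "\<epsilon> ?y = I +>\<^bsub>R\<^esub> term_poly (squarefree_expo \<sigma>) v"
      using \<epsilon>_homog[OF sqf_degrees[OF s] y] by (auto simp: M_homog)
    \<comment> \<open>For a face the scalar \<open>v\<close> is the augmentation, hence 0; for a
      non-face the monomial itself is in the ideal.\<close>
    have "term_poly (squarefree_expo \<sigma>) v \<in> I"
    proof (cases "\<sigma> \<in> K")
      case True
      have "v = face_coef (squarefree_expo \<sigma>) (\<epsilon> ?y)"
        unfolding v using face_coef[OF _ term_poly_carrier[OF sqf_degrees[OF s]], of "squarefree_expo \<sigma>"] True finite_subset[OF s]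
        by (simp add: keys_sqf coef_term_poly)
      also have "\<dots> = 0" using aug_face_coef[OF True x] a[OF True] by simp
      finally show ?thesis using I.zero_closed by simp
    qed (rule nonface_I[OF s])
    then have "\<epsilon> ?y = \<zero>\<^bsub>M\<^esub>" unfolding v M_zero(1) by (rule coset_mem_I)
    then have "?y \<in> d 0 ` carrier (F 1)"
      unfolding exact_0' using F.lift_closed[OF s x] by blast
    then obtain w where "w \<in> carrier (F (Suc 0))" "d 0 w = ?y" by auto
    from preimage_chain[OF s x this] show ?thesis by simp
  qed
  show "\<exists>x\<in>chains (tg 0 \<sigma>). aug x = 1" if s: "\<sigma> \<in> K" for \<sigma>
  proof -
    have sU: "\<sigma> \<subseteq> {1..m}" and fin: "finite \<sigma>" using K_U[OF s] finite_subset by auto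
    have suppK: "supp (squarefree_expo \<sigma>) \<in> K" using s fin by (simp add: keys_sqf)
    \<comment> \<open>The class of the face monomial has a preimage under \<epsilon>, and only the
      component of degree \<sigma> of this preimage contributes to the coefficient of the
      monomial.\<close>
    let ?p = "term_poly (squarefree_expo \<sigma>) 1 :: 'k mpoly"
    have p: "?p \<in> carrier R" by (rule term_poly_carrier[OF sqf_degrees[OF sU]])
    have "I +>\<^bsub>R\<^esub> ?p \<in> \<epsilon> ` carrier (F 0)" unfolding \<epsilon>_onto M_carrier using p by blast
    then obtain w where w: "w \<in> carrier (F 0)" "\<epsilon> w = I +>\<^bsub>R\<^esub> ?p" by auto
    obtain E u where E: "finite E" "squarefree_expo \<sigma> \<in> E" "E \<subseteq> degrees m"
      and u: "\<And>e. e \<in> E \<Longrightarrow> u e \<in> homog (F 0) e" and wu: "w = finsum (F 0) u E"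
      using F.decomposition_exists[OF w(1) sqf_degrees[OF sU]] by blast
    have uc: "u \<in> E \<rightarrow> carrier (F 0)" using u E(3) F.homog_closed(1) by blast
    define \<chi> where "\<chi> y = face_coef (squarefree_expo \<sigma>) (\<epsilon> y)" for y
    have "\<chi> w = (\<Sum>e\<in>E. \<chi> (u e))"
      unfolding wu \<chi>_def using linear_mapD(1,2)[OF \<epsilon>_linear]
      by (intro additive_sum[OF F.abelian_monoid_axioms _ E(1) uc]) (auto simp: face_coef_add[OF suppK])
    also have "\<dots> = (\<Sum>e\<in>E. if e = squarefree_expo \<sigma> then \<chi> (u (squarefree_expo \<sigma>)) else 0)"
    proof (rule sum.cong[OF refl])
      fix e assume e: "e \<in> E"
      then have deg: "e \<in> degrees m" using E(3) by blast
      obtain v where v: "\<epsilon> (u e) = I +>\<^bsub>R\<^esub> term_poly e v"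
        using \<epsilon>_homog[OF deg u[OF e]] by (auto simp: M_homog)
      have "\<chi> (u e) = coef (term_poly e v) (squarefree_expo \<sigma>)"
        unfolding \<chi>_def v by (rule face_coef[OF suppK term_poly_carrier[OF deg]])
      then show "\<chi> (u e) = (if e = squarefree_expo \<sigma> then \<chi> (u (squarefree_expo \<sigma>)) else 0)"
        by (metis coef_term_poly)
    qed
    also have "\<dots> = \<chi> (u (squarefree_expo \<sigma>))" using E(1,2) by simp
    also have "\<chi> w = 1" unfolding \<chi>_def w(2) using face_coef[OF suppK p] by (simp add: coef_term_poly)
    finally have 1: "\<chi> (u (squarefree_expo \<sigma>)) = 1" ..
    obtain x where x: "x \<in> chains (tg 0 \<sigma>)" "F.lift 0 0 \<sigma> x = u (squarefree_expo \<sigma>)"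
      using F.lift_surj[OF sU u[OF E(2)], of 0] by blast
    have "aug x = 1" using aug_face_coef[OF s x(1)] 1 by (simp add: x(2) \<chi>_def)
    with x(1) show ?thesis by blast
  qed
qed

end

section \<open>Tensoring with the coefficients\<close>

abbreviation (input) "triv \<equiv> trivial_module :: ('k::comm_ring_1 mpoly, 'k) graded_module"

lemma triv_simps [simp]:
  "carrier triv = UNIV" "add triv = (+)" "smult triv = (\<lambda>p c. coef p 0 * c)"
  "homog triv = (\<lambda>a. if a = 0 then UNIV else {0})"
  by (simp_all add: trivial_module_def)

lemma sum_apply: "(\<Sum>i\<in>A. f i) p = (\<Sum>i\<in>A. f i p)" for f :: "'i \<Rightarrow> 'p \<Rightarrow> 'x::comm_monoid_add"
  by (induction A rule: infinite_finite_induct) simp_all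

section \<open>The tensor product of a module with the trivial module\<close>

locale tensor_triv =
  fixes m :: nat and M :: "('k::comm_ring_1 mpoly, 'a) graded_module"
  assumes module: "Module.module (mpoly_ring m) M"
begin

sublocale module "mpoly_ring m" M
  by (rule module)

abbreviation "R \<equiv> mpoly_ring m :: 'k mpoly ring"
abbreviation "T \<equiv> tensor_free R M triv"
abbreviation "KK \<equiv> tensor_kernel R M triv"
abbreviation "TP \<equiv> tensor_product R M triv"

text \<open>Describes the carrier of the free module on pairs by ordinary functions, whose pointwise
  sums and differences then replace the operations of the record.\<close>

definition TF :: "('a \<times> 'k \<Rightarrow> 'k mpoly) set"
  where "TF = {z. (\<forall>p. supp (z p) \<subseteq> degrees m) \<and> (\<forall>p. fst p \<notin> carrier M \<longrightarrow> z p = 0) \<and> finite {p. z p \<noteq> 0}}"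

lemma TF_D: "z \<in> TF \<Longrightarrow> supp (z p) \<subseteq> degrees m" "z \<in> TF \<Longrightarrow> z p \<noteq> 0 \<Longrightarrow> fst p \<in> carrier M"
  "z \<in> TF \<Longrightarrow> finite {p. z p \<noteq> 0}"
  unfolding TF_def by blast+

lemma T_simps:
  "carrier T = TF" "add T = (+)" "zero T = 0" "smult T = (\<lambda>r z p. r * z p)"
proof -
  have "supp (z p) \<subseteq> degrees m" if "\<forall>p\<in>carrier M \<times> UNIV. supp (z p) \<subseteq> degrees m" "\<forall>p. p \<notin> carrier M \<times> UNIV \<longrightarrow> z p = 0"
    for z :: "'a \<times> 'k \<Rightarrow> 'k mpoly" and p
  proof (cases "p \<in> carrier M \<times> UNIV")
    case False
    then have "z p = 0" using that(2) by blast
    then show ?thesis by simp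
  qed (use that(1) in blast)
  note * = this
  have "carrier T = {z. (\<forall>p\<in>carrier M \<times> UNIV. supp (z p) \<subseteq> degrees m) \<and> (\<forall>p. p \<notin> carrier M \<times> UNIV \<longrightarrow> z p = 0) \<and> finite {p. z p \<noteq> 0}}"
    (is "_ = ?T")
    by (simp add: tensor_free_def free_module_def)
  also have "\<dots> = TF"
  proof (intro subset_antisym subsetI)
    fix z assume "z \<in> TF"
    then have z: "\<forall>p. supp (z p) \<subseteq> degrees m" "\<forall>p. fst p \<notin> carrier M \<longrightarrow> z p = 0" "finite {p. z p \<noteq> 0}"
      unfolding TF_def by blast+
    have "z p = 0" if "p \<notin> carrier M \<times> UNIV" for p using z(2) that unfolding mem_Times_iff by blast
    with z(1,3) show "z \<in> ?T"
      by blast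
  next
    fix z :: "'a \<times> 'k \<Rightarrow> 'k mpoly" assume "z \<in> ?T"
    then have z: "\<forall>p\<in>carrier M \<times> UNIV. supp (z p) \<subseteq> degrees m" "\<forall>p. p \<notin> carrier M \<times> UNIV \<longrightarrow> z p = 0" "finite {p. z p \<noteq> 0}"
      by blast+
    have "z p = 0" if "fst p \<notin> carrier M" for p using z(2) that unfolding mem_Times_iff by blast
    with *[OF z(1,2)] z(3) show "z \<in> TF" unfolding TF_def by blast
  qed
  finally show "carrier T = TF" .
qed (auto simp: tensor_free_def free_module_def fun_eq_iff)

lemma TF_closed:
  "0 \<in> TF" "z \<in> TF \<Longrightarrow> z' \<in> TF \<Longrightarrow> z + z' \<in> TF" "r \<in> carrier R \<Longrightarrow> z \<in> TF \<Longrightarrow> (\<lambda>p. r * z p) \<in> TF"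
  "z \<in> TF \<Longrightarrow> - z \<in> TF"
proof -
  show "0 \<in> TF" by (simp add: TF_def)
  show "z + z' \<in> TF" if "z \<in> TF" "z' \<in> TF"
  proof -
    have "finite {p. (z + z') p \<noteq> 0}"
      by (rule finite_subset[of _ "{p. z p \<noteq> 0} \<union> {p. z' p \<noteq> 0}"]) (use that in \<open>auto simp: TF_def\<close>)
    moreover have "supp ((z + z') p) \<subseteq> degrees m" for p
      unfolding plus_fun_apply using that by (intro order_trans[OF keys_add] Un_least TF_D(1))
    ultimately show ?thesis using that by (simp add: TF_def)
  qed
  show "(\<lambda>p. r * z p) \<in> TF" if "r \<in> carrier R" "z \<in> TF"
  proof -
    have "finite {p. r * z p \<noteq> 0}"
      by (rule finite_subset[of _ "{p. z p \<noteq> 0}"]) (use that in \<open>auto simp: TF_def\<close>)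
    then show ?thesis using that mult_degrees[of r m] by (simp add: TF_def)
  qed
  show "- z \<in> TF" if "z \<in> TF" using that by (simp add: TF_def)
qed

lemma T_module: "Module.module R T"
proof (rule moduleI[OF mpoly_cring])
  show "abelian_group T"
  proof (rule abelian_groupI)
    fix z assume "z \<in> carrier T"
    then show "\<exists>y\<in>carrier T. y \<oplus>\<^bsub>T\<^esub> z = \<zero>\<^bsub>T\<^esub>"
      by (intro bexI[of _ "- z"]) (simp_all add: T_simps TF_closed)
  qed (simp_all add: T_simps TF_closed add.assoc add.commute)
qed (auto simp: T_simps TF_closed(3)[simplified] fun_eq_iff algebra_simps)

sublocale T: module R T
  by (rule T_module)

lemma T_minus: "z \<in> TF \<Longrightarrow> \<ominus>\<^bsub>T\<^esub> z = - z"
  by (rule T.add.inv_equality) (simp_all add: T_simps TF_closed)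

lemma submodule_TF:
  assumes "H \<subseteq> TF" "0 \<in> H" "\<And>z z'. z \<in> H \<Longrightarrow> z' \<in> H \<Longrightarrow> z + z' \<in> H"
    "\<And>r z. r \<in> carrier R \<Longrightarrow> z \<in> H \<Longrightarrow> (\<lambda>p. r * z p) \<in> H"
  shows "submodule H R T"
proof (rule T.submoduleI)
  have neg: "- z \<in> H" if "z \<in> H" for z
  proof -
    have "(\<lambda>p. (- 1) * z p) \<in> H" by (rule assms(4)[OF _ that]) (simp add: keys_one)
    moreover have "(\<lambda>p. (- 1) * z p) = - z" by (simp add: fun_eq_iff)
    ultimately show ?thesis by simp
  qed
  then show "\<ominus>\<^bsub>T\<^esub> z \<in> H" if "z \<in> H" for z using that T_minus assms(1) by auto
qed (use assms in \<open>simp_all add: T_simps\<close>)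

definition e :: "'a \<Rightarrow> 'k \<Rightarrow> 'a \<times> 'k \<Rightarrow> 'k mpoly"
  where "e x y = free_gen R (x, y)"

lemma e_apply: "e x y p = (if p = (x, y) then 1 else 0)"
  by (simp add: e_def free_gen_def)

lemma e_TF: "x \<in> carrier M \<Longrightarrow> e x y \<in> TF"
proof -
  assume x: "x \<in> carrier M"
  have "finite {p. e x y p \<noteq> 0}" by (rule finite_subset[of _ "{(x, y)}"]) (auto simp: e_apply)
  then show ?thesis using x by (auto simp: TF_def e_apply split: if_splits)
qed

lemma relators:
  "tensor_relators R M triv =
    {e (x \<oplus>\<^bsub>M\<^esub> x') y - (e x y + e x' y) | x x' y. x \<in> carrier M \<and> x' \<in> carrier M} \<union>
    {e x (y + y') - (e x y + e x y') | x y y'. x \<in> carrier M} \<union>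
    {e (r \<odot>\<^bsub>M\<^esub> x) y - (\<lambda>p. r * e x y p) | r x y. r \<in> carrier R \<and> x \<in> carrier M} \<union>
    {e x (coef r 0 * y) - (\<lambda>p. r * e x y p) | r x y. r \<in> carrier R \<and> x \<in> carrier M}"
proof -
  have minus: "z \<ominus>\<^bsub>T\<^esub> z' = z - z'" if "z' \<in> TF" for z z'
    unfolding a_minus_def T_minus[OF that] by (simp add: T_simps)
  have 1: "e (x \<oplus>\<^bsub>M\<^esub> x') y \<ominus>\<^bsub>T\<^esub> (e x y \<oplus>\<^bsub>T\<^esub> e x' y) = e (x \<oplus>\<^bsub>M\<^esub> x') y - (e x y + e x' y)"
    if "x \<in> carrier M" "x' \<in> carrier M" for x x' y
    using minus[OF TF_closed(2)[OF e_TF[OF that(1)] e_TF[OF that(2)]]] by (simp add: T_simps)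
  have 2: "e x (y + y') \<ominus>\<^bsub>T\<^esub> (e x y \<oplus>\<^bsub>T\<^esub> e x y') = e x (y + y') - (e x y + e x y')"
    if "x \<in> carrier M" for x y y'
    using minus[OF TF_closed(2)[OF e_TF[OF that] e_TF[OF that]]] by (simp add: T_simps)
  have 3: "z \<ominus>\<^bsub>T\<^esub> r \<odot>\<^bsub>T\<^esub> e x y = z - (\<lambda>p. r * e x y p)"
    if "r \<in> carrier R" "x \<in> carrier M" for r x y z
    using minus[OF TF_closed(3)[OF that(1) e_TF[OF that(2)]]] by (simp add: T_simps)
  show ?thesis
    unfolding tensor_relators_def Let_def e_def[symmetric] triv_simps
    using 1 2 3 by (intro arg_cong2[where f = "(\<union>)"] Collect_cong) (auto 0 3 intro!: ex_cong1 simp del: mpoly_ring_simps; metis)+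
qed

lemma relators_TF: "tensor_relators R M triv \<subseteq> TF"
proof -
  have minus: "z - z' \<in> TF" if "z \<in> TF" "z' \<in> TF" for z z'
    using TF_closed(2)[OF that(1) TF_closed(4)[OF that(2)]] by simp
  show ?thesis
    unfolding relators by (auto intro!: minus TF_closed(2) TF_closed(3) e_TF simp del: mpoly_ring_simps)
qed

lemma KK_iff: "z \<in> KK \<longleftrightarrow> (\<forall>H. submodule H R T \<and> tensor_relators R M triv \<subseteq> H \<longrightarrow> z \<in> H)"
  by (auto simp: tensor_kernel_def generated_submodule_def)

text \<open>The induction principle of the kernel: what holds of the relators and is stable under
  the module operations holds throughout.\<close>

lemma KK_min:
  assumes "H \<subseteq> TF" "0 \<in> H" "\<And>z z'. z \<in> H \<Longrightarrow> z' \<in> H \<Longrightarrow> z + z' \<in> H"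
    "\<And>r z. r \<in> carrier R \<Longrightarrow> z \<in> H \<Longrightarrow> (\<lambda>p. r * z p) \<in> H" "tensor_relators R M triv \<subseteq> H" "z \<in> KK"
  shows "z \<in> H"
  using submodule_TF[OF assms(1-4)] assms(5,6) KK_iff by blast

lemma KK_TF: "z \<in> KK \<Longrightarrow> z \<in> TF"
  by (rule KK_min[OF subset_refl TF_closed(1) TF_closed(2) TF_closed(3) relators_TF])

lemma KK_closed:
  "0 \<in> KK" "z \<in> KK \<Longrightarrow> z' \<in> KK \<Longrightarrow> z + z' \<in> KK" "r \<in> carrier R \<Longrightarrow> z \<in> KK \<Longrightarrow> (\<lambda>p. r * z p) \<in> KK"
  "z \<in> KK \<Longrightarrow> - z \<in> KK" "z \<in> KK \<Longrightarrow> z' \<in> KK \<Longrightarrow> z - z' \<in> KK"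
proof -
  have H: "0 \<in> H" "z \<in> H \<Longrightarrow> z' \<in> H \<Longrightarrow> z + z' \<in> H" "r \<in> carrier R \<Longrightarrow> z \<in> H \<Longrightarrow> (\<lambda>p. r * z p) \<in> H"
    if "submodule H R T" for H z z' r
  proof -
    interpret H: submodule H R T by fact
    show "0 \<in> H" using H.one_closed by (simp add: T_simps)
    show "z \<in> H \<Longrightarrow> z' \<in> H \<Longrightarrow> z + z' \<in> H" using H.m_closed[of z z'] by (simp add: T_simps)
    show "r \<in> carrier R \<Longrightarrow> z \<in> H \<Longrightarrow> (\<lambda>p. r * z p) \<in> H" using H.smult_closed[of r z] by (simp add: T_simps)
  qed
  show 0: "0 \<in> KK" unfolding KK_iff using H(1) by blast
  show add: "z + z' \<in> KK" if "z \<in> KK" "z' \<in> KK" for z z' using that unfolding KK_iff using H(2) by blast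
  show mult: "(\<lambda>p. r * z p) \<in> KK" if "r \<in> carrier R" "z \<in> KK" for r z using that unfolding KK_iff using H(3) by blast
  show neg: "- z \<in> KK" if "z \<in> KK" for z
  proof -
    have "(\<lambda>p. (- 1) * z p) \<in> KK" by (rule mult[OF _ that]) (simp add: keys_one)
    moreover have "(\<lambda>p. (- 1) * z p) = - z" by (simp add: fun_eq_iff)
    ultimately show ?thesis by simp
  qed
  show "z - z' \<in> KK" if "z \<in> KK" "z' \<in> KK" using add[OF that(1) neg[OF that(2)]] by simp
qed

lemma relators_KK: "tensor_relators R M triv \<subseteq> KK"
  unfolding KK_iff subset_iff by blast

definition cs :: "('a \<times> 'k \<Rightarrow> 'k mpoly) \<Rightarrow> ('a \<times> 'k \<Rightarrow> 'k mpoly) set"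
  where "cs z = KK +>\<^bsub>T\<^esub> z"

lemma cs_alt: "cs z = {k + z | k. k \<in> KK}"
  unfolding cs_def a_r_coset_def' by (auto simp: T_simps)

lemma cs_self: "z \<in> cs z"
  unfolding cs_alt using KK_closed(1) by force

lemma cs_intro: "k \<in> KK \<Longrightarrow> k + z \<in> cs z"
  unfolding cs_alt by blast

lemma cs_cases:
  assumes "w \<in> cs z"
  obtains k where "w = k + z" "k \<in> KK"
  using assms unfolding cs_alt by (elim CollectE exE conjE)

lemma cs_eq_iff: "cs z = cs z' \<longleftrightarrow> z - z' \<in> KK"
proof
  assume "cs z = cs z'"
  then obtain k where "z = k + z'" "k \<in> KK" using cs_self[of z] unfolding cs_alt by blast
  then show "z - z' \<in> KK" by simp
next
  assume zz: "z - z' \<in> KK"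
  have "k + z = (k + (z - z')) + z'" "k + z' = (k - (z - z')) + z" for k by simp_all
  then show "cs z = cs z'" unfolding cs_alt using KK_closed(2,5)[OF _ zz] by (metis (no_types, lifting))
qed

lemma cs_add: "cs z = cs z' \<Longrightarrow> cs w = cs w' \<Longrightarrow> cs (z + w) = cs (z' + w')"
  unfolding cs_eq_iff by (drule (1) KK_closed(2)) (simp add: algebra_simps)

lemma cs_mult: "r \<in> carrier R \<Longrightarrow> cs z = cs z' \<Longrightarrow> cs (\<lambda>p. r * z p) = cs (\<lambda>p. r * z' p)"
  unfolding cs_eq_iff by (drule (1) KK_closed(3)) (simp add: fun_diff_def right_diff_distrib)

lemma cs_e:
  assumes "x \<in> carrier M"
  shows "x' \<in> carrier M \<Longrightarrow> cs (e (x \<oplus>\<^bsub>M\<^esub> x') y) = cs (e x y + e x' y)"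
    "r \<in> carrier R \<Longrightarrow> cs (e (r \<odot>\<^bsub>M\<^esub> x) y) = cs (\<lambda>p. r * e x y p)"
    "r \<in> carrier R \<Longrightarrow> cs (e x (coef r 0 * y)) = cs (\<lambda>p. r * e x y p)"
  unfolding cs_eq_iff using relators_KK assms unfolding relators by blast+

lemma cs_e_zero: "cs (e \<zero>\<^bsub>M\<^esub> y) = cs 0"
proof -
  have "e \<zero>\<^bsub>M\<^esub> y - (e \<zero>\<^bsub>M\<^esub> y + e \<zero>\<^bsub>M\<^esub> y) \<in> KK"
    using cs_e(1)[of "\<zero>\<^bsub>M\<^esub>" "\<zero>\<^bsub>M\<^esub>" y] unfolding cs_eq_iff by simp
  then show ?thesis unfolding cs_eq_iff using KK_closed(4) by fastforce
qed

lemma cs_e_finsum: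
  assumes "finite A" "h \<in> A \<rightarrow> carrier M"
  shows "cs (e (finsum M h A) y) = cs (\<Sum>i\<in>A. e (h i) y)"
  using assms
proof (induction A rule: finite_induct)
  case (insert i A)
  then have h: "h \<in> A \<rightarrow> carrier M" "h i \<in> carrier M" by auto
  have "cs (e (finsum M h (insert i A)) y) = cs (e (h i) y + e (finsum M h A) y)"
    using insert(1,2) h cs_e(1)[OF h(2) finsum_closed[OF h(1)]] by simp
  also have "\<dots> = cs (e (h i) y + (\<Sum>i\<in>A. e (h i) y))" by (rule cs_add[OF refl insert.IH[OF h(1)]])
  finally show ?case unfolding sum.insert[OF insert(1,2)] .
qed (simp add: cs_e_zero)

text \<open>A polynomial can be moved to the second factor, where only its constant coefficient
  survives, and returns as a constant in front of the tensor with second factor 1.\<close>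

lemma cs_e_smult:
  assumes "r \<in> carrier R" "x \<in> carrier M"
  shows "cs (e (r \<odot>\<^bsub>M\<^esub> x) y) = cs (\<lambda>p. term_poly 0 (coef r 0 * y) * e x 1 p)"
proof -
  have "cs (e (r \<odot>\<^bsub>M\<^esub> x) y) = cs (e x (coef r 0 * y))" using cs_e(2,3)[OF assms(2,1)] by simp
  also have "\<dots> = cs (e x (coef (term_poly 0 (coef r 0 * y)) 0 * 1))" by (simp add: coef_term_poly)
  also have "\<dots> = cs (\<lambda>p. term_poly 0 (coef r 0 * y) * e x 1 p)" by (rule cs_e(3)[OF assms(2)]) (rule term_poly_carrier, simp)
  finally show ?thesis .
qed

lemma TP_simps:
  "carrier TP = cs ` TF" "zero TP = cs 0"
  "cs z \<oplus>\<^bsub>TP\<^esub> cs z' = cs (z + z')" "r \<in> carrier R \<Longrightarrow> r \<odot>\<^bsub>TP\<^esub> cs z = cs (\<lambda>p. r * z p)"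
proof -
  show "carrier TP = cs ` TF"
    by (auto simp: tensor_product_def quotient_module_def A_RCOSETS_def' cs_def T_simps)
  have "cs 0 = KK" unfolding cs_alt by simp
  then show "zero TP = cs 0" by (simp add: tensor_product_def quotient_module_def)
  have "cs z \<oplus>\<^bsub>TP\<^esub> cs z' = {h + h' | h h'. h \<in> cs z \<and> h' \<in> cs z'}"
    by (auto simp: tensor_product_def quotient_module_def set_add_def' T_simps)
  also have "\<dots> = cs (z + z')"
  proof (intro Set.set_eqI iffI)
    fix w assume "w \<in> {h + h' | h h'. h \<in> cs z \<and> h' \<in> cs z'}"
    then obtain h h' where h: "w = h + h'" "h \<in> cs z" "h' \<in> cs z'" by (elim CollectE exE conjE)
    obtain k where k: "h = k + z" "k \<in> KK" using h(2) by (rule cs_cases)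
    obtain k' where k': "h' = k' + z'" "k' \<in> KK" using h(3) by (rule cs_cases)
    have "w = (k + k') + (z + z')" unfolding h(1) k(1) k'(1) by (simp only: ac_simps)
    then show "w \<in> cs (z + z')" using cs_intro[OF KK_closed(2)[OF k(2) k'(2)], of "z + z'"] by (simp only:)
  next
    fix w assume "w \<in> cs (z + z')"
    then obtain k where k: "w = k + (z + z')" "k \<in> KK" by (rule cs_cases)
    have "w = (k + z) + z'" unfolding k(1) by (simp only: add.assoc)
    then show "w \<in> {h + h' | h h'. h \<in> cs z \<and> h' \<in> cs z'}"
      using cs_intro[OF k(2)] cs_self by (intro CollectI exI conjI)
  qed
  finally show "cs z \<oplus>\<^bsub>TP\<^esub> cs z' = cs (z + z')" .
  show "r \<odot>\<^bsub>TP\<^esub> cs z = cs (\<lambda>p. r * z p)" if r: "r \<in> carrier R"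
  proof -
    have *: "cs (\<lambda>p. r * h p) = cs (\<lambda>p. r * z p)" if "h \<in> cs z" for h
    proof (rule cs_mult[OF r])
      obtain k where "h = k + z" "k \<in> KK" using \<open>h \<in> cs z\<close> by (rule cs_cases)
      then show "cs h = cs z" unfolding cs_eq_iff by simp
    qed
    have "r \<odot>\<^bsub>TP\<^esub> cs z = (\<Union>h\<in>cs z. cs (\<lambda>p. r * h p))"
      by (simp add: tensor_product_def quotient_module_def T_simps cs_def)
    also have "\<dots> = (\<Union>h\<in>cs z. cs (\<lambda>p. r * z p))" by (rule SUP_cong[OF refl *])
    also have "\<dots> = cs (\<lambda>p. r * z p)" using cs_self[of z] by blast
    finally show ?thesis .
  qed
qed

text \<open>Components of a tensor product are defined through \<open>generate\<close>, whose
  inverses have to be identified.\<close>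

lemma TP_group: "group (add_monoid TP)"
proof (rule groupI)
  have TF: "\<exists>z\<in>TF. x = cs z" if "x \<in> carrier (add_monoid TP)" for x
    using that TP_simps(1) by auto
  show "x \<otimes>\<^bsub>add_monoid TP\<^esub> y \<in> carrier (add_monoid TP)"
    if xy: "x \<in> carrier (add_monoid TP)" "y \<in> carrier (add_monoid TP)" for x y
  proof -
    obtain z z' where "z \<in> TF" "x = cs z" "z' \<in> TF" "y = cs z'" using TF[OF xy(1)] TF[OF xy(2)] by blast
    then show ?thesis using TF_closed(2) by (simp add: TP_simps(1,3))
  qed
  show "\<one>\<^bsub>add_monoid TP\<^esub> \<in> carrier (add_monoid TP)"
    using TF_closed(1) by (simp add: TP_simps(1,2))
  fix x assume "x \<in> carrier (add_monoid TP)"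
  from TF[OF this] obtain z where z: "z \<in> TF" "x = cs z" by blast
  show "\<one>\<^bsub>add_monoid TP\<^esub> \<otimes>\<^bsub>add_monoid TP\<^esub> x = x" by (simp add: TP_simps(2,3) z)
  show "\<exists>y\<in>carrier (add_monoid TP). y \<otimes>\<^bsub>add_monoid TP\<^esub> x = \<one>\<^bsub>add_monoid TP\<^esub>"
    by (rule bexI[of _ "cs (- z)"]) (simp_all add: z TP_simps(1,2,3) TF_closed)
  fix y w assume "y \<in> carrier (add_monoid TP)" "w \<in> carrier (add_monoid TP)"
  then obtain z' z'' where "y = cs z'" "w = cs z''" using TF by blast
  then show "(x \<otimes>\<^bsub>add_monoid TP\<^esub> y) \<otimes>\<^bsub>add_monoid TP\<^esub> w = x \<otimes>\<^bsub>add_monoid TP\<^esub> (y \<otimes>\<^bsub>add_monoid TP\<^esub> w)"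
    by (simp add: TP_simps(3) z(2) add.assoc)
qed

lemma TP_inv: "z \<in> TF \<Longrightarrow> inv\<^bsub>add_monoid TP\<^esub> cs z = cs (- z)"
  by (rule group.inv_equality[OF TP_group]) (simp_all add: TP_simps(1,2,3) TF_closed)

end

section \<open>Coordinates in the tensor product of a graded free module with the
  coefficients\<close>

context graded_free_mod
begin

sublocale tensor_triv m M
  by unfold_locales

definition coord :: "'a \<Rightarrow> 'a \<Rightarrow> 'k mpoly"
  where "coord x = (THE c. c \<in> FB \<and> x = rep c)"

lemma coord_rep: "c \<in> FB \<Longrightarrow> coord (rep c) = c"
  unfolding coord_def by (rule the_equality) (auto dest: rep_inj)

lemma coord: "x \<in> carrier M \<Longrightarrow> coord x \<in> FB \<and> rep (coord x) = x"
  using rep_surj[of x] coord_rep by auto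

lemma coord_add: "x \<in> carrier M \<Longrightarrow> y \<in> carrier M \<Longrightarrow> coord (x \<oplus>\<^bsub>M\<^esub> y) b = coord x b + coord y b"
proof -
  assume "x \<in> carrier M" "y \<in> carrier M"
  then have xy: "coord x \<in> FB" "coord y \<in> FB" "x \<oplus>\<^bsub>M\<^esub> y = rep (\<lambda>b. coord x b + coord y b)"
    using coord rep_add by auto
  show ?thesis unfolding xy(3) coord_rep[OF FB_add[OF xy(1,2)]] ..
qed

lemma coord_smult: "r \<in> carrier R \<Longrightarrow> x \<in> carrier M \<Longrightarrow> coord (r \<odot>\<^bsub>M\<^esub> x) b = r * coord x b"
proof -
  assume r: "r \<in> carrier R" and "x \<in> carrier M"
  then have x: "coord x \<in> FB" "r \<odot>\<^bsub>M\<^esub> x = rep (\<lambda>b. r * coord x b)"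
    using coord rep_mult by auto
  show ?thesis unfolding x(2) coord_rep[OF FB_mult[OF r x(1)]] ..
qed

lemma coord_basis: "b \<in> B \<Longrightarrow> coord b = (\<lambda>b'. if b' = b then 1 else 0)"
proof -
  assume b: "b \<in> B"
  have one: "1 \<in> carrier R" by (simp add: keys_one)
  have "b = rep (\<lambda>b'. if b' = b then 1 else 0)"
    using rep_single[OF one b] smult_one[OF B_carrier[OF b]] by simp
  then show ?thesis using coord_rep[OF FB_single[OF one b]] by simp
qed

text \<open>Normal form of a tensor: expanding in the basis and moving the coefficients across
  leaves scalar multiples of the classes of \<open>b\<close> \<otimes> 1, with scalars read off from
  the constant coefficients of the coordinates.\<close>

lemma cs_e_rep:
  assumes c: "c \<in> FB"
  shows "cs (e (rep c) y) = cs (\<lambda>p. if snd p = 1 then term_poly 0 (coef (c (fst p)) 0 * y) else 0)"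
proof -
  let ?S = "{b. c b \<noteq> 0}"
  have fin: "finite ?S" by (rule FB_D(3)[OF c])
  have bM: "b \<in> carrier M" if "b \<in> ?S" for b using that B_carrier FB_D(2)[OF c] by blast
  have tm: "cs (e (c b \<odot>\<^bsub>M\<^esub> b) y) = cs (\<lambda>p. term_poly 0 (coef (c b) 0 * y) * e b 1 p)" if "b \<in> ?S" for b
    by (rule cs_e_smult[OF FB_D(1)[OF c] bM[OF that]])
  have sums: "cs (\<Sum>b\<in>S. e (c b \<odot>\<^bsub>M\<^esub> b) y) = cs (\<Sum>b\<in>S. (\<lambda>p. term_poly 0 (coef (c b) 0 * y) * e b 1 p))"
    if "finite S" "S \<subseteq> ?S" for S
    using that
  proof (induction S rule: finite_induct)
    case (insert b S)
    have "b \<in> ?S" "S \<subseteq> ?S" using insert.prems by auto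
    then show ?case
      unfolding sum.insert[OF insert(1,2)] by (intro cs_add tm insert.IH)
  qed simp
  have "cs (e (rep c) y) = cs (\<Sum>b\<in>?S. e (c b \<odot>\<^bsub>M\<^esub> b) y)"
    unfolding rep_def by (rule cs_e_finsum[OF fin]) (rule funcsetI, rule smult_closed[OF FB_D(1)[OF c] bM])
  also have "\<dots> = cs (\<Sum>b\<in>?S. (\<lambda>p. term_poly 0 (coef (c b) 0 * y) * e b 1 p))"
    by (rule sums[OF fin subset_refl])
  also have "(\<Sum>b\<in>?S. (\<lambda>p. term_poly 0 (coef (c b) 0 * y) * e b 1 p))
    = (\<lambda>p. if snd p = 1 then term_poly 0 (coef (c (fst p)) 0 * y) else 0)"
  proof
    fix p :: "'a \<times> 'k"
    have "(\<Sum>b\<in>?S. (\<lambda>p. term_poly 0 (coef (c b) 0 * y) * e b 1 p)) p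
      = (\<Sum>b\<in>?S. term_poly 0 (coef (c b) 0 * y) * e b 1 p)"
      by (rule sum_apply)
    also have "\<dots> = (\<Sum>b\<in>?S. if b = fst p then (if snd p = 1 then term_poly 0 (coef (c (fst p)) 0 * y) else 0) else 0)"
      by (rule sum.cong) (auto simp: e_apply prod_eq_iff)
    also have "\<dots> = (if snd p = 1 then term_poly 0 (coef (c (fst p)) 0 * y) else 0)"
      using fin by auto
    finally show "(\<Sum>b\<in>?S. (\<lambda>p. term_poly 0 (coef (c b) 0 * y) * e b 1 p)) p
      = (if snd p = 1 then term_poly 0 (coef (c (fst p)) 0 * y) else 0)" .
  qed
  finally show ?thesis .
qed

text \<open>A representative of \<open>\<Sum> x\<^sub>b (b \<otimes> 1)\<close>, whose class is \<open>J n x\<close> below.\<close>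

definition zmap :: "nat \<Rightarrow> (nat \<times> 'a \<Rightarrow>\<^sub>0 'k) \<Rightarrow> 'a \<times> 'k \<Rightarrow> 'k mpoly"
  where "zmap n x = (\<lambda>p. if snd p = 1 then term_poly 0 (coef x (n, fst p)) else 0)"

lemma zmap_simps: "zmap n (x + y) = zmap n x + zmap n y" "zmap n (scale c x) = (\<lambda>p. term_poly 0 c * zmap n x p)"
  "zmap n 0 = 0" "zmap n (- x) = - zmap n x"
  by (auto simp: zmap_def fun_eq_iff lookup_add term_poly_add term_poly_mult) (simp add: term_poly_def single_uminus)

lemma zmap_gen: "zmap n (gen (n, b)) = e b 1"
  by (auto simp: zmap_def fun_eq_iff e_apply lookup_single when_def)

lemma tagged_closed: "x \<in> chains (tagged n \<sigma>) \<Longrightarrow> coef x (n, b) \<noteq> 0 \<Longrightarrow> b \<in> B"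
  using tagged_coef[of x n \<sigma> b] by (simp add: sB_def)

lemma zmap_TF: "x \<in> chains (tagged n \<sigma>) \<Longrightarrow> zmap n x \<in> TF"
proof -
  assume x: "x \<in> chains (tagged n \<sigma>)"
  have "{p. zmap n x p \<noteq> 0} \<subseteq> (\<lambda>b. (snd b, 1)) ` supp x"
  proof
    fix p assume "p \<in> {p. zmap n x p \<noteq> 0}"
    then have "snd p = 1" "(n, fst p) \<in> supp x" by (auto simp: zmap_def in_keys_iff split: if_splits)
    then show "p \<in> (\<lambda>b. (snd b, 1)) ` supp x" by (intro image_eqI[of _ _ "(n, fst p)"]) (simp_all add: prod_eq_iff)
  qed
  then have "finite {p. zmap n x p \<noteq> 0}" by (rule finite_subset) simp
  moreover have "supp (zmap n x p) \<subseteq> degrees m" for p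
    using keys_term_poly[of 0 "coef x (n, fst p)"] by (auto simp: zmap_def)
  moreover have "zmap n x p = 0" if "fst p \<notin> carrier M" for p
  proof -
    have "coef x (n, fst p) = 0" using that tagged_closed[OF x, of "fst p"] B_carrier by blast
    then show ?thesis by (simp add: zmap_def)
  qed
  ultimately show ?thesis by (simp add: TF_def)
qed

text \<open>The complementary monomial of \<open>b\<close> acts on \<open>k\<close> as 0 unless it
  is 1, that is, unless \<open>b\<close> has degree \<sigma>. Here the full component is cut down to
  its stratum.\<close>

lemma cs_e_lift:
  assumes s: "\<sigma> \<subseteq> {1..m}" and x: "x \<in> chains (tagged n \<sigma>)"
    and x': "\<And>b. coef x' (n, b) = (if sdeg b = \<sigma> then coef x (n, b) * y else 0)"
  shows "cs (e (lift n \<sigma> x) y) = cs (zmap n x')"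
proof -
  have "coef (lcoords n \<sigma> x b) 0 * y = coef x' (n, b)" for b
  proof (cases "coef x (n, b) = 0")
    case False
    then have b: "b \<in> sB" "sdeg b \<subseteq> \<sigma>" using tagged_coef[OF x] by auto
    have fin: "finite (\<sigma> - sdeg b)" using finite_subset[OF s] by simp
    have "squarefree_expo (\<sigma> - sdeg b) = 0 \<longleftrightarrow> \<sigma> - sdeg b = {}"
      by (simp only: keys_eq_empty[symmetric] keys_sqf[OF fin])
    also have "\<dots> \<longleftrightarrow> sdeg b = \<sigma>" using b by auto
    finally show ?thesis by (simp add: lcoords_def coef_term_poly x')
  qed (simp add: lcoords_def x')
  then show ?thesis
    unfolding lift_def cs_e_rep[OF lcoords_FB[OF s x]] zmap_def by (simp only:)
qed

text \<open>
  Reads off the coefficient of \<open>b \<otimes> 1\<close>. It vanishes on the relators and thus shows that the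
  classes \<open>b \<otimes> 1\<close> are linearly independent over \<open>k\<close>.
\<close>

definition Psi :: "'a \<Rightarrow> ('a \<times> 'k \<Rightarrow> 'k mpoly) \<Rightarrow> 'k"
  where "Psi b z = (\<Sum>p\<in>{p. z p \<noteq> 0}. coef (z p) 0 * (snd p * coef (coord (fst p) b) 0))"

lemma Psi_superset: "finite S \<Longrightarrow> (\<And>p. z p \<noteq> 0 \<Longrightarrow> p \<in> S) \<Longrightarrow>
    Psi b z = (\<Sum>p\<in>S. coef (z p) 0 * (snd p * coef (coord (fst p) b) 0))"
  unfolding Psi_def by (rule sum.mono_neutral_left) auto

lemma Psi_add: "z \<in> TF \<Longrightarrow> z' \<in> TF \<Longrightarrow> Psi b (z + z') = Psi b z + Psi b z'"
proof -
  assume z: "z \<in> TF" "z' \<in> TF"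
  let ?S = "{p. z p \<noteq> 0} \<union> {p. z' p \<noteq> 0}"
  have S: "finite ?S" using TF_D(3)[OF z(1)] TF_D(3)[OF z(2)] by simp
  have "Psi b (z + z') = (\<Sum>p\<in>?S. coef ((z + z') p) 0 * (snd p * coef (coord (fst p) b) 0))"
    by (rule Psi_superset[OF S]) auto
  moreover have "Psi b z = (\<Sum>p\<in>?S. coef (z p) 0 * (snd p * coef (coord (fst p) b) 0))"
    by (rule Psi_superset[OF S]) simp
  moreover have "Psi b z' = (\<Sum>p\<in>?S. coef (z' p) 0 * (snd p * coef (coord (fst p) b) 0))"
    by (rule Psi_superset[OF S]) simp
  ultimately show ?thesis by (simp add: lookup_add distrib_right sum.distrib)
qed

lemma Psi_mult: "z \<in> TF \<Longrightarrow> Psi b (\<lambda>p. r * z p) = coef r 0 * Psi b z"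
proof -
  assume z: "z \<in> TF"
  have "Psi b (\<lambda>p. r * z p) = (\<Sum>p\<in>{p. z p \<noteq> 0}. coef (r * z p) 0 * (snd p * coef (coord (fst p) b) 0))"
    by (rule Psi_superset[OF TF_D(3)[OF z]]) auto
  then show ?thesis by (simp add: Psi_def coef_mult_0 sum_distrib_left mult.assoc)
qed

lemma Psi_minus: "z \<in> TF \<Longrightarrow> Psi b (- z) = - Psi b z"
proof -
  assume "z \<in> TF"
  moreover have "(\<lambda>p. (- 1) * z p) = - z" by (simp add: fun_eq_iff)
  ultimately show ?thesis using Psi_mult[of z b "- 1"] by simp
qed

lemma Psi_e: "Psi b (e x y) = y * coef (coord x b) 0"
proof -
  have "Psi b (e x y) = (\<Sum>p\<in>{(x, y)}. coef (e x y p) 0 * (snd p * coef (coord (fst p) b) 0))"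
    by (rule Psi_superset) (auto simp: e_apply split: if_splits)
  then show ?thesis by (simp add: e_apply)
qed

text \<open>On a pair, \<open>Psi b\<close> is \<open>y\<close> times the constant coefficient of
  the coordinate of \<open>x\<close> at \<open>b\<close>. This is additive in both arguments, and
  balanced over the polynomial ring because constant coefficients are multiplicative.\<close>

lemma Psi_KK: "z \<in> KK \<Longrightarrow> Psi b z = 0"
proof -
  let ?H = "{z \<in> TF. Psi b z = 0}"
  have "tensor_relators R M triv \<subseteq> ?H"
  proof
    fix z assume z: "z \<in> tensor_relators R M triv"
    have zTF: "z \<in> TF" using relators_TF z by blast
    have diff: "Psi b (u - v) = Psi b u - Psi b v" if "u \<in> TF" "v \<in> TF" for u v
      using Psi_add[OF that(1) TF_closed(4)[OF that(2)]] Psi_minus[OF that(2)] by simp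
    from z consider
        (1) x x' y where "z = e (x \<oplus>\<^bsub>M\<^esub> x') y - (e x y + e x' y)" "x \<in> carrier M" "x' \<in> carrier M"
      | (2) x y y' where "z = e x (y + y') - (e x y + e x y')" "x \<in> carrier M"
      | (3) r x y where "z = e (r \<odot>\<^bsub>M\<^esub> x) y - (\<lambda>p. r * e x y p)" "r \<in> carrier R" "x \<in> carrier M"
      | (4) r x y where "z = e x (coef r 0 * y) - (\<lambda>p. r * e x y p)" "r \<in> carrier R" "x \<in> carrier M"
      unfolding relators by blast
    then have "Psi b z = 0"
    proof cases
      case 1
      note TF = e_TF[OF 1(2)] e_TF[OF 1(3)] e_TF[OF a_closed[OF 1(2,3)]]
      show ?thesis
        unfolding 1(1) diff[OF TF(3) TF_closed(2)[OF TF(1,2)]] Psi_add[OF TF(1,2)] Psi_e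
          coord_add[OF 1(2,3)] lookup_add by (simp add: distrib_left)
    next
      case 2
      note TF = e_TF[OF 2(2)]
      show ?thesis
        unfolding 2(1) diff[OF TF TF_closed(2)[OF TF TF]] Psi_add[OF TF TF] Psi_e by (simp add: distrib_right)
    next
      case 3
      note TF = e_TF[OF 3(3)] e_TF[OF smult_closed[OF 3(2,3)]]
      show ?thesis
        unfolding 3(1) diff[OF TF(2) TF_closed(3)[OF 3(2) TF(1)]] Psi_mult[OF TF(1)] Psi_e
          coord_smult[OF 3(2,3)] coef_mult_0 by (simp add: mult.left_commute)
    next
      case 4
      note TF = e_TF[OF 4(3)]
      show ?thesis
        unfolding 4(1) diff[OF TF TF_closed(3)[OF 4(2) TF]] Psi_mult[OF TF] Psi_e by (simp add: mult.assoc)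
    qed
    with zTF show "z \<in> ?H" by blast
  qed
  moreover have "0 \<in> ?H" using TF_closed(1) by (simp add: Psi_def)
  moreover have "z + z' \<in> ?H" if "z \<in> ?H" "z' \<in> ?H" for z z'
    using that TF_closed(2)[of z z'] Psi_add[of z z' b] by simp
  moreover have "(\<lambda>p. r * z p) \<in> ?H" if "r \<in> carrier R" "z \<in> ?H" for r z
    using that(2) TF_closed(3)[OF that(1), of z] Psi_mult[of z b r] by simp
  ultimately have "z \<in> ?H" if "z \<in> KK"
    using KK_min[of ?H z] that by blast
  then show "z \<in> KK \<Longrightarrow> Psi b z = 0" by blast
qed

lemma Psi_zmap: "x \<in> chains (tagged n \<sigma>) \<Longrightarrow> b \<in> B \<Longrightarrow> Psi b (zmap n x) = coef x (n, b)"
proof -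
  assume x: "x \<in> chains (tagged n \<sigma>)" and b: "b \<in> B"
  define S where "S = insert b (snd ` supp x)"
  have S: "finite S" "b \<in> S" by (simp_all add: S_def)
  have "Psi b (zmap n x) = (\<Sum>p\<in>S \<times> {1}. coef (zmap n x p) 0 * (snd p * coef (coord (fst p) b) 0))"
  proof (rule Psi_superset)
    fix p assume "zmap n x p \<noteq> 0"
    then have p: "snd p = 1" "(n, fst p) \<in> supp x" by (auto simp: zmap_def in_keys_iff split: if_splits)
    have "fst p \<in> snd ` supp x" by (rule image_eqI[OF _ p(2)]) simp
    then show "p \<in> S \<times> {1}" using p(1) by (simp add: S_def mem_Times_iff)
  qed (use S in simp)
  also have "\<dots> = (\<Sum>b'\<in>S. coef x (n, b') * coef (coord b' b) 0)"
    unfolding sum.cartesian_product[symmetric, of _ "{1}" S, simplified]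
    by (simp add: sum.cartesian_product' zmap_def coef_term_poly)
  also have "\<dots> = (\<Sum>b'\<in>S. if b' = b then coef x (n, b) else 0)"
  proof (rule sum.cong[OF refl])
    fix b' assume "b' \<in> S"
    show "coef x (n, b') * coef (coord b' b) 0 = (if b' = b then coef x (n, b) else 0)"
    proof (cases "coef x (n, b') = 0")
      case False
      then have "b' \<in> B" by (rule tagged_closed[OF x])
      then show ?thesis by (simp add: coord_basis)
    qed auto
  qed
  also have "\<dots> = coef x (n, b)" using S by simp
  finally show ?thesis .
qed

definition J :: "nat \<Rightarrow> (nat \<times> 'a \<Rightarrow>\<^sub>0 'k) \<Rightarrow> ('a \<times> 'k \<Rightarrow> 'k mpoly) set"
  where "J n x = cs (zmap n x)"

lemma J_inj: "inj_on (J n) (chains (tagged n \<sigma>))"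
proof (rule inj_onI, rule poly_mapping_eqI)
  fix x y b' assume x: "x \<in> chains (tagged n \<sigma>)" and y: "y \<in> chains (tagged n \<sigma>)" and eq: "J n x = J n y"
  show "coef x b' = coef y b'"
  proof (cases "fst b' = n \<and> snd b' \<in> B")
    case True
    then obtain b where b: "b' = (n, b)" "b \<in> B" by (cases b') simp
    have "zmap n x - zmap n y \<in> KK" using eq unfolding J_def cs_eq_iff .
    then have "Psi b (zmap n x + - zmap n y) = 0" using Psi_KK by simp
    then show ?thesis
      using Psi_add[OF zmap_TF[OF x] TF_closed(4)[OF zmap_TF[OF y]], of b] Psi_minus[OF zmap_TF[OF y], of b]
        Psi_zmap[OF x b(2)] Psi_zmap[OF y b(2)] b(1) by simp
  next
    case False
    then have "b' \<notin> tagged n \<sigma>" by (auto simp: tagged_def sB_def)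
    then show ?thesis using coef_mem_chains x y by metis
  qed
qed

definition stratum :: "nat \<Rightarrow> nat set \<Rightarrow> (nat \<times> 'a) set"
  where "stratum n \<sigma> = {(n, b) | b. b \<in> sB \<and> sdeg b = \<sigma>}"

lemma stratum_tagged: "stratum n \<sigma> \<subseteq> tagged n \<sigma>"
  by (auto simp: stratum_def tagged_def)

lemma stratum_chains: "x \<in> chains (stratum n \<sigma>) \<Longrightarrow> x \<in> chains (tagged n \<sigma>)"
  by (rule chains_mono[OF stratum_tagged])

abbreviation "TC \<sigma> \<equiv> tensor_component m M triv (squarefree_expo \<sigma>)"

lemma pure_tensor_cs: "pure_tensor R M triv x y = cs (e x y)"
  by (simp add: pure_tensor_def cs_def e_def)

lemma TC_simps: "add (TC \<sigma>) = add TP" "zero (TC \<sigma>) = J n 0" "smult (TC \<sigma>) = (\<lambda>c z. term_poly 0 c \<odot>\<^bsub>TP\<^esub> z)"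
  by (simp_all add: tensor_component_def Let_def J_def zmap_simps TP_simps)

lemma J_add: "J n (x + y) = J n x \<oplus>\<^bsub>TC \<sigma>\<^esub> J n y"
  by (simp add: TC_simps J_def zmap_simps TP_simps)

lemma J_scale: "J n (scale c x) = c \<odot>\<^bsub>TC \<sigma>\<^esub> J n x"
  unfolding TC_simps J_def zmap_simps by (rule TP_simps(4)[symmetric]) (rule term_poly_carrier, simp)

text \<open>Pure tensors of total degree \<sigma> reduce to combinations of \<open>b\<close>
  \<otimes> 1 with \<open>b\<close> of degree \<sigma>. Conversely the scalar multiples
  \<open>b\<close> \<otimes> \<open>c\<close> of these are pure tensors themselves, so the additive
  subgroup already contains all combinations.\<close>

lemma TC_carrier:
  assumes s: "\<sigma> \<subseteq> {1..m}"
  shows "carrier (TC \<sigma>) = J n ` chains (stratum n \<sigma>)"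
proof -
  let ?G = "{pure_tensor R M triv x y | x y b c.
          b \<in> degrees m \<and> c \<in> degrees m \<and> b + c = squarefree_expo \<sigma> \<and> x \<in> homog M b \<and> y \<in> homog triv c}"
  have carr: "carrier (TC \<sigma>) = generate (add_monoid TP) ?G"
    by (simp add: tensor_component_def Let_def)
  have G_J: "g \<in> J n ` chains (stratum n \<sigma>)" if "g \<in> ?G" for g
  proof -
    obtain x y b c where g: "g = cs (e x y)" and bc: "b \<in> degrees m" "b + c = squarefree_expo \<sigma>"
      and x: "x \<in> homog M b" and y: "y \<in> homog triv c" using \<open>g \<in> ?G\<close> unfolding pure_tensor_cs by blast
    show ?thesis
    proof (cases "c = 0")
      case True
      then have "x \<in> homog M (squarefree_expo \<sigma>)" using x bc by simp
      then obtain x' where x': "x' \<in> chains (tagged n \<sigma>)" "lift n \<sigma> x' = x" using lift_surj[OF s] by blast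
      let ?x = "scale y (gr (\<lambda>b. sdeg (snd b)) \<sigma> x')"
      have "g = J n ?x"
        unfolding g J_def x'(2)[symmetric] by (rule cs_e_lift[OF s x'(1)]) (simp add: mult.commute)
      moreover have "gr (\<lambda>b. sdeg (snd b)) \<sigma> x' \<in> chains (stratum n \<sigma>)"
        unfolding gr_def by (rule chains_mono[OF _ restr_chains[OF x'(1)]]) (auto simp: tagged_def stratum_def)
      ultimately show ?thesis using chains_closed(5) by blast
    next
      case False
      \<comment> \<open>The trivial module is concentrated in degree 0, so in any other degree the
        second factor is 0.\<close>
      then have y0: "y = 0" using y by simp
      obtain w where w: "w \<in> FB" "rep w = x" using rep_surj homog_closed(1)[OF bc(1) x] by blast
      have "g = cs (\<lambda>p. if snd p = 1 then term_poly 0 (coef (w (fst p)) 0 * 0) else 0)"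
        unfolding g y0 w(2)[symmetric] by (rule cs_e_rep[OF w(1)])
      also have "\<dots> = J n 0" unfolding J_def zmap_def by (simp cong: if_cong)
      finally show ?thesis using chains_closed(1) by blast
    qed
  qed
  have J_TF: "J n x \<in> carrier TP" if "x \<in> chains (stratum n \<sigma>)" for x
    using zmap_TF[OF stratum_chains[OF that]] by (simp add: TP_simps J_def)
  have 1: "g \<in> J n ` chains (stratum n \<sigma>)" if "g \<in> generate (add_monoid TP) ?G" for g
    using that
  proof (induction rule: generate.induct)
    case one
    have "\<one>\<^bsub>add_monoid TP\<^esub> = J n 0" by (simp add: TP_simps J_def zmap_simps)
    then show ?case using chains_closed(1) by blast
  next
    case (incl h)
    then show ?case by (rule G_J)
  next
    case (inv h)
    from G_J[OF inv] obtain x where x: "x \<in> chains (stratum n \<sigma>)" "h = J n x" by blast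
    have "inv\<^bsub>add_monoid TP\<^esub> h = J n (- x)"
      unfolding x(2) J_def zmap_simps by (rule TP_inv[OF zmap_TF[OF stratum_chains[OF x(1)]]])
    then show ?case using chains_closed(3)[OF x(1)] by blast
  next
    case (eng h1 h2)
    then obtain x y where "x \<in> chains (stratum n \<sigma>)" "h1 = J n x" "y \<in> chains (stratum n \<sigma>)" "h2 = J n y" by blast
    then show ?case using chains_closed(2) J_add[of n x y \<sigma>] by (auto simp: TC_simps intro!: image_eqI[of _ _ "x + y"])
  qed
  have J0: "J n 0 = \<one>\<^bsub>add_monoid TP\<^esub>" by (simp add: TP_simps J_def zmap_simps)
  have gen_G: "J n (scale c (gen (n, b))) \<in> ?G" if b: "(n, b) \<in> stratum n \<sigma>" for b c
  proof -
    have b: "b \<in> sB" "sdeg b = \<sigma>" using b by (auto simp: stratum_def)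
    have bM: "b \<in> carrier M" using b B_carrier by (simp add: sB_def)
    have "cs (e b (coef (term_poly 0 c) 0 * 1)) = cs (\<lambda>p. term_poly 0 c * e b 1 p)"
      by (rule cs_e(3)[OF bM]) (rule term_poly_carrier, simp)
    then have "J n (scale c (gen (n, b))) = pure_tensor R M triv b c"
      unfolding J_def zmap_simps zmap_gen pure_tensor_cs by (simp add: coef_term_poly)
    moreover have "b \<in> homog M (squarefree_expo \<sigma>)" using bdeg(2)[of b] sdeg(2)[OF b(1)] b by (simp add: sB_def)
    moreover have "c \<in> homog triv 0" by simp
    moreover have "squarefree_expo \<sigma> \<in> degrees m" "0 \<in> degrees m" "squarefree_expo \<sigma> + 0 = squarefree_expo \<sigma>"
      using sqf_degrees[OF s] by simp_all
    ultimately show ?thesis by blast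
  qed
  have 2: "J n x \<in> generate (add_monoid TP) ?G" if x: "x \<in> chains (stratum n \<sigma>)" for x
  proof -
    have "J n (\<Sum>b\<in>A. scale (coef x b) (gen b)) \<in> generate (add_monoid TP) ?G" if "A \<subseteq> supp x" "finite A" for A
      using that(2,1)
    proof (induction A rule: finite_induct)
      case empty
      show ?case using generate.one[of "add_monoid TP" ?G] by (simp add: J0)
    next
      case (insert b A)
      then have "b \<in> stratum n \<sigma>" using x by (auto simp: chains_def)
      then obtain b' where b': "b = (n, b')" "(n, b') \<in> stratum n \<sigma>" by (auto simp: stratum_def)
      have 1: "J n (scale (coef x b) (gen b)) \<in> generate (add_monoid TP) ?G"
        unfolding b'(1) by (rule generate.incl[OF gen_G[OF b'(2)]])
      have "J n (\<Sum>b\<in>insert b A. scale (coef x b) (gen b))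
        = J n (scale (coef x b) (gen b)) \<otimes>\<^bsub>add_monoid TP\<^esub> J n (\<Sum>b\<in>A. scale (coef x b) (gen b))"
        unfolding sum.insert[OF insert(1,2)] J_add[where \<sigma> = \<sigma>] by (simp add: TC_simps)
      then show ?case using generate.eng[OF 1 insert.IH] insert.prems by simp
    qed
    from this[OF subset_refl] show ?thesis using chain_expand[of "supp x" x] by simp
  qed
  show ?thesis unfolding carr using 1 2 by blast
qed

end

section \<open>The differential of the tensored resolution\<close>

context graded_resolution
begin

text \<open>The map \<open>d n\<close> \<otimes> id on representatives; \<open>tensor_map\<close> is
  the union of the cosets of its values.\<close>

definition push :: "nat \<Rightarrow> ('f \<times> 'k \<Rightarrow> 'k mpoly) \<Rightarrow> 'f \<times> 'k \<Rightarrow> 'k mpoly"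
  where "push n z = (\<Sum>p\<in>{p. z p \<noteq> 0}. (\<lambda>q. z p * F.e (d n (fst p)) (snd p) q))"

lemma push_superset:
  assumes "finite S" "\<And>p. z p \<noteq> 0 \<Longrightarrow> p \<in> S"
  shows "push n z q = (\<Sum>p\<in>S. z p * F.e (d n (fst p)) (snd p) q)"
  unfolding push_def sum_apply using assms by (intro sum.mono_neutral_left) auto

lemma push_add:
  assumes z: "z \<in> F.TF (Suc n)" "z' \<in> F.TF (Suc n)"
  shows "push n (z + z') = push n z + push n z'"
proof
  fix q
  let ?S = "{p. z p \<noteq> 0} \<union> {p. z' p \<noteq> 0}"
  have S: "finite ?S" using F.TF_D(3)[OF z(1)] F.TF_D(3)[OF z(2)] by simp
  have "push n (z + z') q = (\<Sum>p\<in>?S. (z + z') p * F.e (d n (fst p)) (snd p) q)"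
    by (rule push_superset[OF S]) auto
  moreover have "push n z q = (\<Sum>p\<in>?S. z p * F.e (d n (fst p)) (snd p) q)"
    by (rule push_superset[OF S]) simp
  moreover have "push n z' q = (\<Sum>p\<in>?S. z' p * F.e (d n (fst p)) (snd p) q)"
    by (rule push_superset[OF S]) simp
  ultimately show "push n (z + z') q = (push n z + push n z') q"
    by (simp add: distrib_right sum.distrib)
qed

lemma push_mult:
  assumes z: "z \<in> F.TF (Suc n)"
  shows "push n (\<lambda>p. r * z p) = (\<lambda>q. r * push n z q)"
proof
  fix q
  have "push n (\<lambda>p. r * z p) q = (\<Sum>p\<in>{p. z p \<noteq> 0}. r * z p * F.e (d n (fst p)) (snd p) q)"
    by (rule push_superset[OF F.TF_D(3)[OF z]]) auto
  moreover have "push n z q = (\<Sum>p\<in>{p. z p \<noteq> 0}. z p * F.e (d n (fst p)) (snd p) q)"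
    by (rule push_superset[OF F.TF_D(3)[OF z]]) simp
  ultimately show "push n (\<lambda>p. r * z p) q = r * push n z q"
    by (simp add: sum_distrib_left mult.assoc)
qed

lemma push_e: "push n (F.e x y) = F.e (d n x) y"
proof
  fix q
  have "push n (F.e x y) q = (\<Sum>p\<in>{(x, y)}. F.e x y p * F.e (d n (fst p)) (snd p) q)"
    by (rule push_superset) (auto simp: F.e_apply split: if_splits)
  also have "\<dots> = F.e (d n x) y q" by (simp add: F.e_apply)
  finally show "push n (F.e x y) q = F.e (d n x) y q" .
qed

lemma push_0: "push n 0 = 0"
  by (simp add: push_def)

lemma push_diff:
  assumes z: "z \<in> F.TF (Suc n)" "z' \<in> F.TF (Suc n)"
  shows "push n (z - z') = push n z - push n z'"
proof -
  have "z - z' \<in> F.TF (Suc n)" using F.TF_closed(2)[OF z(1) F.TF_closed(4)[OF z(2)]] by simp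
  from push_add[OF this z(2)] show ?thesis by simp
qed

text \<open>By linearity of \<open>d n\<close>, each kind of relator goes to a relator of the same
  kind.\<close>

lemma push_KK:
  assumes "z \<in> tensor_kernel R (F (Suc n)) triv"
  shows "push n z \<in> tensor_kernel R (F n) triv"
proof -
  let ?K = "tensor_kernel R (F n) triv"
  let ?H = "{z \<in> F.TF (Suc n). push n z \<in> ?K}"
  have lin: "\<And>x. x \<in> carrier (F (Suc n)) \<Longrightarrow> d n x \<in> carrier (F n)"
    using linear_mapD(1)[OF d_linear] .
  have rel: "tensor_relators R (F (Suc n)) triv \<subseteq> ?H"
  proof
    fix z assume z: "z \<in> tensor_relators R (F (Suc n)) triv"
    have zTF: "z \<in> F.TF (Suc n)" using F.relators_TF z by blast
    from z consider
        (1) x x' y where "z = F.e (x \<oplus>\<^bsub>F (Suc n)\<^esub> x') y - (F.e x y + F.e x' y)" "x \<in> carrier (F (Suc n))" "x' \<in> carrier (F (Suc n))"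
      | (2) x y y' where "z = F.e x (y + y') - (F.e x y + F.e x y')" "x \<in> carrier (F (Suc n))"
      | (3) r x y where "z = F.e (r \<odot>\<^bsub>F (Suc n)\<^esub> x) y - (\<lambda>p. r * F.e x y p)" "r \<in> carrier R" "x \<in> carrier (F (Suc n))"
      | (4) r x y where "z = F.e x (coef r 0 * y) - (\<lambda>p. r * F.e x y p)" "r \<in> carrier R" "x \<in> carrier (F (Suc n))"
      unfolding F.relators by blast
    then have "push n z \<in> tensor_relators R (F n) triv"
    proof cases
      case 1
      note TF = F.e_TF[OF 1(2)] F.e_TF[OF 1(3)] F.e_TF[OF F.a_closed[OF 1(2,3)]]
      have "push n z = F.e (d n x \<oplus>\<^bsub>F n\<^esub> d n x') y - (F.e (d n x) y + F.e (d n x') y)"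
        unfolding 1(1) push_diff[OF TF(3) F.TF_closed(2)[OF TF(1,2)]] push_add[OF TF(1,2)] push_e
          linear_mapD(2)[OF d_linear 1(2,3)] ..
      then show ?thesis unfolding F.relators using lin[OF 1(2)] lin[OF 1(3)] by blast
    next
      case 2
      note TF = F.e_TF[OF 2(2)]
      have "push n z = F.e (d n x) (y + y') - (F.e (d n x) y + F.e (d n x) y')"
        unfolding 2(1) push_diff[OF TF F.TF_closed(2)[OF TF TF]] push_add[OF TF TF] push_e ..
      then show ?thesis unfolding F.relators using lin[OF 2(2)] by blast
    next
      case 3
      note TF = F.e_TF[OF 3(3)] F.e_TF[OF F.smult_closed[OF 3(2,3)]]
      have "push n z = F.e (r \<odot>\<^bsub>F n\<^esub> d n x) y - (\<lambda>p. r * F.e (d n x) y p)"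
        unfolding 3(1) push_diff[OF TF(2) F.TF_closed(3)[OF 3(2) TF(1)]] push_mult[OF TF(1)] push_e
          linear_mapD(3)[OF d_linear 3(2,3)] ..
      then show ?thesis unfolding F.relators using lin[OF 3(3)] 3(2) by blast
    next
      case 4
      note TF = F.e_TF[OF 4(3)]
      have "push n z = F.e (d n x) (coef r 0 * y) - (\<lambda>p. r * F.e (d n x) y p)"
        unfolding 4(1) push_diff[OF TF F.TF_closed(3)[OF 4(2) TF]] push_mult[OF TF] push_e ..
      then show ?thesis unfolding F.relators using lin[OF 4(3)] 4(2) by blast
    qed
    then show "z \<in> ?H" using zTF F.relators_KK[of n] by blast
  qed
  have "0 \<in> ?H" using F.TF_closed(1) F.KK_closed(1) by (simp add: push_0)
  moreover have "z + z' \<in> ?H" if "z \<in> ?H" "z' \<in> ?H" for z z'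
    using that F.TF_closed(2)[of z "Suc n" z'] push_add[of z n z'] F.KK_closed(2)[of "push n z" n "push n z'"] by simp
  moreover have "(\<lambda>p. r * z p) \<in> ?H" if "r \<in> carrier R" "z \<in> ?H" for r z
    using that(2) F.TF_closed(3)[OF that(1), of z "Suc n"] push_mult[of z n r] F.KK_closed(3)[OF that(1), of "push n z" n] by simp
  moreover have "?H \<subseteq> F.TF (Suc n)" by blast
  ultimately have "z \<in> ?H" by (intro F.KK_min[OF _ _ _ _ rel assms])
  then show ?thesis by blast
qed

abbreviation "tmap n \<equiv> tensor_map R (F (Suc n)) (F n) triv (d n)"

text \<open>Two representatives of a coset differ by the kernel, which \<open>push\<close> respects;
  so the union in \<open>tensor_map\<close> is a single coset.\<close>

lemma tmap_cs:
  assumes z: "z \<in> F.TF (Suc n)"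
  shows "tmap n (F.cs (Suc n) z) = F.cs n (push n z)"
proof -
  have sum: "(\<Oplus>\<^bsub>tensor_free R (F n) triv\<^esub>p\<in>{p. h p \<noteq> \<zero>\<^bsub>R\<^esub>}. h p \<odot>\<^bsub>tensor_free R (F n) triv\<^esub> free_gen R (d n (fst p), snd p)) = push n h"
    if h: "h \<in> F.TF (Suc n)" for h
  proof -
    have mem: "(\<lambda>p. h p \<odot>\<^bsub>tensor_free R (F n) triv\<^esub> free_gen R (d n (fst p), snd p)) \<in> {p. h p \<noteq> 0} \<rightarrow> carrier (tensor_free R (F n) triv)"
    proof
      fix p assume "p \<in> {p. h p \<noteq> 0}"
      then have "fst p \<in> carrier (F (Suc n))" using F.TF_D(2)[OF h] by simp
      then have e: "F.e (d n (fst p)) (snd p) \<in> F.TF n" using linear_mapD(1)[OF d_linear] by (intro F.e_TF)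
      have "h p \<in> carrier R" using F.TF_D(1)[OF h] by simp
      from F.TF_closed(3)[OF this e]
      show "h p \<odot>\<^bsub>tensor_free R (F n) triv\<^esub> free_gen R (d n (fst p), snd p) \<in> carrier (tensor_free R (F n) triv)"
        by (simp add: F.T_simps F.e_def)
    qed
    have "(\<Oplus>\<^bsub>tensor_free R (F n) triv\<^esub>p\<in>{p. h p \<noteq> 0}. h p \<odot>\<^bsub>tensor_free R (F n) triv\<^esub> free_gen R (d n (fst p), snd p))
      = (\<Sum>p\<in>{p. h p \<noteq> 0}. h p \<odot>\<^bsub>tensor_free R (F n) triv\<^esub> free_gen R (d n (fst p), snd p))"
      by (rule additive_sum[where \<chi> = "\<lambda>x. x", OF F.T.abelian_monoid_axioms _ F.TF_D(3)[OF h] mem]) (simp add: F.T_simps)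
    then show ?thesis by (simp add: push_def F.T_simps F.e_def)
  qed
  have "tmap n (F.cs (Suc n) z) = (\<Union>h\<in>F.cs (Suc n) z. F.cs n (push n z))"
    unfolding tensor_map_def Let_def
  proof (rule SUP_cong[OF refl])
    fix h assume "h \<in> F.cs (Suc n) z"
    then obtain k where k: "h = k + z" "k \<in> tensor_kernel R (F (Suc n)) triv" by (rule F.cs_cases)
    have kTF: "k \<in> F.TF (Suc n)" by (rule F.KK_TF[OF k(2)])
    have h: "h \<in> F.TF (Suc n)" unfolding k(1) by (rule F.TF_closed(2)[OF kTF z])
    have "F.cs n (push n h) = F.cs n (push n z)"
      unfolding F.cs_eq_iff k(1) push_add[OF kTF z] using push_KK[OF k(2)] by simp
    then show "tensor_kernel R (F n) triv +>\<^bsub>tensor_free R (F n) triv\<^esub>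
        (\<Oplus>\<^bsub>tensor_free R (F n) triv\<^esub>p\<in>{p. h p \<noteq> \<zero>\<^bsub>R\<^esub>}. h p \<odot>\<^bsub>tensor_free R (F n) triv\<^esub> free_gen R (d n (fst p), snd p))
      = F.cs n (push n z)"
      unfolding sum[OF h] F.cs_def .
  qed
  also have "\<dots> = F.cs n (push n z)" using F.cs_self[of z "Suc n"] by blast
  finally show ?thesis .
qed

sublocale res: filtered_resolution K sbasis fst smdeg D aug "{1..m}"
  by (rule F_resolution)

lemma str_stratum: "res.str n \<sigma> = chains (F.stratum n n \<sigma>)"
proof -
  have "{b \<in> sbasis. fst b = n \<and> smdeg b = \<sigma>} = F.stratum n n \<sigma>"
    by (auto simp: sbasis_def smdeg_def F.stratum_def)
  then show ?thesis by (simp add: res.str_def)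
qed

text \<open>For a basis element \<open>b\<close> of degree \<sigma>, \<open>d n b\<close> is the
  homogenization of \<open>Dgen\<close> in degree \<sigma>. Tensoring keeps the part of degree
  exactly \<sigma>, and this is the graded differential.\<close>

lemma tmap_J:
  assumes s: "\<sigma> \<subseteq> {1..m}" and x: "x \<in> res.str (Suc n) \<sigma>"
  shows "tmap n (F.J (Suc n) (Suc n) x) = F.J n n (res.grD \<sigma> x)"
proof -
  let ?z = "F.zmap (Suc n)"
  have xc: "x \<in> chains (F.stratum (Suc n) (Suc n) \<sigma>)" using x by (simp add: str_stratum)
  have z_TF: "?z y \<in> F.TF (Suc n)" if "y \<in> chains (F.stratum (Suc n) (Suc n) \<sigma>)" for y
    by (rule F.zmap_TF[OF F.stratum_chains[OF that]])
  have gen: "F.cs n (push n (?z (scale c (gen b)))) = F.cs n (F.zmap n (res.grD \<sigma> (scale c (gen b))))"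
    if b: "b \<in> F.stratum (Suc n) (Suc n) \<sigma>" for b c
  proof -
    obtain b' where b': "b = (Suc n, b')" "b' \<in> F.sB (Suc n)" "F.sdeg (Suc n) b' = \<sigma>"
      using b by (auto simp: F.stratum_def)
    have b'M: "b' \<in> carrier (F (Suc n))" using b'(2) F.B_carrier by (simp add: F.sB_def)
    have c: "term_poly 0 c \<in> carrier R" by (rule term_poly_carrier) simp
    have Dg: "Dgen (Suc n, b') \<in> chains (tg n \<sigma>)" using Dgen(1)[OF b'(2)] unfolding b'(3) .
    have e: "F.cs n (F.e (d n b') 1) = F.cs n (F.zmap n (gr smdeg \<sigma> (Dgen b)))"
      unfolding Dgen(2)[OF b'(2), symmetric] b'(3)
      by (rule F.cs_e_lift[OF s Dg]) (simp add: b'(1) smdeg_def)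
    have "F.cs n (push n (?z (scale c (gen b)))) = F.cs n (\<lambda>q. term_poly 0 c * F.e (d n b') 1 q)"
      unfolding F.zmap_simps b'(1) F.zmap_gen push_mult[OF F.e_TF[OF b'M]] push_e ..
    also have "\<dots> = F.cs n (\<lambda>q. term_poly 0 c * F.zmap n (gr smdeg \<sigma> (Dgen b)) q)"
      by (rule F.cs_mult[OF c e])
    also have "(\<lambda>q. term_poly 0 c * F.zmap n (gr smdeg \<sigma> (Dgen b)) q) = F.zmap n (res.grD \<sigma> (scale c (gen b)))"
      unfolding klinearD(2)[OF res.klinear_grD] F.zmap_simps by (simp add: res.grD_def D_gen)
    finally show ?thesis .
  qed
  \<comment> \<open>The extension from basis elements to chains goes summand by summand, since
    \<open>push\<close> is shown to be additive on the carrier of the free module only.\<close>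
  have "F.cs n (push n (?z (\<Sum>b\<in>A. scale (coef x b) (gen b)))) = F.cs n (F.zmap n (res.grD \<sigma> (\<Sum>b\<in>A. scale (coef x b) (gen b))))"
    if "finite A" "A \<subseteq> supp x" for A
    using that
  proof (induction A rule: finite_induct)
    case empty
    show ?case unfolding sum.empty klinearD(3)[OF res.klinear_grD] F.zmap_simps(3) push_0 ..
  next
    case (insert b A)
    have st: "b' \<in> F.stratum (Suc n) (Suc n) \<sigma>" if "b' \<in> insert b A" for b'
      using xc insert.prems that unfolding chains_def by blast
    have bs: "b \<in> F.stratum (Suc n) (Suc n) \<sigma>" by (rule st) simp
    have m1: "scale (coef x b) (gen b) \<in> chains (F.stratum (Suc n) (Suc n) \<sigma>)"
      by (intro chains_closed(5,7) bs)
    have m2: "(\<Sum>b\<in>A. scale (coef x b) (gen b)) \<in> chains (F.stratum (Suc n) (Suc n) \<sigma>)"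
      by (intro chains_closed(5,6,7) st) simp
    show ?case
      unfolding sum.insert[OF insert(1,2)] klinearD(1)[OF res.klinear_grD] F.zmap_simps(1) push_add[OF z_TF[OF m1] z_TF[OF m2]]
      using insert.prems by (intro F.cs_add gen[OF bs] insert.IH) blast
  qed
  from this[OF finite_keys subset_refl]
  have "F.cs n (push n (?z x)) = F.cs n (F.zmap n (res.grD \<sigma> x))"
    using chain_expand[OF finite_keys subset_refl, of x] by simp
  then show ?thesis
    unfolding F.J_def tmap_cs[OF z_TF[OF xc]] .
qed

lemma Tor_presented:
  assumes s: "\<sigma> \<subseteq> {1..m}"
  defines "C \<equiv> \<lambda>n. tensor_component m (F n) triv (squarefree_expo \<sigma>)"
  shows "presented_quotient ((C q)\<lparr>carrier := cycles C tmap q\<rparr>) (tmap q ` carrier (C (Suc q)))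
    (F.J q q) (res.grZ q \<sigma>) (res.grB q \<sigma>)"
proof (rule res.presented_homology[where s = 1 and g = "\<lambda>n. F.J n n"])
  show "carrier (C n) = F.J n n ` res.str n \<sigma>" for n
    unfolding C_def str_stratum by (rule F.TC_carrier[OF s])
  show "inj_on (F.J n n) (res.str n \<sigma>)" for n
    unfolding str_stratum by (rule inj_on_subset[OF F.J_inj]) (use F.stratum_chains in blast)
  show "F.J n n (x + y) = F.J n n x \<oplus>\<^bsub>C n\<^esub> F.J n n y" for n x y
    unfolding C_def by (rule F.J_add)
  show "F.J n n (scale c x) = c \<odot>\<^bsub>C n\<^esub> F.J n n x" for n c x
    unfolding C_def by (rule F.J_scale)
  show "\<zero>\<^bsub>C n\<^esub> = F.J n n 0" for n
    unfolding C_def by (rule F.TC_simps(2))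
  show "tmap n (F.J (Suc n) (Suc n) x) = F.J n n (scale 1 (res.grD \<sigma> x))" if "x \<in> res.str (Suc n) \<sigma>" for n x
    using tmap_J[OF s that] by simp
qed simp

end

section \<open>Star and link\<close>

lemma presented_gr_iso:
  fixes N :: "('k::comm_ring_1, 'n, 'u) module_scheme" and N' :: "('k, 'p, 'v) module_scheme"
  assumes "two_filtered_resolutions K B hdeg mdeg D aug U B' hdeg' mdeg' D' aug'"
    and "presented_quotient N H g (filtered_resolution.grZ B hdeg mdeg D n a) (filtered_resolution.grB B hdeg mdeg D n a)"
    and "presented_quotient N' H' g' (filtered_resolution.grZ B' hdeg' mdeg' D' n a) (filtered_resolution.grB B' hdeg' mdeg' D' n a)"
  shows "module_isomorphic (coeff_ring :: 'k ring) (quotient_module N H) (quotient_module N' H')"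
  by (rule gr_homology_iso[OF assms(1), of n a]) (rule presented_quotient_iso[OF assms(2,3)])

text \<open>A set \<rho> lies in \<tau> \<union> \<omega> exactly when
  \<open>\<rho> - \<omega>\<close> lies in \<tau>. That \<tau> itself is a face then follows, as it
  is smaller than \<tau> \<union> \<omega>.\<close>

lemma star_complex_of: "star (complex_of m P) \<omega> = complex_of m (compression \<omega> P)" if "\<omega> \<subseteq> {1..m}"
proof (intro Set.set_eqI iffI)
  fix \<tau> assume "\<tau> \<in> star (complex_of m P) \<omega>"
  then have t: "\<tau> \<subseteq> {1..m}" "\<not> (\<exists>\<rho>\<in>set P. \<rho> \<subseteq> \<tau> \<union> \<omega>)" by (auto simp: star_def complex_of_def)
  have "\<not> \<rho> - \<omega> \<subseteq> \<tau>" if "\<rho> \<in> set P" for \<rho> using t(2) that by blast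
  then show "\<tau> \<in> complex_of m (compression \<omega> P)" using t(1) by (simp add: complex_of_def compression_def)
next
  fix \<tau> assume "\<tau> \<in> complex_of m (compression \<omega> P)"
  then have t: "\<tau> \<subseteq> {1..m}" "\<forall>\<rho>\<in>set P. \<not> \<rho> - \<omega> \<subseteq> \<tau>" by (simp_all add: complex_of_def compression_def)
  have "\<not> \<rho> \<subseteq> \<tau> \<union> \<omega>" if "\<rho> \<in> set P" for \<rho> using t(2) that by blast
  moreover from this have "\<not> \<rho> \<subseteq> \<tau>" if "\<rho> \<in> set P" for \<rho> using that by blast
  ultimately show "\<tau> \<in> star (complex_of m P) \<omega>" using t(1) \<open>\<omega> \<subseteq> {1..m}\<close> by (simp add: star_def complex_of_def)
qed

lemma complex_of_subset: "\<sigma> \<in> complex_of m Q \<Longrightarrow> \<tau> \<subseteq> \<sigma> \<Longrightarrow> \<tau> \<in> complex_of m Q"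
  unfolding complex_of_def by blast

text \<open>Disjointness from \<omega> is all that distinguishes the link from the star.\<close>

lemma link_eq_faces:
  assumes "\<omega> \<subseteq> {1..m}"
  shows "link (complex_of m P) \<omega> = {c \<in> complex_of m (compression \<omega> P). c \<subseteq> {1..m} - \<omega>}"
proof -
  have "link (complex_of m P) \<omega> = {c \<in> star (complex_of m P) \<omega>. c \<inter> \<omega> = {}}"
    by (auto simp: link_def star_def)
  also have "\<dots> = {c \<in> complex_of m (compression \<omega> P). c \<inter> \<omega> = {}}" by (simp only: star_complex_of[OF assms])
  also have "\<dots> = {c \<in> complex_of m (compression \<omega> P). c \<subseteq> {1..m} - \<omega>}"
    unfolding complex_of_def by blast
  finally show ?thesis .
qed

text \<open>By closure under subsets, an intersection of a face with \<sigma> is itself a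
  face.\<close>

lemma full_subcomplex_eq_faces:
  "full_subcomplex (complex_of m Q) \<sigma> = {c \<in> complex_of m Q. c \<subseteq> \<sigma>}"
proof (intro Set.set_eqI iffI)
  fix c assume "c \<in> full_subcomplex (complex_of m Q) \<sigma>"
  then obtain \<tau> where "\<tau> \<in> complex_of m Q" "c = \<tau> \<inter> \<sigma>" by (auto simp: full_subcomplex_def)
  then show "c \<in> {c \<in> complex_of m Q. c \<subseteq> \<sigma>}" using complex_of_subset[of \<tau> m Q c] by blast
next
  fix c assume "c \<in> {c \<in> complex_of m Q. c \<subseteq> \<sigma>}"
  then have "c = c \<inter> \<sigma>" "c \<in> complex_of m Q" by auto
  then show "c \<in> full_subcomplex (complex_of m Q) \<sigma>" unfolding full_subcomplex_def by blast
qed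

text \<open>Taylor's resolution and the one obtained from \<open>F\<close> belong to the same
  complex, so their graded pieces at \<sigma> have the same homology; the first piece is the
  exterior complex, the second computes Tor.\<close>

theorem \<Lambda>_homology_Tor:
  fixes F :: "nat \<Rightarrow> ('k::comm_ring_1 mpoly, 'f) graded_module"
  assumes Q: "simplicial_complement m Q" and res: "graded_free_resolution m (face_ring m (complex_of m Q)) F d \<epsilon>"
    and \<sigma>: "\<sigma> \<subseteq> {1..m}"
  shows "module_isomorphic (coeff_ring :: 'k ring) (\<Lambda>_homology Q q \<sigma>)
    (Tor_component m F d trivial_module q (squarefree_expo \<sigma>))"
proof -
  \<comment> \<open>Freeness provides a homogeneous basis of each module separately; they are then
    collected into one family by choice.\<close>
  have "\<exists>B. graded_free_mod m (F n) B" for n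
  proof -
    have free: "graded_free m (F n)" using res by (simp add: graded_free_resolution_def)
    then obtain B where "B \<subseteq> (\<Union>a\<in>degrees m. homog (F n) a)"
      "\<forall>x\<in>carrier (F n). \<exists>!c. c \<in> carrier (free_module (mpoly_ring m) B) \<and> x = (\<Oplus>\<^bsub>F n\<^esub>b\<in>{b. c b \<noteq> 0}. c b \<odot>\<^bsub>F n\<^esub> b)"
      unfolding graded_free_def by (elim conjE exE)
    moreover have "graded_module m (F n)" using free by (simp add: graded_free_def)
    ultimately have "graded_free_mod m (F n) B"
      by (intro graded_free_mod.intro graded_mod.intro graded_free_mod_axioms.intro) blast+
    then show ?thesis ..
  qed
  then have "\<exists>B. \<forall>n. graded_free_mod m (F n) (B n)" by (intro choice allI)
  then obtain B where B: "\<And>n. graded_free_mod m (F n) (B n)" by blast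
  have "face_ring_of m (complex_of m Q)"
    by (rule face_ring_of.intro) (erule (1) complex_of_subset, simp add: complex_of_def)
  interpret G: graded_resolution m "complex_of m Q" "TYPE('k)" F d \<epsilon> B
    by (rule graded_resolution.intro[OF \<open>face_ring_of m (complex_of m Q)\<close> graded_resolution_axioms.intro[OF res B]])
  have "two_filtered_resolutions (complex_of m Q) (taylor_basis Q) (\<lambda>b. card (fst b)) (taylor_deg Q)
    (koszul (\<lambda>_ _. False)) (\<lambda>x. coef x ({}, {})) {1..m} G.sbasis fst G.smdeg G.D G.aug"
    by (intro two_filtered_resolutions.intro taylor_resolution[OF Q] G.F_resolution)
  from presented_gr_iso[OF this \<Lambda>_homology_presented[OF Q] G.Tor_presented[OF \<sigma>]]
  show ?thesis unfolding \<Lambda>_homology_def Tor_component_def homology_def .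
qed

text \<open>Hochster's formula for the exterior complex, for every \<open>V\<close>. The link is the
  case of the compression with \<open>V\<close> the complement of \<omega>.\<close>

theorem \<Lambda>_homology_cohomology:
  assumes Q: "simplicial_complement m Q" and V: "V \<subseteq> {1..m}"
  shows "module_isomorphic (coeff_ring :: 'k::comm_ring_1 ring) (\<Lambda>_homology Q q V)
    (reduced_cohomology {c \<in> complex_of m Q. c \<subseteq> V} (int (card V) - int q - 1))"
proof -
  have two: "two_filtered_resolutions (complex_of m Q) (taylor_basis Q) (\<lambda>b. card (fst b)) (taylor_deg Q)
    (koszul (\<lambda>_ _. False) :: _ \<Rightarrow> _ \<Rightarrow>\<^sub>0 'k) (\<lambda>x. coef x ({}, {})) {1..m} (cube_basis (complex_of m Q) {1..m})
    (\<lambda>b. card (fst b)) (\<lambda>b. fst b \<union> snd b) (koszul (\<lambda>c i. insert i c \<in> complex_of m Q))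
    (\<lambda>x. \<Sum>c\<in>complex_of m Q. coef x ({}, c))"
  proof (rule two_filtered_resolutions.intro[OF taylor_resolution[OF Q] cube_resolution])
    show "\<tau> \<in> complex_of m Q" if "\<sigma> \<in> complex_of m Q" "\<tau> \<subseteq> \<sigma>" for \<sigma> \<tau>
      by (rule complex_of_subset[OF that])
    show "\<sigma> \<subseteq> {1..m}" if "\<sigma> \<in> complex_of m Q" for \<sigma> using that by (simp add: complex_of_def)
  qed simp
  show ?thesis
    unfolding \<Lambda>_homology_def homology_def reduced_cohomology_def
  proof (rule presented_gr_iso[OF two \<Lambda>_homology_presented[OF Q] reduced_cohomology_presented])
    show "\<tau> \<in> complex_of m Q" if "\<sigma> \<in> complex_of m Q" "\<tau> \<subseteq> \<sigma>" for \<sigma> \<tau>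
      by (rule complex_of_subset[OF that])
    show "\<sigma> \<subseteq> {1..m}" if "\<sigma> \<in> complex_of m Q" for \<sigma> using that by (simp add: complex_of_def)
  qed (use V in simp_all)
qed

theorem theorem4p7:
  fixes m :: nat and P :: "nat set list" and \<omega> :: "nat set"
    and F :: "nat \<Rightarrow> ('k::comm_ring_1 mpoly, 'f) graded_module"
    and d :: "nat \<Rightarrow> 'f \<Rightarrow> 'f"
    and \<epsilon> :: "'f \<Rightarrow> 'k mpoly set"
  assumes "principal_domain (coeff_ring :: 'k ring)"
    and "simplicial_complement m P"
    and "\<omega> \<subseteq> {1..m}"
  shows
    "star (complex_of m P) \<omega> = complex_of m (compression \<omega> P) \<and>
     (graded_free_resolution m (face_ring m (star (complex_of m P) \<omega>)) F d \<epsilon> \<longrightarrow>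
       (\<forall>q \<sigma>. \<sigma> \<subseteq> {1..m} \<longrightarrow>
         module_isomorphic (coeff_ring :: 'k ring)
           (\<Lambda>_homology (compression \<omega> P) q \<sigma>)
           (Tor_component m F d trivial_module q (squarefree_expo \<sigma>)))) \<and>
     link (complex_of m P) \<omega> = full_subcomplex (complex_of m (compression \<omega> P)) ({1..m} - \<omega>) \<and>
     (\<forall>q. module_isomorphic (coeff_ring :: 'k ring)
       (\<Lambda>_homology (compression \<omega> P) q ({1..m} - \<omega>))
       (reduced_cohomology (link (complex_of m P) \<omega>) (int m - int (card \<omega>) - int q - 1)))"
proof -
  let ?Q = "compression \<omega> P" and ?V = "{1..m} - \<omega>"
  have Q: "simplicial_complement m ?Q"
    using assms(2) by (auto simp: simplicial_complement_def compression_def)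
  have star: "star (complex_of m P) \<omega> = complex_of m ?Q"
    by (rule star_complex_of[OF assms(3)])
  have link: "link (complex_of m P) \<omega> = {c \<in> complex_of m ?Q. c \<subseteq> ?V}"
    by (rule link_eq_faces[OF assms(3)])
  \<comment> \<open>The bound on \<open>card \<omega>\<close> keeps the subtraction of natural
    numbers from truncating, so that it agrees with the one in the integers.\<close>
  have "card ?V = m - card \<omega>" "card \<omega> \<le> m"
    using card_Diff_subset[of \<omega> "{1..m}"] finite_subset[OF assms(3)] card_mono[OF _ assms(3)] assms(3) by auto
  then have "int (card ?V) = int m - int (card \<omega>)" by linarith
  with \<Lambda>_homology_cohomology[OF Q, of ?V, where 'k = 'k]
  have "module_isomorphic (coeff_ring :: 'k ring) (\<Lambda>_homology ?Q q ?V)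
      (reduced_cohomology (link (complex_of m P) \<omega>) (int m - int (card \<omega>) - int q - 1))" for q
    unfolding link by simp
  moreover have "link (complex_of m P) \<omega> = full_subcomplex (complex_of m ?Q) ?V"
    unfolding link full_subcomplex_eq_faces ..
  ultimately show ?thesis
    unfolding star using \<Lambda>_homology_Tor[OF Q] by (intro conjI impI allI refl)
qed

end
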